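(* Let $S$ be the inverse monoid $\mathrm{FHP}/\boldsymbol\lambda$ (under composition). The following groups are isomorphic: (1) the group $\mathrm{FHP}/\boldsymbol{\lambda\eta}$ (under composition) of invertible elements of $\boldsymbol{\lambda\eta}$; (2) the group $S/\sigma_S$; (3) the group of maximal elements of $S$ with respect to the natural order, with product $t\cdot u:=(tu)^{\mathfrak m}$, where $s^{\mathfrak m}$ denotes the unique maximal element of $\{v\in S: s\le v\}$.
   Context: $\Lambda$ is the set of $\lambda$-terms; $\mathbf I=\lambda x.x$, $\mathbf B=\lambda fgx.f(gx)$, $M\circ N:=\mathbf BMN$. $\boldsymbol\lambda$ is $\beta$-conversion and $\boldsymbol{\lambda\eta}$ is $\beta\eta$-conversion. $\mathscr{HP}(x)$ is the largest set of Böhm-like trees such that each $T\in\mathscr{HP}(x)$ has the form $\lambda x_1\ldots x_n.x\,T_1\cdots T_n$ for some $n$, permutation $\pi$ of $\{1,..,n\}$ and $T_i\in\mathscr{HP}(x_{\pi i})$; $\mathscr{HP}=\{\lambda x.T:T\in\mathscr{HP}(x)\}$; $\mathrm{FHP}$ is the set of $\lambda$-terms whose Böhm tree is a finite element of $\mathscr{HP}$. $\mathrm{FHP}/\mathcal T$ denotes the set of $\mathcal T$-classes of elements of $\mathrm{FHP}$, closed under $\circ$ with unit $\mathbf I$. In an inverse monoid (monoid with $^*$ satisfying $(u^* )^*=u$, $(uv)^*=v^*u^*$, $uu^*u=u$, $uu^*vv^*=vv^*uu^*$) the natural order is $u\le v$ iff $uu^*v=u$, and $\sigma_S$ is the relation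 $t\,\sigma_S\,u$ iff some $w$ satisfies $w\le t$ and $w\le u$ (a congruence with group quotient). *)

theory Defs
  imports "HOL-Algebra.Group" "HOL-Combinatorics.Permutations"
begin

section \<open>Lambda-terms and conversion\<close>

text \<open>Lambda-terms modulo alpha-conversion, in de Bruijn notation; open terms are included.\<close>

datatype tm = Var nat | App tm tm | Abs tm

primrec lift :: "tm \<Rightarrow> nat \<Rightarrow> tm" where
  "lift (Var i) k = (if i < k then Var i else Var (Suc i))"
| "lift (App s t) k = App (lift s k) (lift t k)"
| "lift (Abs s) k = Abs (lift s (Suc k))"

primrec subst :: "tm \<Rightarrow> tm \<Rightarrow> nat \<Rightarrow> tm" where
  "subst (Var i) u k = (if k < i then Var (i - 1) else if i = k then u else Var i)"
| "subst (App s t) u k = App (subst s u k) (subst t u k)"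
| "subst (Abs s) u k = Abs (subst s (lift u 0) (Suc k))"

inductive beta :: "tm \<Rightarrow> tm \<Rightarrow> bool" where
  "beta (App (Abs s) t) (subst s t 0)"
| "beta s s' \<Longrightarrow> beta (App s t) (App s' t)"
| "beta t t' \<Longrightarrow> beta (App s t) (App s t')"
| "beta s s' \<Longrightarrow> beta (Abs s) (Abs s')"

inductive eta :: "tm \<Rightarrow> tm \<Rightarrow> bool" where
  "eta (Abs (App (lift s 0) (Var 0))) s"
| "eta s s' \<Longrightarrow> eta (App s t) (App s' t)"
| "eta t t' \<Longrightarrow> eta (App s t) (App s t')"
| "eta s s' \<Longrightarrow> eta (Abs s) (Abs s')"

definition beta_conv :: "(tm \<times> tm) set" where
  "beta_conv = {(s, t). equivclp beta s t}"

definition beta_eta_conv :: "(tm \<times> tm) set" where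
  "beta_eta_conv = {(s, t). equivclp (sup beta eta) s t}"

definition comb_I :: tm where
  "comb_I = Abs (Var 0)"

definition comb_B :: tm where
  "comb_B = Abs (Abs (Abs (App (Var 2) (App (Var 1) (Var 0)))))"

definition comp :: "tm \<Rightarrow> tm \<Rightarrow> tm" where
  "comp M N = App (App comb_B M) N"


section \<open>Boehm trees\<close>

text \<open>
  \<open>Hnf n y Ts\<close> is the Boehm-like tree \<open>\<lambda>x\<^sub>1 \<dots> x\<^sub>n. y T\<^sub>1 \<dots> T\<^sub>m\<close>, where \<open>m\<close> is the length of \<open>Ts\<close>. The
  de Bruijn indices of the head \<open>y\<close> and of the free variables of the \<open>T\<^sub>i\<close> are counted below the
  \<open>n\<close> binders, so that \<open>x\<^sub>k\<close> has index \<open>n - k\<close> there.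
\<close>

codatatype boehm = Bot | Hnf nat nat "boehm list"

definition hnf :: "nat \<Rightarrow> nat \<Rightarrow> tm list \<Rightarrow> tm" where
  "hnf n y Ms = (Abs ^^ n) (foldl App (Var y) Ms)"

text \<open>
  The choice made by \<open>some_hnf\<close> is immaterial: by the Church-Rosser theorem all head normal forms
  of a term agree in \<open>n\<close>, \<open>y\<close> and the number of arguments, and have pairwise convertible arguments.
\<close>

definition some_hnf :: "tm \<Rightarrow> (nat \<times> nat \<times> tm list) option" where
  "some_hnf M =
    (if \<exists>n y Ms. (M, hnf n y Ms) \<in> beta_conv
     then Some (SOME (n, y, Ms). (M, hnf n y Ms) \<in> beta_conv)
     else None)"

primcorec BT :: "tm \<Rightarrow> boehm" where
  "BT M = (case some_hnf M of
     None \<Rightarrow> Bot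
   | Some h \<Rightarrow> Hnf (fst h) (fst (snd h)) (map BT (snd (snd h))))"

text \<open>Addresses of the nodes of a Boehm-like tree.\<close>

inductive node :: "boehm \<Rightarrow> nat list \<Rightarrow> bool" where
  "node T []"
| "\<lbrakk>i < length Ts; node (Ts ! i) p\<rbrakk> \<Longrightarrow> node (Hnf n y Ts) (i # p)"

definition finite_tree :: "boehm \<Rightarrow> bool" where
  "finite_tree T \<longleftrightarrow> finite {p. node T p}"


section \<open>Hereditary permutations\<close>

text \<open>
  \<open>HP_var j T\<close> states \<open>T \<in> HP(x)\<close> for the variable \<open>x\<close> with index \<open>j\<close>, which is \<open>j + n\<close> below the
  \<open>n\<close> leading binders of \<open>T\<close>. Positions are numbered from \<open>0\<close>: the variable bound at position \<open>k\<close> has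
  index \<open>n - Suc k\<close>.
\<close>

coinductive HP_var :: "nat \<Rightarrow> boehm \<Rightarrow> bool" where
  "\<lbrakk>length Ts = n; \<pi> permutes {..<n}; \<And>i. i < n \<Longrightarrow> HP_var (n - Suc (\<pi> i)) (Ts ! i)\<rbrakk>
    \<Longrightarrow> HP_var j (Hnf n (j + n) Ts)"

fun abs_tree :: "boehm \<Rightarrow> boehm" where
  "abs_tree Bot = Bot"
| "abs_tree (Hnf n y Ts) = Hnf (Suc n) y Ts"

definition HP :: "boehm set" where
  "HP = {abs_tree T | T. HP_var 0 T}"

definition FHP :: "tm set" where
  "FHP = {M. BT M \<in> HP \<and> finite_tree (BT M)}"


section \<open>Quotients\<close>

text \<open>
  The quotient of a structure by a relation \<open>r\<close>. When \<open>r\<close> is a congruence, the product of the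
  classes of \<open>x\<close> and \<open>y\<close> is the class of \<open>x \<otimes> y\<close>.
\<close>

definition quotient_struct :: "('a, 'b) monoid_scheme \<Rightarrow> ('a \<times> 'a) set \<Rightarrow> 'a set monoid" where
  "quotient_struct G r =
    \<lparr>carrier = carrier G // r,
     monoid.mult = (\<lambda>X Y. \<Union>x\<in>X. \<Union>y\<in>Y. r `` {x \<otimes>\<^bsub>G\<^esub> y}),
     monoid.one = r `` {\<one>\<^bsub>G\<^esub>}\<rparr>"

text \<open>
  The structure \<open>A/T\<close> under composition, for a set \<open>A\<close> of terms and a lambda-theory \<open>T\<close>; its elements
  are the classes, taken in the set of all terms, of the elements of \<open>A\<close>.
\<close>

definition terms_mod :: "tm set \<Rightarrow> (tm \<times> tm) set \<Rightarrow> tm set monoid" where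
  "terms_mod A T = quotient_struct \<lparr>carrier = A, monoid.mult = comp, monoid.one = comb_I\<rparr> T"

abbreviation FHP_beta :: "tm set monoid" where
  "FHP_beta \<equiv> terms_mod FHP beta_conv"

abbreviation FHP_beta_eta :: "tm set monoid" where
  "FHP_beta_eta \<equiv> terms_mod FHP beta_eta_conv"


section \<open>Inverse monoids\<close>

locale inverse_monoid = monoid G for G (structure) +
  fixes star :: "'a \<Rightarrow> 'a"
  assumes star_closed: "u \<in> carrier G \<Longrightarrow> star u \<in> carrier G"
    and star_star: "u \<in> carrier G \<Longrightarrow> star (star u) = u"
    and star_mult: "\<lbrakk>u \<in> carrier G; v \<in> carrier G\<rbrakk> \<Longrightarrow> star (u \<otimes> v) = star v \<otimes> star u"
    and mult_star_mult: "u \<in> carrier G \<Longrightarrow> u \<otimes> star u \<otimes> u = u"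
    and idem_commute: "\<lbrakk>u \<in> carrier G; v \<in> carrier G\<rbrakk> \<Longrightarrow>
      (u \<otimes> star u) \<otimes> (v \<otimes> star v) = (v \<otimes> star v) \<otimes> (u \<otimes> star u)"

definition nat_le :: "('a, 'b) monoid_scheme \<Rightarrow> ('a \<Rightarrow> 'a) \<Rightarrow> 'a \<Rightarrow> 'a \<Rightarrow> bool" where
  "nat_le G star u v \<longleftrightarrow> u \<otimes>\<^bsub>G\<^esub> star u \<otimes>\<^bsub>G\<^esub> v = u"

definition sigma :: "('a, 'b) monoid_scheme \<Rightarrow> ('a \<Rightarrow> 'a) \<Rightarrow> ('a \<times> 'a) set" where
  "sigma G star = {(t, u). t \<in> carrier G \<and> u \<in> carrier G \<and>
     (\<exists>w\<in>carrier G. nat_le G star w t \<and> nat_le G star w u)}"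

definition maximal_in ::
  "('a, 'b) monoid_scheme \<Rightarrow> ('a \<Rightarrow> 'a) \<Rightarrow> 'a set \<Rightarrow> 'a \<Rightarrow> bool" where
  "maximal_in G star A m \<longleftrightarrow> m \<in> A \<and> (\<forall>v\<in>A. nat_le G star m v \<longrightarrow> v = m)"

definition up_set :: "('a, 'b) monoid_scheme \<Rightarrow> ('a \<Rightarrow> 'a) \<Rightarrow> 'a \<Rightarrow> 'a set" where
  "up_set G star s = {v \<in> carrier G. nat_le G star s v}"

definition max_above :: "('a, 'b) monoid_scheme \<Rightarrow> ('a \<Rightarrow> 'a) \<Rightarrow> 'a \<Rightarrow> 'a" where
  "max_above G star s = (THE m. maximal_in G star (up_set G star s) m)"

text \<open>The unit of an inverse monoid is always maximal: \<open>1 \<le> v\<close> means \<open>1 1\<^sup>* v = 1\<close>, that is, \<open>v = 1\<close>.\<close>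

definition max_struct :: "('a, 'b) monoid_scheme \<Rightarrow> ('a \<Rightarrow> 'a) \<Rightarrow> 'a monoid" where
  "max_struct G star =
    \<lparr>carrier = {m. maximal_in G star (carrier G) m},
     monoid.mult = (\<lambda>t u. max_above G star (t \<otimes>\<^bsub>G\<^esub> u)),
     monoid.one = \<one>\<^bsub>G\<^esub>\<rparr>"

end

theory Submission
  imports Defs "HOL-Library.Confluence"
begin

text \<open>
  Modulo beta, a finite hereditary permutation is a finite tree of permutations (type \<open>hperm\<close>). In
  the inverse monoid of these trees the idempotents are the eta-expansions of \<open>I\<close>, so that
  \<open>u \<le> v\<close> holds iff \<open>u\<close> is an eta-expansion of \<open>v\<close>, every element lies below its
  eta-normal form, and the kernel of the projection to \<open>\<lambda>\<eta>\<close> consists of idempotents. A homomorphism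
  onto a group with these properties identifies the group with \<open>S/\<sigma>\<close> and with the maximal elements.

  That every invertible term is a finite hereditary permutation (Dezani; Bergstra and Klop) is proved
  for mutually inverse substitutions \<open>\<sigma>\<close>, \<open>\<tau>\<close> instead of terms. All \<open>\<sigma> i\<close> and \<open>\<tau> j\<close> have head normal
  forms, whose head variables define mutually inverse permutations, and the arguments below two
  matching heads form again a pair of mutually inverse substitutions. The process stops because
  \<open>\<sigma>\<close> followed by \<open>\<tau>\<close> sends a variable to a term convertible to a variable, which is beta
  convertible to a finite eta-expansion of it; this expansion becomes smaller in each step.
\<close>

section \<open>Simultaneous substitution\<close>

text \<open>Invertibility of one term does not descend to the single arguments below its head,
  because each argument may use all variables of the block of binders; only the whole family of
  arguments, read as a substitution for that block, is invertible. Conversion modulo eta offers no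
  finite object to recurse on, and the Boehm tree of an invertible term is not known to be finite
  beforehand. The finite datum at hand is the beta normal form of an eta-expanded variable, which is
  why one of the two compositions is followed up to beta. The numbers of binders and of arguments at
  two matching heads are not known to agree either: their equality is part of what the induction
  yields, by counting. Finally, only an instance of an invertible term is known to be head
  normalising, so a standardisation argument has to provide a head normal form of the term
  itself.\<close>

definition upr :: "(nat \<Rightarrow> nat) \<Rightarrow> nat \<Rightarrow> nat" where
  "upr r = case_nat 0 (\<lambda>i. Suc (r i))"

primrec ren :: "(nat \<Rightarrow> nat) \<Rightarrow> tm \<Rightarrow> tm" where
  "ren r (Var i) = Var (r i)"
| "ren r (App s t) = App (ren r s) (ren r t)"
| "ren r (Abs s) = Abs (ren (upr r) s)"

definition up :: "(nat \<Rightarrow> tm) \<Rightarrow> nat \<Rightarrow> tm" where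
  "up \<sigma> = case_nat (Var 0) (\<lambda>i. ren Suc (\<sigma> i))"

primrec psub :: "(nat \<Rightarrow> tm) \<Rightarrow> tm \<Rightarrow> tm" where
  "psub \<sigma> (Var i) = \<sigma> i"
| "psub \<sigma> (App s t) = App (psub \<sigma> s) (psub \<sigma> t)"
| "psub \<sigma> (Abs s) = Abs (psub (up \<sigma>) s)"

lemma upr_simps [simp]: "upr r 0 = 0" "upr r (Suc i) = Suc (r i)"
  by (simp_all add: upr_def)

lemma up_simps [simp]: "up \<sigma> 0 = Var 0" "up \<sigma> (Suc i) = ren Suc (\<sigma> i)"
  by (simp_all add: up_def)

lemma ren_ren: "ren r (ren r' t) = ren (\<lambda>i. r (r' i)) t"
proof (induction t arbitrary: r r')
  case (Abs t)
  have "(\<lambda>i. upr r (upr r' i)) = upr (\<lambda>i. r (r' i))"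
    by (auto simp: fun_eq_iff upr_def split: nat.split)
  with Abs show ?case by simp
qed auto

lemma ren_id: "ren (\<lambda>i. i) t = t"
proof (induction t)
  case (Abs t)
  have "upr (\<lambda>i. i) = (\<lambda>i. i)"
    by (auto simp: fun_eq_iff upr_def split: nat.split)
  with Abs show ?case by simp
qed auto

lemma ren_conv_psub: "ren r t = psub (\<lambda>i. Var (r i)) t"
proof (induction t arbitrary: r)
  case (Abs t)
  have "up (\<lambda>i. Var (r i)) = (\<lambda>i. Var (upr r i))"
    by (auto simp: fun_eq_iff up_def upr_def split: nat.split)
  with Abs show ?case by simp
qed auto

lemma psub_ren: "psub \<sigma> (ren r t) = psub (\<lambda>i. \<sigma> (r i)) t"
proof (induction t arbitrary: \<sigma> r)
  case (Abs t)
  have "(\<lambda>i. up \<sigma> (upr r i)) = up (\<lambda>i. \<sigma> (r i))"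
    by (auto simp: fun_eq_iff up_def upr_def split: nat.split)
  with Abs show ?case by simp
qed auto

lemma ren_psub: "ren r (psub \<sigma> t) = psub (\<lambda>i. ren r (\<sigma> i)) t"
proof (induction t arbitrary: \<sigma> r)
  case (Abs t)
  have "(\<lambda>i. ren (upr r) (up \<sigma> i)) = up (\<lambda>i. ren r (\<sigma> i))"
    by (auto simp: fun_eq_iff up_def ren_ren o_def split: nat.split)
  with Abs show ?case by simp
qed auto

lemma psub_psub: "psub \<sigma> (psub \<tau> t) = psub (\<lambda>i. psub \<sigma> (\<tau> i)) t"
proof (induction t arbitrary: \<sigma> \<tau>)
  case (Abs t)
  have "(\<lambda>i. psub (up \<sigma>) (up \<tau> i)) = up (\<lambda>i. psub \<sigma> (\<tau> i))"
    by (auto simp: fun_eq_iff up_def ren_psub psub_ren o_def split: nat.split)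
  with Abs show ?case by simp
qed auto

lemma psub_Var [simp]: "psub Var t = t"
  using ren_conv_psub[of "\<lambda>i. i" t] by (simp add: ren_id)

text \<open>An injective renaming is undone by renaming with a left inverse.\<close>

lemma ren_inj:
  assumes "inj r" "ren r s = ren r t"
  shows "s = t"
proof -
  have "ren (inv_into UNIV r) (ren r u) = u" for u
    using assms(1) by (simp add: ren_ren ren_id)
  then show ?thesis by (metis assms(2))
qed

section \<open>The given \<open>lift\<close> and \<open>subst\<close> as simultaneous
  substitutions\<close>

lemma lift_conv_ren: "lift t k = ren (\<lambda>i. if i < k then i else Suc i) t"
proof (induction t arbitrary: k)
  case (Abs t)
  have "upr (\<lambda>i. if i < k then i else Suc i) = (\<lambda>i. if i < Suc k then i else Suc i)"
    by (auto simp: fun_eq_iff upr_def split: nat.split)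
  with Abs show ?case by simp
qed auto

lemma lift_0 [simp]: "lift t 0 = ren Suc t"
  by (simp add: lift_conv_ren)

lemma subst_conv_psub:
  "subst t u k = psub (\<lambda>i. if k < i then Var (i - 1) else if i = k then u else Var i) t"
proof (induction t arbitrary: k u)
  case (Abs t)
  have "up (\<lambda>i. if k < i then Var (i - 1) else if i = k then u else Var i) =
    (\<lambda>i. if Suc k < i then Var (i - 1) else if i = Suc k then ren Suc u else Var i)"
    by (auto simp: fun_eq_iff up_def split: nat.split)
  with Abs show ?case by simp
qed auto

lemma subst_0 [simp]: "subst t u 0 = psub (case_nat u Var) t"
proof -
  have "(\<lambda>i. if 0 < i then Var (i - 1) else if i = 0 then u else Var i) = case_nat u Var"
    by (auto simp: fun_eq_iff split: nat.split)
  then show ?thesis by (simp add: subst_conv_psub)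
qed

lemma psub_cons_ren_Suc [simp]: "psub (case_nat u \<sigma>) (ren Suc t) = psub \<sigma> t"
  by (simp add: psub_ren)

lemma psub_up_comp_cons: "(\<lambda>i. psub (case_nat u Var) (up \<sigma> i)) = case_nat u \<sigma>"
  by (auto simp: fun_eq_iff up_def split: nat.split)

text \<open>The contractum of the substituted redex appears on the right, which is what closes each
  reduction relation below under substitution.\<close>

lemma psub_psub_cons: "psub \<sigma> (psub (case_nat u Var) t) = psub (case_nat (psub \<sigma> u) Var) (psub (up \<sigma>) t)"
  unfolding psub_psub psub_up_comp_cons
  by (rule arg_cong[of _ _ "\<lambda>s. psub s t"]) (auto simp: fun_eq_iff split: nat.split)

lemma ren_psub_cons: "ren r (psub (case_nat u Var) t) = psub (case_nat (ren r u) Var) (ren (upr r) t)"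
  by (simp add: ren_psub psub_ren)
    (rule arg_cong[of _ _ "\<lambda>s. psub s t"], auto simp: fun_eq_iff upr_def split: nat.split)

lemma ren_Suc_upr: "ren (upr r) (ren Suc t) = ren Suc (ren r t)"
  by (simp add: ren_ren o_def)

lemma psub_up_ren_Suc: "psub (up \<sigma>) (ren Suc t) = ren Suc (psub \<sigma> t)"
  by (simp add: psub_ren ren_psub)

section \<open>Beta reduction\<close>

inductive par :: "tm \<Rightarrow> tm \<Rightarrow> bool" where
  par_Var: "par (Var i) (Var i)"
| par_App: "par s s' \<Longrightarrow> par t t' \<Longrightarrow> par (App s t) (App s' t')"
| par_Abs: "par s s' \<Longrightarrow> par (Abs s) (Abs s')"
| par_beta: "par s s' \<Longrightarrow> par t t' \<Longrightarrow> par (App (Abs s) t) (psub (case_nat t' Var) s')"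

inductive_cases par_VarE: "par (Var i) t"
inductive_cases par_AppE: "par (App s t) u"
inductive_cases par_AbsE: "par (Abs s) u"

lemma par_refl: "par t t"
  by (induction t) (auto intro: par.intros)

lemma par_ren: "par s t \<Longrightarrow> par (ren r s) (ren r t)"
proof (induction arbitrary: r rule: par.induct)
  case (par_beta s s' t t')
  show ?case
    by (simp add: ren_psub_cons) (intro par.intros par_beta)
qed (auto intro: par.intros)

lemma par_psub: "par s t \<Longrightarrow> (\<And>i. par (\<sigma> i) (\<tau> i)) \<Longrightarrow> par (psub \<sigma> s) (psub \<tau> t)"
proof (induction arbitrary: \<sigma> \<tau> rule: par.induct)
  case (par_Abs s s')
  have "par (up \<sigma> i) (up \<tau> i)" for i
    using par_Abs.prems by (cases i) (auto intro: par_ren par_refl)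
  then show ?case by (simp add: par.par_Abs par_Abs.IH)
next
  case (par_beta s s' t t')
  have "par (up \<sigma> i) (up \<tau> i)" for i
    using par_beta.prems by (cases i) (auto intro: par_ren par_refl)
  then show ?case
    by (simp add: psub_psub_cons) (intro par.intros par_beta)
qed (auto intro: par.intros)

lemma par_psub_cons: "par s s' \<Longrightarrow> par t t' \<Longrightarrow> par (psub (case_nat t Var) s) (psub (case_nat t' Var) s')"
  by (rule par_psub) (auto split: nat.split intro: par_refl)

text \<open>Takahashi's complete development: all redexes present in the term are contracted at
  once.\<close>

fun cd :: "tm \<Rightarrow> tm" where
  "cd (Var i) = Var i"
| "cd (App (Abs s) t) = psub (case_nat (cd t) Var) (cd s)"
| "cd (App s t) = App (cd s) (cd t)"
| "cd (Abs s) = Abs (cd s)"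

text \<open>The triangle property: \<open>cd s\<close> depends on \<open>s\<close> alone, so any two
  parallel reducts of \<open>s\<close> meet there and the diamond property follows.\<close>

lemma par_cd: "par s t \<Longrightarrow> par t (cd s)"
proof (induction s arbitrary: t rule: cd.induct)
  case (2 s u)
  from 2(3) show ?case
    by (rule par_AppE) (auto elim!: par_AbsE intro: par.intros par_psub_cons 2)
qed (auto elim!: par_VarE par_AppE par_AbsE intro: par.intros)

lemma beta_redex: "beta (App (Abs s) t) (psub (case_nat t Var) s)"
  using beta.intros(1)[of s t] by simp

lemma beta_par: "beta s t \<Longrightarrow> par s t"
  by (induction rule: beta.induct) (auto intro: par.intros par_refl)

lemma rtranclp_cong1:
  assumes "\<And>x y. r x y \<Longrightarrow> r (f x) (f y)" "r\<^sup>*\<^sup>* x y"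
  shows "r\<^sup>*\<^sup>* (f x) (f y)"
  using assms(2) by (induction) (auto intro: assms(1) rtranclp.rtrancl_into_rtrancl)

lemma betas_App: "beta\<^sup>*\<^sup>* s s' \<Longrightarrow> beta\<^sup>*\<^sup>* t t' \<Longrightarrow> beta\<^sup>*\<^sup>* (App s t) (App s' t')"
  by (rule rtranclp_trans[of _ _ "App s' t"]; rule rtranclp_cong1) (auto intro: beta.intros)

lemma betas_Abs: "beta\<^sup>*\<^sup>* s s' \<Longrightarrow> beta\<^sup>*\<^sup>* (Abs s) (Abs s')"
  by (rule rtranclp_cong1) (auto intro: beta.intros)

lemma par_betas: "par s t \<Longrightarrow> beta\<^sup>*\<^sup>* s t"
proof (induction rule: par.induct)
  case (par_beta s s' t t')
  then have "beta\<^sup>*\<^sup>* (App (Abs s) t) (App (Abs s') t')"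
    by (intro betas_App betas_Abs)
  then show ?case
    using beta_redex by (rule rtranclp.rtrancl_into_rtrancl)
qed (auto intro: betas_App betas_Abs)

lemma pars_eq_betas: "par\<^sup>*\<^sup>* = beta\<^sup>*\<^sup>*"
proof (intro antisym predicate2I)
  show "beta\<^sup>*\<^sup>* s t" if "par\<^sup>*\<^sup>* s t" for s t
    using that by induction (simp, metis par_betas rtranclp_trans)
  show "par\<^sup>*\<^sup>* s t" if "beta\<^sup>*\<^sup>* s t" for s t
    using that by (metis beta_par mono_rtranclp)
qed

lemma confluentp_beta: "confluentp beta"
proof -
  have "strong_confluentp par"
    by (rule strong_confluentpI) (blast intro: par_cd)
  then have "confluentp par" by (rule strong_confluentp_imp_confluentp)
  then show ?thesis by (simp add: confluentp_def pars_eq_betas rtranclp_conversep)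
qed

section \<open>Conversion, congruence and substitution\<close>

definition beta_eta :: "tm \<Rightarrow> tm \<Rightarrow> bool" where
  "beta_eta s t \<longleftrightarrow> beta s t \<or> eta s t"

abbreviation bconv (infix \<open>=b\<close> 50) where "bconv \<equiv> equivclp beta"
abbreviation econv (infix \<open>=e\<close> 50) where "econv \<equiv> equivclp beta_eta"

lemma church_rosser:
  assumes "s =b t"
  obtains u where "beta\<^sup>*\<^sup>* s u" "beta\<^sup>*\<^sup>* t u"
proof -
  have "(beta\<^sup>*\<^sup>* OO beta\<inverse>\<inverse>\<^sup>*\<^sup>*) s t"
    using assms confluentp_beta semiconfluentp_equivclp confluentp_eq_semiconfluentp by metis
  then show ?thesis using that by (auto simp: rtranclp_conversep)
qed

lemma equivclp_cong1:
  assumes "\<And>x y. r x y \<Longrightarrow> equivclp r (f x) (f y)" "equivclp r x y"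
  shows "equivclp r (f x) (f y)"
  using assms(2)
proof (induction)
  case (step y z)
  then have "equivclp r (f y) (f z)" by (auto intro: assms(1) equivclp_sym)
  with step.IH show ?case by (rule equivclp_trans)
qed auto

lemma bconv_App: "s =b s' \<Longrightarrow> t =b t' \<Longrightarrow> App s t =b App s' t'"
  by (rule equivclp_trans[of _ _ "App s' t"]; rule equivclp_cong1) (auto intro: beta.intros)

lemma bconv_Abs: "s =b s' \<Longrightarrow> Abs s =b Abs s'"
  by (rule equivclp_cong1) (auto intro: beta.intros)

lemma econv_cong1:
  assumes "\<And>x y. beta x y \<Longrightarrow> beta (f x) (f y)" "\<And>x y. eta x y \<Longrightarrow> eta (f x) (f y)" "x =e y"
  shows "f x =e f y"
proof -
  have "beta_eta (f x) (f y)" if "beta_eta x y" for x y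
    using that assms(1,2) by (auto simp: beta_eta_def)
  then show ?thesis by (intro equivclp_cong1[OF _ assms(3)] r_into_equivclp)
qed

lemma econv_App: "s =e s' \<Longrightarrow> t =e t' \<Longrightarrow> App s t =e App s' t'"
  by (rule equivclp_trans[of _ _ "App s' t"]; rule econv_cong1) (auto intro: beta.intros eta.intros)

lemma econv_Abs: "s =e s' \<Longrightarrow> Abs s =e Abs s'"
  by (rule econv_cong1) (auto intro: beta.intros eta.intros)

lemma bconv_econv: "s =b t \<Longrightarrow> s =e t"
  by (induction rule: equivclp_induct) (auto simp: beta_eta_def intro: equivclp_into_equivclp)

lemma eta_econv: "eta s t \<Longrightarrow> s =e t"
  by (simp add: beta_eta_def r_into_equivclp)

lemma beta_conv_iff: "(s, t) \<in> beta_conv \<longleftrightarrow> s =b t"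
  by (simp add: beta_conv_def)

lemma beta_eta_conv_iff: "(s, t) \<in> beta_eta_conv \<longleftrightarrow> s =e t"
proof -
  have "sup beta eta = beta_eta" by (auto simp: fun_eq_iff beta_eta_def)
  then show ?thesis by (simp add: beta_eta_conv_def)
qed

lemma bconv_redex: "App (Abs s) t =b psub (case_nat t Var) s"
  using beta_redex by (rule r_into_equivclp)

lemma eta_wrap: "eta (Abs (App (ren Suc s) (Var 0))) s"
  using eta.intros(1)[of s] by simp

lemma beta_psub: "beta s t \<Longrightarrow> beta (psub \<sigma> s) (psub \<sigma> t)"
proof (induction arbitrary: \<sigma> rule: beta.induct)
  case (1 s t)
  then show ?case using beta_redex by (simp add: psub_psub_cons)
qed (auto intro: beta.intros)

lemma eta_psub: "eta s t \<Longrightarrow> eta (psub \<sigma> s) (psub \<sigma> t)"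
proof (induction arbitrary: \<sigma> rule: eta.induct)
  case (1 s)
  then show ?case using eta_wrap by (simp add: psub_up_ren_Suc)
qed (auto intro: eta.intros)

lemma bconv_psub: "s =b t \<Longrightarrow> psub \<sigma> s =b psub \<sigma> t"
  by (rule equivclp_cong1) (auto intro: beta_psub)

lemma econv_psub: "s =e t \<Longrightarrow> psub \<sigma> s =e psub \<sigma> t"
  by (rule econv_cong1) (auto intro: beta_psub eta_psub)

lemma bconv_ren: "s =b t \<Longrightarrow> ren r s =b ren r t"
  by (simp add: ren_conv_psub bconv_psub)

lemma econv_ren: "s =e t \<Longrightarrow> ren r s =e ren r t"
  by (simp add: ren_conv_psub econv_psub)

text \<open>Allows a composition of substitutions that is only convertible to the identity to be
  dropped.\<close>

lemma econv_psub_fun: "(\<And>i. \<sigma> i =e \<tau> i) \<Longrightarrow> psub \<sigma> t =e psub \<tau> t"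
proof (induction t arbitrary: \<sigma> \<tau>)
  case (Abs t)
  have "up \<sigma> i =e up \<tau> i" for i
    using Abs.prems by (cases i) (simp_all add: econv_ren)
  then show ?case by (simp add: econv_Abs Abs.IH)
qed (simp_all add: econv_App)

section \<open>Finite hereditary permutations\<close>

text \<open>
  \<open>Perm p [T\<^sub>0, \<dots>]\<close> stands for \<open>\<lambda>z x\<^sub>0 \<dots> x\<^sub>n. z (T\<^sub>0 x\<^bsub>p 0\<^esub>) (T\<^sub>1 x\<^bsub>p 1\<^esub>) \<dots>\<close>. Beyond its arity such a term is
  eta-expanded by identities, which is why \<open>kid\<close> returns \<open>triv\<close> there.
\<close>

datatype hperm = Perm (perm: "nat \<Rightarrow> nat") (kids: "hperm list")

definition triv :: hperm where "triv = Perm id []"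

abbreviation arity :: "hperm \<Rightarrow> nat" where "arity T \<equiv> length (kids T)"

definition kid :: "hperm \<Rightarrow> nat \<Rightarrow> hperm" where
  "kid T i = (if i < arity T then kids T ! i else triv)"

lemma triv_simps [simp]: "perm triv = id" "kids triv = []" "kid triv i = triv"
  by (simp_all add: triv_def kid_def)

lemma kid_beyond: "arity T \<le> i \<Longrightarrow> kid T i = triv"
  by (simp add: kid_def)

lemma hperm_eqI:
  assumes "arity T = arity U" "perm T = perm U" "\<And>i. i < arity T \<Longrightarrow> kid T i = kid U i"
  shows "T = U"
proof (rule hperm.expand)
  have "kids T = kids U"
    using assms(1,3) by (intro nth_equalityI) (simp_all add: kid_def split: if_splits)
  with assms(2) show "perm T = perm U \<and> kids T = kids U" by simp
qed

lemma size_kid: "i < arity T \<Longrightarrow> size (kid T i) < size T"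
  by (cases T) (auto simp: kid_def less_Suc_eq_le intro!: size_list_estimation'[of "kids T ! i" _ _ size])

lemma size_kid_le: "size (kid T i) \<le> size T"
proof (cases "i < arity T")
  case False
  then show ?thesis by (cases T) (simp add: kid_def triv_def)
qed (simp add: size_kid less_imp_le)

text \<open>Unlike \<open>size_kid\<close> this covers indices beyond the arity, where the child is
  \<open>triv\<close>; a product looks there as soon as its factors differ in arity.\<close>

lemma size_kid_less: "0 < arity T \<Longrightarrow> size (kid T i) < size T"
proof (cases "i < arity T")
  case False
  assume "0 < arity T"
  then have "0 < size_list size (kids T)" by (cases "kids T") simp_all
  with False show ?thesis by (cases T) (simp add: kid_def triv_def)
qed (rule size_kid)

text \<open>Induction on size states the hypothesis through \<open>kid\<close>, the total access
  function in which the later facts are phrased.\<close>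

lemma kid_induct [case_names kids]:
  assumes "\<And>T. (\<And>i. i < arity T \<Longrightarrow> P (kid T i)) \<Longrightarrow> P T"
  shows "P T"
  by (induction T rule: measure_induct_rule[of size]) (blast intro: assms size_kid)

inductive wfh :: "hperm \<Rightarrow> bool" where
  "perm T permutes {..<arity T} \<Longrightarrow> (\<And>i. i < arity T \<Longrightarrow> wfh (kid T i)) \<Longrightarrow> wfh T"

lemma wfh_triv [simp]: "wfh triv"
  by (rule wfh.intros) (simp_all add: permutes_id)

lemma wfh_perm: "wfh T \<Longrightarrow> perm T permutes {..<arity T}"
  by (erule wfh.cases) simp

lemma wfh_kid: "wfh T \<Longrightarrow> wfh (kid T i)"
  by (cases "i < arity T") (auto elim: wfh.cases simp: kid_beyond)

lemma wfh_perm_beyond: "wfh T \<Longrightarrow> arity T \<le> i \<Longrightarrow> perm T i = i"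
  by (meson lessThan_iff not_le permutes_not_in wfh_perm)

lemma wfh_perm_less: "wfh T \<Longrightarrow> perm T i < arity T \<longleftrightarrow> i < arity T"
  by (metis lessThan_iff permutes_in_image wfh_perm)

lemma wfh_perm_less': "wfh T \<Longrightarrow> arity T \<le> k \<Longrightarrow> i < k \<Longrightarrow> perm T i < k"
  by (metis not_le order_less_le_trans wfh_perm_beyond wfh_perm_less)

lemma wfh_induct [consumes 1, case_names wfh]:
  assumes "wfh T"
    and "\<And>T. wfh T \<Longrightarrow> (\<And>i. i < arity T \<Longrightarrow> P (kid T i)) \<Longrightarrow> P T"
  shows "P T"
  using assms(1) by (induction T rule: kid_induct) (blast intro: assms(2) wfh_kid)

text \<open>
  \<open>hmult\<close> mirrors \<open>comp\<close>: in \<open>M (N z) x\<^sub>0 x\<^sub>1 \<dots>\<close> the \<open>i\<close>-th argument of \<open>z\<close> is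
  \<open>U\<^sub>i (T\<^bsub>\<rho> i\<^esub> x\<^bsub>\<pi> (\<rho> i)\<^esub>)\<close>, so the order of composition is reversed in the children.
\<close>

lemma size_hmult:
  assumes "i < max (arity T) (arity U)"
  shows "size (kid U i) + size (kid T j) < size T + size U"
proof -
  from assms have "0 < arity T \<or> 0 < arity U" by auto
  then show ?thesis
    using size_kid_le[of U i] size_kid_le[of T j] size_kid_less[of U i] size_kid_less[of T j]
    by linarith
qed

function hmult :: "hperm \<Rightarrow> hperm \<Rightarrow> hperm" where
  "hmult T U = Perm (perm T \<circ> perm U)
    (map (\<lambda>i. hmult (kid U i) (kid T (perm U i))) [0..<max (arity T) (arity U)])"
  by pat_completeness auto

termination
  by (relation "measure (\<lambda>(T, U). size T + size U)")
    (auto simp only: in_measure wf_measure split set_upt atLeastLessThan_iff intro: size_hmult)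

declare hmult.simps [simp del]

lemma arity_hmult [simp]: "arity (hmult T U) = max (arity T) (arity U)"
  by (subst hmult.simps) simp

lemma perm_hmult [simp]: "perm (hmult T U) = perm T \<circ> perm U"
  by (subst hmult.simps) simp

lemma hmult_triv_triv [simp]: "hmult triv triv = triv"
  by (rule hperm_eqI) auto

text \<open>Beyond both arities the formula persists, since \<open>perm U\<close> fixes the index
  and \<open>hmult triv triv\<close> is \<open>triv\<close>; later proofs can rewrite with it at any
  index.\<close>

lemma kid_hmult:
  assumes "wfh T" "wfh U"
  shows "kid (hmult T U) i = hmult (kid U i) (kid T (perm U i))"
proof (cases "i < max (arity T) (arity U)")
  case True
  then have "kid (hmult T U) i = kids (hmult T U) ! i"
    by (simp add: kid_def)
  also have "\<dots> = hmult (kid U i) (kid T (perm U i))"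
    using True by (subst hmult.simps) simp
  finally show ?thesis .
next
  case False
  then have "arity T \<le> i" "arity U \<le> i" "arity (hmult T U) \<le> i" by auto
  then show ?thesis
    using assms by (simp add: kid_beyond wfh_perm_beyond)
qed

lemma permutes_mono: "p permutes {..<m} \<Longrightarrow> m \<le> n \<Longrightarrow> p permutes {..<(n::nat)}"
  by (rule permutes_subset) auto

lemma wfh_hmult: "wfh T \<Longrightarrow> wfh U \<Longrightarrow> wfh (hmult T U)"
proof (induction T U rule: hmult.induct)
  case (1 T U)
  show ?case
  proof (rule wfh.intros)
    show "perm (hmult T U) permutes {..<arity (hmult T U)}"
      using 1(2,3)[THEN wfh_perm] by (auto intro!: permutes_compose elim: permutes_mono)
  next
    fix i assume "i < arity (hmult T U)"
    then show "wfh (kid (hmult T U) i)"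
      using 1 by (auto simp: kid_hmult intro!: 1(1) wfh_kid)
  qed
qed

text \<open>The order of the factors is reversed in the children, so the hypothesis is used from
  right to left on the reversed triple. The total size is a measure insensitive to this
  reversal.\<close>

lemma hmult_assoc:
  assumes "wfh T" "wfh U" "wfh V"
  shows "hmult (hmult T U) V = hmult T (hmult U V)"
  using assms
proof (induction "size T + size U + size V" arbitrary: T U V rule: less_induct)
  case less
  show ?case
  proof (rule hperm_eqI)
    fix i assume "i < arity (hmult (hmult T U) V)"
    \<comment> \<open>The rightmost factor with a genuine child at \<open>i\<close> makes the total
      size drop; the permutations of the factors to its right fix \<open>i\<close>.\<close>
    then consider "i < arity V" | "arity V \<le> i" "i < arity U" | "arity V \<le> i" "arity U \<le> i" "i < arity T"
      by fastforce
    then have "size (kid V i) + size (kid U (perm V i)) + size (kid T (perm U (perm V i))) < size V + size U + size T"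
      using size_kid_le[of V i] size_kid_le[of U "perm V i"] size_kid_le[of T "perm U (perm V i)"]
        less.prems by cases (simp_all add: add_less_le_mono add_le_less_mono size_kid wfh_perm_beyond)
    then show "kid (hmult (hmult T U) V) i = kid (hmult T (hmult U V)) i"
      using less.prems by (simp add: kid_hmult wfh_hmult wfh_kid less.hyps add_ac)
  qed (simp_all add: o_assoc)
qed

lemma hmult_triv_left: "wfh T \<Longrightarrow> hmult triv T = T"
  and hmult_triv_right: "wfh T \<Longrightarrow> hmult T triv = T"
proof -
  have "hmult triv T = T \<and> hmult T triv = T" if "wfh T"
    using that
  proof (induction rule: wfh_induct)
    case (wfh T)
    show ?case
      by (rule conjI; rule hperm_eqI) (simp_all add: kid_hmult wfh)
  qed
  then show "wfh T \<Longrightarrow> hmult triv T = T" "wfh T \<Longrightarrow> hmult T triv = T" by auto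
qed

text \<open>The generalised inverse. In \<open>hmult T (hstar T)\<close> position \<open>i\<close>
  joins \<open>kid (hstar T) i\<close> with the child of \<open>T\<close> at the preimage of
  \<open>i\<close>, so the star of that child has to stand there.\<close>

function hstar :: "hperm \<Rightarrow> hperm" where
  "hstar T = Perm (inv_into UNIV (perm T))
    (map (\<lambda>i. hstar (kid T (inv_into UNIV (perm T) i))) [0..<arity T])"
  by pat_completeness auto

termination
  by (relation "measure size"; clarsimp) (metis gr_zeroI not_less_zero size_kid_less)

declare hstar.simps [simp del]

lemma arity_hstar [simp]: "arity (hstar T) = arity T"
  by (subst hstar.simps) simp

lemma perm_hstar: "perm (hstar T) = inv_into UNIV (perm T)"
  by (subst hstar.simps) simp

lemma wfh_perm_inv:
  assumes "wfh T"
  shows "inv_into UNIV (perm T) permutes {..<arity T}"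
    and "perm T (inv_into UNIV (perm T) i) = i"
    and "inv_into UNIV (perm T) (perm T i) = i"
  using permutes_inv[OF wfh_perm[OF assms]] permutes_inverses[OF wfh_perm[OF assms]] by auto

lemma kid_hstar:
  assumes "wfh T"
  shows "kid (hstar T) i = hstar (kid T (perm (hstar T) i))"
proof (cases "i < arity T")
  case True
  then have "kid (hstar T) i = kids (hstar T) ! i"
    by (simp add: kid_def)
  also have "\<dots> = hstar (kid T (perm (hstar T) i))"
    using True unfolding perm_hstar by (subst hstar.simps) simp
  finally show ?thesis .
next
  case False
  have "hstar triv = triv"
    by (rule hperm_eqI) (auto simp: perm_hstar inv_id)
  moreover have "inv_into UNIV (perm T) i = i"
    using False wfh_perm_inv(1)[OF assms] by (simp add: permutes_not_in)
  ultimately show ?thesis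
    using False by (simp add: kid_beyond perm_hstar)
qed

lemma wfh_hstar: "wfh T \<Longrightarrow> wfh (hstar T)"
proof (induction T rule: hstar.induct)
  case (1 T)
  show ?case
  proof (rule wfh.intros)
    show "perm (hstar T) permutes {..<arity (hstar T)}"
      by (simp add: perm_hstar wfh_perm_inv(1) 1(2))
  next
    fix i assume "i < arity (hstar T)"
    then show "wfh (kid (hstar T) i)"
      using 1 by (simp add: kid_hstar wfh_kid perm_hstar)
  qed
qed

lemma perm_hstar_comp:
  assumes "wfh T"
  shows "perm T \<circ> perm (hstar T) = id" "perm (hstar T) \<circ> perm T = id"
    "perm T (perm (hstar T) i) = i" "perm (hstar T) (perm T i) = i"
  using wfh_perm_inv[OF assms] by (auto simp: fun_eq_iff perm_hstar)

lemma hstar_hstar: "wfh T \<Longrightarrow> hstar (hstar T) = T"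
proof (induction rule: wfh_induct)
  case (wfh T)
  have p: "perm (hstar (hstar T)) = perm T"
    by (metis wfh.hyps inv_inv_eq perm_hstar permutes_bij wfh_perm)
  show ?case
  proof (rule hperm_eqI)
    fix i assume "i < arity (hstar (hstar T))"
    then show "kid (hstar (hstar T)) i = kid T i"
      using wfh by (simp add: kid_hstar wfh_hstar p perm_hstar_comp)
  qed (simp_all add: p)
qed

lemma hstar_hmult: "wfh T \<Longrightarrow> wfh U \<Longrightarrow> hstar (hmult T U) = hmult (hstar U) (hstar T)"
proof (induction T U rule: hmult.induct)
  case (1 T U)
  have p: "perm (hstar (hmult T U)) = perm (hstar U) \<circ> perm (hstar T)"
    by (simp add: perm_hstar o_inv_distrib permutes_bij[OF wfh_perm] 1(2,3))
  show ?case
  proof (rule hperm_eqI)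
    fix i assume "i < arity (hstar (hmult T U))"
    \<comment> \<open>Both sides invert the product of children that stands at the preimage of
      \<open>i\<close> under the composite permutation.\<close>
    define j where "j = perm (hstar U) (perm (hstar T) i)"
    have "j < max (arity T) (arity U)"
      unfolding j_def using \<open>i < _\<close> 1(2,3) by (intro wfh_perm_less') (auto intro: wfh_hstar)
    then have "hstar (hmult (kid U j) (kid T (perm U j))) = hmult (hstar (kid T (perm U j))) (hstar (kid U j))"
      using 1 by (simp add: wfh_kid)
    moreover have "perm U j = perm (hstar T) i"
      using 1(3) by (simp add: j_def perm_hstar_comp)
    ultimately show "kid (hstar (hmult T U)) i = kid (hmult (hstar U) (hstar T)) i"
      using 1(2,3) by (simp add: kid_hstar wfh_hmult kid_hmult wfh_hstar p flip: j_def)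
  qed (simp_all add: p max.commute)
qed

text \<open>\<open>idm\<close> describes the finite eta-expansions of the identity, which are the idempotents.\<close>

inductive idm :: "hperm \<Rightarrow> bool" where
  "perm T = id \<Longrightarrow> (\<And>i. i < arity T \<Longrightarrow> idm (kid T i)) \<Longrightarrow> idm T"

lemma idm_triv [simp]: "idm triv"
  by (rule idm.intros) simp_all

lemma idm_perm: "idm T \<Longrightarrow> perm T = id"
  by (erule idm.cases) simp

lemma idm_kid: "idm T \<Longrightarrow> idm (kid T i)"
  by (cases "i < arity T") (auto elim: idm.cases simp: kid_beyond)

lemma idm_wfh: "idm T \<Longrightarrow> wfh T"
  by (induction rule: idm.induct) (auto intro: wfh.intros simp: permutes_id)

lemma idm_idem: "idm T \<Longrightarrow> hmult T T = T"
proof (induction T rule: kid_induct)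
  case (kids T)
  then show ?case
    by (intro hperm_eqI[of "hmult T T"]) (simp_all add: kid_hmult idm_wfh idm_perm idm_kid)
qed

text \<open>A permutation equal to its square is the identity. The children of
  \<open>hmult T T\<close> are then the squares of the children, and the argument descends.\<close>

lemma idem_idm: "wfh T \<Longrightarrow> hmult T T = T \<Longrightarrow> idm T"
proof (induction rule: wfh_induct)
  case (wfh T)
  have "perm T \<circ> perm T = perm T"
    using arg_cong[OF wfh.prems, of perm] by simp
  then have p: "perm T = id"
    by (metis (no_types, opaque_lifting) comp_id fun.map_id o_assoc permutes_inv_o(2) wfh.hyps wfh_perm)
  show ?case
  proof (rule idm.intros[OF p])
    fix i assume "i < arity T"
    moreover have "hmult (kid T i) (kid T i) = kid T i"
      using arg_cong[OF wfh.prems, of "\<lambda>T. kid T i"] wfh.hyps by (simp add: kid_hmult p)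
    ultimately show "idm (kid T i)" by (rule wfh.IH)
  qed
qed

lemma idm_commute: "idm T \<Longrightarrow> idm U \<Longrightarrow> hmult T U = hmult U T"
proof (induction T U rule: hmult.induct)
  case (1 T U)
  then show ?case
    by (intro hperm_eqI[of "hmult T U"]) (simp_all add: kid_hmult idm_wfh idm_perm idm_kid max.commute)
qed

text \<open>Passing to children exchanges the two products, because \<open>hmult\<close> reverses
  factors; hence they are treated simultaneously.\<close>

lemma idm_hmult_hstar:
  assumes "wfh T"
  shows "idm (hmult T (hstar T))" "idm (hmult (hstar T) T)"
proof -
  have "idm (hmult T (hstar T)) \<and> idm (hmult (hstar T) T)"
    using assms
  proof (induction rule: wfh_induct)
    case (wfh T)
    have "idm (hmult T (hstar T))"
    proof (rule idm.intros)
      fix i assume "i < arity (hmult T (hstar T))"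
      then have "perm (hstar T) i < arity T"
        using wfh.hyps by (simp add: wfh_perm_less[OF wfh_hstar, of T, simplified])
      then show "idm (kid (hmult T (hstar T)) i)"
        using wfh by (simp add: kid_hmult wfh_hstar kid_hstar)
    qed (simp add: perm_hstar_comp wfh.hyps)
    moreover have "idm (hmult (hstar T) T)"
    proof (rule idm.intros)
      fix i assume "i < arity (hmult (hstar T) T)"
      then show "idm (kid (hmult (hstar T) T) i)"
        using wfh by (simp add: kid_hmult wfh_hstar kid_hstar perm_hstar_comp)
    qed (simp add: perm_hstar_comp wfh.hyps)
    ultimately show ?case ..
  qed
  then show "idm (hmult T (hstar T))" "idm (hmult (hstar T) T)" by auto
qed

lemma hmult_hstar_hmult:
  assumes "wfh T"
  shows "hmult (hmult T (hstar T)) T = T"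
  using assms
proof (induction rule: wfh_induct)
  case (wfh T)
  show ?case
  proof (rule hperm_eqI)
    fix i assume "i < arity (hmult (hmult T (hstar T)) T)"
    \<comment> \<open>With \<open>K\<close> the child of \<open>T\<close>, the child here is
      \<open>K\<close> times the product of \<open>hstar K\<close> and \<open>K\<close>;
      associativity brings it to the form of the hypothesis.\<close>
    then show "kid (hmult (hmult T (hstar T)) T) i = kid T i"
      using wfh
      by (simp add: kid_hmult wfh_hstar kid_hstar perm_hstar_comp wfh_hmult wfh_kid
          hmult_assoc[symmetric])
  qed (use wfh.hyps in \<open>simp_all add: perm_hstar_comp\<close>)
qed

section \<open>Eta-normal forms\<close>

text \<open>
  \<open>etan\<close> removes at every node the trailing positions that are fixed and carry an identity; these are
  the eta-redexes.
\<close>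

definition trim :: "hperm \<Rightarrow> nat" where
  "trim T = (LEAST n. \<forall>i\<ge>n. perm T i = i \<and> kid T i = triv)"

definition strip :: "hperm \<Rightarrow> hperm" where
  "strip T = Perm (perm T) (take (trim T) (kids T))"

lemma trim_le: "wfh T \<Longrightarrow> trim T \<le> arity T"
  unfolding trim_def by (rule Least_le) (simp add: kid_beyond wfh_perm_beyond)

lemma trim_beyond:
  assumes "wfh T" "trim T \<le> i"
  shows "perm T i = i \<and> kid T i = triv"
proof -
  have "\<forall>i\<ge>arity T. perm T i = i \<and> kid T i = triv"
    using assms(1) by (simp add: kid_beyond wfh_perm_beyond)
  then have "\<forall>i\<ge>trim T. perm T i = i \<and> kid T i = triv"
    unfolding trim_def by (rule LeastI)
  with assms(2) show ?thesis by blast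
qed

lemma strip_simps:
  assumes "wfh T"
  shows "perm (strip T) = perm T" "arity (strip T) = trim T" "kid (strip T) i = kid T i"
proof -
  show a: "arity (strip T) = trim T" using trim_le[OF assms] by (simp add: strip_def)
  show "kid (strip T) i = kid T i"
  proof (cases "i < trim T")
    case True
    then show ?thesis using a trim_le[OF assms] by (simp add: kid_def) (simp add: strip_def)
  next
    case False
    then show ?thesis using a trim_beyond[OF assms, of i] by (simp add: kid_beyond)
  qed
qed (simp add: strip_def)

lemma wfh_strip: "wfh T \<Longrightarrow> wfh (strip T)"
proof (rule wfh.intros)
  assume T: "wfh T"
  show "perm (strip T) permutes {..<arity (strip T)}"
    unfolding strip_simps[OF T] using wfh_perm[OF T]
    by (rule permutes_superset) (simp add: trim_beyond T)
  show "wfh (kid (strip T) i)" for i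
    by (simp add: strip_simps T wfh_kid)
qed

text \<open>Children come first: an expanded identity becomes \<open>triv\<close>, and so removable,
  only after its own normalisation.\<close>

function etan :: "hperm \<Rightarrow> hperm" where
  "etan T = strip (Perm (perm T) (map (\<lambda>i. etan (kid T i)) [0..<arity T]))"
  by pat_completeness auto

termination
  by (relation "measure size"; simp add: size_kid)

declare etan.simps [simp del]

lemma etan_triv [simp]: "etan triv = triv"
proof -
  have "trim triv = 0" by (simp add: trim_def)
  then show ?thesis by (subst etan.simps) (simp add: strip_def triv_def)
qed

lemma etan_props:
  assumes "wfh T"
  shows "wfh (etan T)" "perm (etan T) = perm T" "kid (etan T) i = etan (kid T i)"
    "arity (etan T) \<le> arity T"
proof -
  have *: "wfh (etan T) \<and> perm (etan T) = perm T \<and> (\<forall>i. kid (etan T) i = etan (kid T i)) \<and>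
    arity (etan T) \<le> arity T"
    using assms
  proof (induction rule: wfh_induct)
    case (wfh T)
    define V where "V = Perm (perm T) (map (\<lambda>i. etan (kid T i)) [0..<arity T])"
    have kid_V: "kid V i = etan (kid T i)" for i
      by (cases "i < arity T") (simp_all add: V_def kid_def)
    have "wfh V"
      by (rule wfh.intros) (simp_all add: kid_V wfh, simp_all add: V_def wfh_perm wfh.hyps wfh)
    moreover have "etan T = strip V"
      by (subst etan.simps) (simp add: V_def)
    moreover have "perm V = perm T" "arity V = arity T"
      by (simp_all add: V_def)
    ultimately show ?case
      using trim_le[of V] by (simp add: strip_simps wfh_strip kid_V)
  qed
  from * show "wfh (etan T)" "perm (etan T) = perm T" "kid (etan T) i = etan (kid T i)"
    "arity (etan T) \<le> arity T" by auto
qed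

text \<open>The arity of a normal form can be read off from the permutation and the normalised
  children alone, so it forgets how far \<open>T\<close> was expanded.\<close>

lemma etan_cong:
  assumes "wfh T" "wfh U" "perm T = perm U" "\<And>i. etan (kid T i) = etan (kid U i)"
  shows "etan T = etan U"
proof -
  have a: "arity (etan T) = (LEAST n. \<forall>i\<ge>n. perm T i = i \<and> etan (kid T i) = triv)" if "wfh T" for T
  proof -
    define V where "V = Perm (perm T) (map (\<lambda>i. etan (kid T i)) [0..<arity T])"
    have kid_V: "kid V i = etan (kid T i)" for i
      by (cases "i < arity T") (simp_all add: V_def kid_def)
    have "wfh V"
      by (rule wfh.intros) (simp_all add: kid_V that etan_props wfh_kid, simp add: V_def wfh_perm that)
    moreover have "etan T = strip V"
      by (subst etan.simps) (simp add: V_def)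
    moreover have "perm V = perm T" by (simp add: V_def)
    ultimately show ?thesis
      by (simp add: strip_simps trim_def kid_V)
  qed
  show ?thesis
    by (rule hperm_eqI) (simp_all add: a etan_props assms)
qed

text \<open>Multiplying by an expanded identity adds only positions that normalisation removes, here
  and in the children. The two sides are proved together since children reverse the factors.\<close>

lemma etan_idm_hmult:
  assumes "idm E" "wfh T"
  shows "etan (hmult E T) = etan T" "etan (hmult T E) = etan T"
proof -
  have "etan (hmult E T) = etan T \<and> etan (hmult T E) = etan T"
    using assms
  proof (induction "size E + size T" arbitrary: E T rule: less_induct)
    case less
    note E = idm_wfh[OF less.prems(1)] idm_perm[OF less.prems(1)]
    have eq: "etan (hmult (kid E j) (kid T i)) = etan (kid T i) \<and>
      etan (hmult (kid T i) (kid E j)) = etan (kid T i)"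
      \<comment> \<open>These are the indices at which a child of \<open>E\<close> meets
        \<open>kid T i\<close>: \<open>perm T i\<close> in \<open>hmult E T\<close>, and
        \<open>i\<close> in \<open>hmult T E\<close>.\<close>
      if "j = i \<or> j = perm T i" for i j
    proof (cases "i < max (arity E) (arity T)")
      case True
      then have "0 < arity E \<or> 0 < arity T" by auto
      then have "size (kid E j) + size (kid T i) < size E + size T"
        using size_kid_le[of E j] size_kid_le[of T i] size_kid_less[of E j] size_kid_less[of T i]
        by linarith
      then show ?thesis
        using less by (simp add: idm_kid wfh_kid)
    next
      case False
      then show ?thesis
        using that less.prems by (auto simp: kid_beyond wfh_perm_beyond)
    qed
    show ?case
      by (rule conjI; rule etan_cong) (simp_all add: kid_hmult less.prems E wfh_hmult eq)
  qed
  then show "etan (hmult E T) = etan T" "etan (hmult T E) = etan T" by auto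
qed

text \<open>Places \<open>T\<close> below its normal form: the idempotent in front restores the
  removed positions. A mirror image is carried along, because the children of either equation are
  instances of the other.\<close>

lemma hmult_hstar_etan:
  assumes "wfh T"
  shows "hmult (hmult T (hstar T)) (etan T) = T"
proof -
  have "hmult (hmult T (hstar T)) (etan T) = T \<and> hmult (etan T) (hmult (hstar T) T) = T"
    using assms
  proof (induction rule: wfh_induct)
    case (wfh T)
    note p = perm_hstar_comp[OF wfh.hyps]
    note simps = kid_hmult wfh_hstar kid_hstar p wfh_hmult etan_props wfh.hyps wfh_kid
    have IH: "hmult (hmult (kid T i) (hstar (kid T i))) (etan (kid T i)) = kid T i"
      "hmult (etan (kid T i)) (hmult (hstar (kid T i)) (kid T i)) = kid T i" if "i < arity T" for i
      using wfh.IH[OF that] by auto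
    have "hmult (hmult T (hstar T)) (etan T) = T"
      by (rule hperm_eqI) (simp_all add: simps IH)
    moreover have "hmult (etan T) (hmult (hstar T) T) = T"
      by (rule hperm_eqI) (simp_all add: simps IH max_def fun_eq_iff)
    ultimately show ?case ..
  qed
  then show ?thesis ..
qed

section \<open>Head normal forms\<close>

abbreviation apps :: "tm \<Rightarrow> tm list \<Rightarrow> tm" where "apps \<equiv> foldl App"

abbreviation shift :: "nat \<Rightarrow> tm \<Rightarrow> tm" where "shift n \<equiv> ren (\<lambda>i. i + n)"

section \<open>Substitution under blocks of abstractions and applications\<close>

lemma psub_apps: "psub \<sigma> (apps s Ms) = apps (psub \<sigma> s) (map (psub \<sigma>) Ms)"
  by (induction Ms arbitrary: s) simp_all

lemma ren_apps: "ren r (apps s Ms) = apps (ren r s) (map (ren r) Ms)"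
  by (induction Ms arbitrary: s) simp_all

lemma upn: "(up ^^ n) \<sigma> i = (if i < n then Var i else shift n (\<sigma> (i - n)))"
proof (induction n arbitrary: i)
  case (Suc n)
  then show ?case by (cases i) (simp_all add: ren_ren)
qed (simp add: ren_id)

lemma uprn: "(upr ^^ n) r i = (if i < n then i else r (i - n) + n)"
proof (induction n arbitrary: i)
  case (Suc n)
  then show ?case by (cases i) simp_all
qed simp

lemma psub_absn: "psub \<sigma> ((Abs ^^ n) t) = (Abs ^^ n) (psub ((up ^^ n) \<sigma>) t)"
  by (induction n arbitrary: \<sigma>) (simp_all add: funpow_swap1[of up])

lemma ren_absn: "ren r ((Abs ^^ n) t) = (Abs ^^ n) (ren ((upr ^^ n) r) t)"
  by (induction n arbitrary: r) (simp_all add: funpow_swap1[of upr])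

text \<open>The substitution carried out by contracting \<open>length As\<close> abstractions; the
  last argument belongs to the innermost binder, hence the reversed index.\<close>

definition env :: "tm list \<Rightarrow> nat \<Rightarrow> tm" where
  "env As i = (if i < length As then As ! (length As - Suc i) else Var (i - length As))"

lemma psub_env_shift [simp]: "n = length As \<Longrightarrow> psub (env As) (shift n t) = t"
  by (simp add: psub_ren env_def)

lemma bconv_absn: "s =b t \<Longrightarrow> (Abs ^^ n) s =b (Abs ^^ n) t"
  by (induction n) (simp_all add: bconv_Abs)

lemma econv_absn: "s =e t \<Longrightarrow> (Abs ^^ n) s =e (Abs ^^ n) t"
  by (induction n) (simp_all add: econv_Abs)

lemma bconv_apps: "list_all2 bconv Ms Ns \<Longrightarrow> s =b t \<Longrightarrow> apps s Ms =b apps t Ns"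
  by (induction Ms Ns arbitrary: s t rule: list_all2_induct) (simp_all add: bconv_App)

lemma econv_apps: "list_all2 econv Ms Ns \<Longrightarrow> s =e t \<Longrightarrow> apps s Ms =e apps t Ns"
  by (induction Ms Ns arbitrary: s t rule: list_all2_induct) (simp_all add: econv_App)

lemma bconv_apps_head: "s =b t \<Longrightarrow> apps s Ms =b apps t Ms"
  by (induction Ms arbitrary: s t) (simp_all add: bconv_App)

lemma list_all2_map_upt: "(\<And>i. i < n \<Longrightarrow> R (f i) (g i)) \<Longrightarrow> list_all2 R (map f [0..<n]) (map g [0..<n])"
  by (simp add: list_all2_conv_all_nth)

lemma apps_absn: "length As = n \<Longrightarrow> apps ((Abs ^^ n) b) As =b psub (env As) b"
proof (induction As arbitrary: n b)
  case Nil
  have "env [] = Var" by (simp add: fun_eq_iff env_def)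
  with Nil show ?case by simp
next
  case (Cons a As)
  then obtain m where n: "n = Suc m" "length As = m" by auto
  have "apps ((Abs ^^ n) b) (a # As) =b apps (psub (case_nat a Var) ((Abs ^^ m) b)) As"
    using n bconv_redex by (simp add: bconv_apps_head)
  also have "\<dots> = apps ((Abs ^^ m) (psub ((up ^^ m) (case_nat a Var)) b)) As"
    by (simp add: psub_absn)
  also have "\<dots> =b psub (env As) (psub ((up ^^ m) (case_nat a Var)) b)"
    using n by (intro Cons.IH)
  also have "(\<lambda>i. psub (env As) ((up ^^ m) (case_nat a Var) i)) = env (a # As)"
  proof
    fix i
    \<comment> \<open>Index \<open>m\<close> is bound by the outermost abstraction and receives
      \<open>a\<close>; smaller ones belong to the remaining arguments, larger ones are
      free.\<close>
    consider "i < m" | "i = m" | "i > m" by linarith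
    then show "psub (env As) ((up ^^ m) (case_nat a Var) i) = env (a # As) i"
      using n by cases (auto simp: upn env_def nth_Cons' Suc_diff_Suc split: nat.split)
  qed
  then have "psub (env As) (psub ((up ^^ m) (case_nat a Var)) b) = psub (env (a # As)) b"
    by (simp add: psub_psub)
  finally show ?case .
qed

text \<open>Abstractions that find no argument survive; this later bounds the number of leading
  abstractions of a term that becomes neutral when applied.\<close>

lemma apps_absn_partial:
  "length As \<le> n \<Longrightarrow> \<exists>X. apps ((Abs ^^ n) b) As =b (Abs ^^ (n - length As)) X"
proof (induction As arbitrary: n b)
  case (Cons a As)
  then obtain m where n: "n = Suc m" "length As \<le> m" by (cases n) auto
  have "apps ((Abs ^^ n) b) (a # As) =b apps (psub (case_nat a Var) ((Abs ^^ m) b)) As"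
    using n bconv_redex by (simp add: bconv_apps_head)
  moreover obtain X where
    "apps (psub (case_nat a Var) ((Abs ^^ m) b)) As =b (Abs ^^ (m - length As)) X"
    using Cons.IH[OF n(2)] by (auto simp: psub_absn)
  ultimately have "apps ((Abs ^^ n) b) (a # As) =b (Abs ^^ (m - length As)) X"
    by (rule equivclp_trans)
  then show ?case using n(1) by auto
qed (auto intro: equivclp_refl)

definition vars :: "nat \<Rightarrow> tm list" where
  "vars k = map (\<lambda>i. Var (k - Suc i)) [0..<k]"

lemma length_vars [simp]: "length (vars k) = k"
  by (simp add: vars_def)

lemma nth_vars [simp]: "i < k \<Longrightarrow> vars k ! i = Var (k - Suc i)"
  by (simp add: vars_def)

lemma vars_Suc: "vars (Suc k) = map (ren Suc) (vars k) @ [Var 0]"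
  by (rule nth_equalityI) (auto simp: nth_append less_Suc_eq Suc_diff_le)

lemma apps_shift_absn_vars: "apps (shift k ((Abs ^^ k) X)) (vars k) =b X"
proof -
  have "psub (env (vars k)) (ren ((upr ^^ k) (\<lambda>i. i + k)) X) = psub Var X"
    unfolding psub_ren by (rule arg_cong[of _ _ "\<lambda>s. psub s X"]) (auto simp: fun_eq_iff env_def uprn)
  then show ?thesis
    using apps_absn[of "vars k" k "ren ((upr ^^ k) (\<lambda>i. i + k)) X"] by (simp add: ren_absn)
qed

text \<open>Extensionality within pure beta conversion. It is sound for terms that are
  \<open>k\<close>-fold abstractions up to beta, since applying them to fresh variables recovers
  their bodies.\<close>

lemma bconv_absn_ext:
  assumes "P =b (Abs ^^ k) X" "Q =b (Abs ^^ k) Y" "apps (shift k P) (vars k) =b apps (shift k Q) (vars k)"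
  shows "P =b Q"
proof -
  have *: "apps (shift k P) (vars k) =b X" if "P =b (Abs ^^ k) X" for P X
    using bconv_apps_head[OF bconv_ren[OF that]] apps_shift_absn_vars by (rule equivclp_trans)
  have "X =b Y"
    using *[OF assms(1)] *[OF assms(2)] assms(3) by (meson equivclp_sym equivclp_trans)
  then show ?thesis
    using assms(1,2) bconv_absn by (meson equivclp_sym equivclp_trans)
qed

lemma eta_absn: "(Abs ^^ k) (apps (shift k s) (vars k)) =e s"
proof (induction k)
  case 0
  then show ?case by (simp add: vars_def ren_id)
next
  case (Suc k)
  have "apps (shift (Suc k) s) (vars (Suc k)) = App (ren Suc (apps (shift k s) (vars k))) (Var 0)"
    by (simp add: vars_Suc ren_apps ren_ren)
  then have "(Abs ^^ Suc k) (apps (shift (Suc k) s) (vars (Suc k))) =e (Abs ^^ k) (apps (shift k s) (vars k))"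
    using econv_absn[OF eta_econv[OF eta_wrap]] by (simp add: funpow_swap1)
  with Suc show ?case by (rule equivclp_trans[rotated])
qed

section \<open>Uniqueness of head normal forms\<close>

lemma apps_Var_not_Abs: "apps (Var y) Ms \<noteq> Abs t"
  by (induction Ms rule: rev_induct) simp_all

lemma apps_Var_inj: "apps (Var y) Ms = apps (Var z) Ns \<longleftrightarrow> y = z \<and> Ms = Ns"
proof (induction Ms arbitrary: Ns rule: rev_induct)
  case Nil
  then show ?case by (cases Ns rule: rev_cases) auto
next
  case (snoc M Ms)
  then show ?case by (cases Ns rule: rev_cases) auto
qed

lemma hnf_inj: "hnf n y Ms = hnf m z Ns \<longleftrightarrow> n = m \<and> y = z \<and> Ms = Ns"
proof (induction n arbitrary: m)
  case 0
  show ?case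
    by (cases m) (simp_all add: hnf_def apps_Var_inj apps_Var_not_Abs)
next
  case (Suc n)
  show ?case
    using Suc[of "m - 1"] apps_Var_not_Abs by (cases m) (auto simp: hnf_def dest: sym)
qed

lemma beta_apps_Var:
  "beta (apps (Var y) Ms) L \<Longrightarrow>
    \<exists>i N. i < length Ms \<and> beta (Ms ! i) N \<and> L = apps (Var y) (Ms[i := N])"
proof (induction Ms arbitrary: L rule: rev_induct)
  case Nil
  then show ?case by (auto elim: beta.cases)
next
  case (snoc M Ms)
  from snoc.prems have "beta (App (apps (Var y) Ms) M) L" by simp
  then show ?case
  proof (cases rule: beta.cases)
    case (1 s)
    then show ?thesis using apps_Var_not_Abs by metis
  next
    case (2 s')
    with snoc.IH obtain i N where "i < length Ms" "beta (Ms ! i) N" "s' = apps (Var y) (Ms[i := N])"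
      by blast
    with 2 show ?thesis
      by (intro exI[of _ i] exI[of _ N]) (simp add: nth_append list_update_append)
  next
    case (3 t')
    then show ?thesis
      by (intro exI[of _ "length Ms"] exI[of _ t']) (simp add: nth_append list_update_append)
  qed
qed

lemma beta_absn: "beta ((Abs ^^ n) t) L \<Longrightarrow> \<exists>t'. beta t t' \<and> L = (Abs ^^ n) t'"
proof (induction n arbitrary: L)
  case (Suc n)
  then have "beta (Abs ((Abs ^^ n) t)) L" by simp
  then obtain L' where "beta ((Abs ^^ n) t) L'" "L = Abs L'"
    by (cases rule: beta.cases) auto
  with Suc.IH show ?case by fastforce
qed auto

lemma beta_hnf:
  "beta (hnf n y Ms) L \<Longrightarrow> \<exists>i N. i < length Ms \<and> beta (Ms ! i) N \<and> L = hnf n y (Ms[i := N])"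
  unfolding hnf_def by (blast dest: beta_absn beta_apps_Var)

lemma betas_hnf: "beta\<^sup>*\<^sup>* (hnf n y Ms) L \<Longrightarrow> \<exists>Ns. L = hnf n y Ns \<and> list_all2 bconv Ms Ns"
proof (induction rule: rtranclp_induct)
  case base
  have "list_all2 bconv Ms Ms" by (rule list_all2_refl) simp
  then show ?case by blast
next
  case (step L L')
  then obtain Ns where Ns: "L = hnf n y Ns" "list_all2 bconv Ms Ns" by blast
  with beta_hnf[of n y Ns L'] step.hyps obtain i N
    where *: "i < length Ns" "beta (Ns ! i) N" "L' = hnf n y (Ns[i := N])"
    by auto
  have "list_all2 bconv Ms (Ns[i := N])"
    using Ns(2) * by (auto simp: list_all2_conv_all_nth nth_list_update intro: equivclp_into_equivclp)
  with * show ?case by blast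
qed

text \<open>A common reduct exists by Church-Rosser, and reduction from a head normal form never
  touches the binders or the head.\<close>

lemma hnf_unique:
  assumes "hnf n y Ms =b hnf m z Ns"
  shows "n = m \<and> y = z \<and> list_all2 bconv Ms Ns"
proof -
  obtain u where u: "beta\<^sup>*\<^sup>* (hnf n y Ms) u" "beta\<^sup>*\<^sup>* (hnf m z Ns) u"
    using assms by (rule church_rosser)
  from betas_hnf[OF u(1)] betas_hnf[OF u(2)] obtain Ks where
    "n = m" "y = z" "list_all2 bconv Ms Ks" "list_all2 bconv Ns Ks"
    by (auto simp: hnf_inj)
  then show ?thesis
    unfolding list_all2_conv_all_nth by (metis equivclp_sym equivclp_trans)
qed

lemma apps_Var_unique: "apps (Var y) Ms =b apps (Var z) Ns \<Longrightarrow> y = z \<and> list_all2 bconv Ms Ns"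
  using hnf_unique[of 0 y Ms 0 z Ns] by (simp add: hnf_def)

section \<open>The terms of finite hereditary permutations\<close>

text \<open>\<open>happ T s\<close> is the hereditary permutation \<open>T\<close> applied to \<open>s\<close>, with the redexes at the top contracted.\<close>

function happ :: "hperm \<Rightarrow> tm \<Rightarrow> tm" where
  "happ T s = (Abs ^^ arity T) (apps (shift (arity T) s)
    (map (\<lambda>i. happ (kid T i) (Var (arity T - Suc (perm T i)))) [0..<arity T]))"
  by pat_completeness auto

termination
  by (relation "measure (\<lambda>(T, s). size T)") (simp_all add: size_kid)

declare happ.simps [simp del]

lemma happ_Var:
  "happ T (Var j) = hnf (arity T) (j + arity T)
    (map (\<lambda>i. happ (kid T i) (Var (arity T - Suc (perm T i)))) [0..<arity T])"
  by (subst happ.simps) (simp add: hnf_def)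

text \<open>All free variables come from \<open>s\<close>: each child is applied to an index of the
  form \<open>arity T - Suc _\<close>, which is bound by the leading block and hence fixed by the
  lifted substitution.\<close>

lemma psub_happ: "psub \<sigma> (happ T s) = happ T (psub \<sigma> s)"
proof (induction T arbitrary: \<sigma> s rule: kid_induct)
  case (kids T)
  have "psub ((up ^^ arity T) \<sigma>) (shift (arity T) s) = shift (arity T) (psub \<sigma> s)"
    by (simp add: psub_ren ren_psub upn)
  moreover have "map (psub ((up ^^ arity T) \<sigma>))
      (map (\<lambda>i. happ (kid T i) (Var (arity T - Suc (perm T i)))) [0..<arity T]) =
    map (\<lambda>i. happ (kid T i) (Var (arity T - Suc (perm T i)))) [0..<arity T]"
    by (auto simp: kids.IH upn)
  ultimately show ?case
    by (subst (1 2) happ.simps) (simp only: psub_absn psub_apps)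
qed

lemma ren_happ: "ren r (happ T s) = happ T (ren r s)"
  by (simp add: ren_conv_psub psub_happ)

lemma happ_triv [simp]: "happ triv s = s"
  by (subst happ.simps) (simp add: ren_id)

text \<open>The number \<open>k\<close> may exceed the arity, so that trees of different arity can
  be compared on one argument list; surplus arguments pass unchanged.\<close>

lemma happ_apps:
  assumes "wfh T" "length As = k" "arity T \<le> k"
  shows "apps (happ T s) As =b apps s (map (\<lambda>i. happ (kid T i) (As ! perm T i)) [0..<k])"
proof -
  define n where "n = arity T"
  have n: "length (take n As) = n" using assms by (simp add: n_def)
  define Bs where "Bs = map (\<lambda>i. happ (kid T i) (Var (n - Suc (perm T i)))) [0..<n]"
  have "apps (happ T s) (take n As) =b psub (env (take n As)) (apps (shift n s) Bs)"
    unfolding happ.simps[of T s] n_def[symmetric] Bs_def[symmetric] by (rule apps_absn[OF n])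
  also have "\<dots> = apps s (map (\<lambda>i. happ (kid T i) (As ! perm T i)) [0..<n])"
  proof -
    have "map (psub (env (take n As))) Bs = map (\<lambda>i. happ (kid T i) (As ! perm T i)) [0..<n]"
    proof (rule nth_equalityI)
      fix i assume "i < length (map (psub (env (take n As))) Bs)"
      then have i: "i < n" by (simp add: Bs_def)
      then have "perm T i < n" using assms(1) by (simp add: n_def wfh_perm_less)
      moreover have "n \<le> length As" using assms by (simp add: n_def)
      ultimately show "map (psub (env (take n As))) Bs ! i = map (\<lambda>i. happ (kid T i) (As ! perm T i)) [0..<n] ! i"
        using i by (simp add: Bs_def psub_happ env_def Suc_diff_Suc min_def)
    qed (simp add: Bs_def)
    then show ?thesis using n by (simp add: psub_apps)
  qed
  finally have *: "apps (happ T s) (take n As) =b \<dots>" .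
  have "drop n As = map (\<lambda>i. happ (kid T i) (As ! perm T i)) [n..<k]"
    using assms by (intro nth_equalityI) (simp_all add: n_def kid_beyond wfh_perm_beyond)
  moreover have "[0..<k] = [0..<n] @ [n..<k]"
    using assms upt_add_eq_append[of 0 n "k - n"] by (simp add: n_def)
  moreover have "apps (happ T s) As = apps (apps (happ T s) (take n As)) (drop n As)"
    by (simp flip: foldl_append)
  ultimately show ?thesis
    using bconv_apps_head[OF *] by simp
qed

lemma happ_absn_bconv: "\<exists>X. happ T s =b (Abs ^^ arity T) X"
  unfolding happ.simps[of T s] by (rule exI) (rule equivclp_refl)

text \<open>If \<open>T\<close> is the shorter tree, its body applies \<open>happ U\<close> to
  \<open>arity T\<close> arguments; these use up that many abstractions of \<open>U\<close>, and the
  rest remain below those of \<open>T\<close>.\<close>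

lemma happ_happ_absn: "\<exists>X. happ T (happ U s) =b (Abs ^^ max (arity T) (arity U)) X"
proof (cases "arity T \<le> arity U")
  case True
  define Bs where "Bs = map (\<lambda>i. happ (kid T i) (Var (arity T - Suc (perm T i)))) [0..<arity T]"
  have "happ T (happ U s) = (Abs ^^ arity T) (apps (happ U (shift (arity T) s)) Bs)"
    by (subst happ.simps) (simp add: Bs_def ren_happ)
  moreover obtain X where "apps (happ U (shift (arity T) s)) Bs =b (Abs ^^ (arity U - length Bs)) X"
    using apps_absn_partial[of Bs "arity U"] True unfolding happ.simps[of U] by (auto simp: Bs_def)
  ultimately have "happ T (happ U s) =b (Abs ^^ arity T) ((Abs ^^ (arity U - arity T)) X)"
    by (simp add: bconv_absn Bs_def)
  then show ?thesis
    using True by (metis comp_apply funpow_add le_add_diff_inverse max_def)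
next
  case False
  then show ?thesis using happ_absn_bconv[of T] by (simp add: max_def)
qed

text \<open>Both sides are abstractions over the larger arity, so it suffices to compare them on
  that many fresh variables. There \<open>happ_apps\<close> evaluates first \<open>T\<close> and
  then \<open>U\<close>, and the children meet in reversed order.\<close>

lemma happ_happ: "wfh T \<Longrightarrow> wfh U \<Longrightarrow> happ T (happ U s) =b happ (hmult T U) s"
proof (induction T U arbitrary: s rule: hmult.induct)
  case (1 T U)
  define k where "k = max (arity T) (arity U)"
  obtain X where X: "happ T (happ U s) =b (Abs ^^ k) X"
    using happ_happ_absn unfolding k_def by blast
  obtain Y where Y: "happ (hmult T U) s =b (Abs ^^ k) Y"
    using happ_absn_bconv[of "hmult T U" s] unfolding k_def by auto
  show ?case
  proof (rule bconv_absn_ext[OF X Y])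
    let ?f = "\<lambda>i. happ (kid T i) (vars k ! perm T i)"
    have "apps (shift k (happ T (happ U s))) (vars k) =b apps (happ U (shift k s)) (map ?f [0..<k])"
      using happ_apps[of T "vars k" k] 1(2) by (simp add: ren_happ k_def)
    also have "\<dots> =b apps (shift k s) (map (\<lambda>i. happ (kid U i) (map ?f [0..<k] ! perm U i)) [0..<k])"
      using 1(3) by (intro happ_apps) (simp_all add: k_def)
    also have "\<dots> =b apps (shift k s) (map (\<lambda>i. happ (kid (hmult T U) i) (vars k ! perm (hmult T U) i)) [0..<k])"
    proof (intro bconv_apps list_all2_map_upt equivclp_refl)
      fix i assume i: "i < k"
      then have "perm U i < k" using 1(3) by (simp add: k_def wfh_perm_less')
      then show "happ (kid U i) (map ?f [0..<k] ! perm U i) =b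
          happ (kid (hmult T U) i) (vars k ! perm (hmult T U) i)"
        using 1 i by (simp add: kid_hmult k_def wfh_kid)
    qed
    also have "\<dots> =b apps (shift k (happ (hmult T U) s)) (vars k)"
      using happ_apps[of "hmult T U" "vars k" k] 1(2,3)
      by (simp add: ren_happ k_def wfh_hmult equivclp_sym)
    finally show "apps (shift k (happ T (happ U s))) (vars k) =b apps (shift k (happ (hmult T U) s)) (vars k)" .
  qed
qed

lemma happ_idm_econv: "idm T \<Longrightarrow> happ T s =e s"
proof (induction T arbitrary: s rule: kid_induct)
  case (kids T)
  have "happ T s =e (Abs ^^ arity T) (apps (shift (arity T) s) (vars (arity T)))"
    unfolding happ.simps[of T s] vars_def
    using kids by (intro econv_absn econv_apps list_all2_map_upt) (simp_all add: idm_perm idm_kid)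
  then show ?case using eta_absn by (rule equivclp_trans)
qed

text \<open>Head normal forms determine the arity and the arguments; the variable below each child
  in turn determines the permutation, as reflecting positions into indices is injective.\<close>

lemma happ_Var_inject:
  assumes "wfh T" "wfh U" "happ T (Var i) =b happ U (Var j)"
  shows "T = U \<and> i = j"
  using assms
proof (induction T arbitrary: U i j rule: kid_induct)
  case (kids T)
  from kids.prems(3) have *: "arity T = arity U \<and> i = j"
    "list_all2 bconv (map (\<lambda>i. happ (kid T i) (Var (arity T - Suc (perm T i)))) [0..<arity T])
      (map (\<lambda>i. happ (kid U i) (Var (arity U - Suc (perm U i)))) [0..<arity U])"
    unfolding happ_Var[of T i] happ_Var[of U j] by (auto dest: hnf_unique)
  then have k: "kid T q = kid U q \<and> arity T - Suc (perm T q) = arity T - Suc (perm U q)"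
    if "q < arity T" for q
    using that kids.prems(1,2) by (intro kids.IH) (auto simp: list_all2_conv_all_nth wfh_kid)
  have p: "perm T q = perm U q" for q
  proof (cases "q < arity T")
    case True
    then have "perm T q < arity T" "perm U q < arity T"
      using * wfh_perm_less[OF kids.prems(1)] wfh_perm_less[OF kids.prems(2)] by auto
    with k[OF True] show ?thesis by linarith
  next
    case False
    then show ?thesis using * kids.prems(1,2) by (simp add: wfh_perm_beyond)
  qed
  show ?case
    using * k p by (auto intro!: hperm_eqI[of T U] simp: fun_eq_iff)
qed

lemma happ_Var_normal: "\<not> beta (happ T (Var j)) L"
proof (induction T arbitrary: j L rule: kid_induct)
  case (kids T)
  then show ?case unfolding happ_Var[of T] by (auto dest!: beta_hnf)
qed

definition to_tm :: "hperm \<Rightarrow> tm" where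
  "to_tm T = Abs (happ T (Var 0))"

lemma App_to_tm: "App (ren r (to_tm T)) s =b happ T s"
  using bconv_redex[of "happ T (Var 0)" s] by (simp add: to_tm_def ren_happ psub_happ)

section \<open>Composition of terms\<close>

lemma comp_bconv: "comp M N =b Abs (App (ren Suc M) (App (ren Suc N) (Var 0)))"
proof -
  have "apps comb_B [M, N] =b psub (env [M, N]) (Abs (App (Var 2) (App (Var 1) (Var 0))))"
    using apps_absn[of "[M, N]" 2 "Abs (App (Var 2) (App (Var 1) (Var 0)))"]
    by (simp only: comb_B_def numeral_2_eq_2 funpow.simps o_def id_apply list.size)
  also have "\<dots> = Abs (App (ren Suc M) (App (ren Suc N) (Var 0)))"
    by (simp add: env_def up_def numeral_2_eq_2)
  finally show ?thesis by (simp add: comp_def)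
qed

lemma comp_cong_bconv: "M =b M' \<Longrightarrow> N =b N' \<Longrightarrow> comp M N =b comp M' N'"
  unfolding comp_def by (intro bconv_App) simp_all

lemma comp_cong_econv: "M =e M' \<Longrightarrow> N =e N' \<Longrightarrow> comp M N =e comp M' N'"
  unfolding comp_def by (intro econv_App) simp_all

lemma comp_to_tm:
  assumes "wfh T" "wfh U"
  shows "comp (to_tm T) (to_tm U) =b to_tm (hmult T U)"
proof -
  have "App (ren Suc (to_tm T)) (App (ren Suc (to_tm U)) (Var 0)) =b happ T (happ U (Var 0))"
    using App_to_tm bconv_App[OF equivclp_refl App_to_tm] equivclp_trans by metis
  also have "\<dots> =b happ (hmult T U) (Var 0)" using assms by (rule happ_happ)
  finally have "Abs (App (ren Suc (to_tm T)) (App (ren Suc (to_tm U)) (Var 0))) =b to_tm (hmult T U)"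
    unfolding to_tm_def by (rule bconv_Abs)
  with comp_bconv show ?thesis by (rule equivclp_trans)
qed

lemma to_tm_triv: "to_tm triv = comb_I"
  by (simp add: to_tm_def comb_I_def)

lemma App_ren_comp: "App (ren r (comp M N)) s =b App (ren r M) (App (ren r N) s)"
proof -
  have "App (ren r (comp M N)) s =b App (ren r (Abs (App (ren Suc M) (App (ren Suc N) (Var 0))))) s"
    by (intro bconv_App bconv_ren comp_bconv) simp
  also have "\<dots> =b App (ren r M) (App (ren r N) s)"
    using bconv_redex[of "App (ren (upr r) (ren Suc M)) (App (ren (upr r) (ren Suc N)) (Var 0))" s]
    by (simp add: ren_Suc_upr)
  finally show ?thesis .
qed

lemma comp_assoc: "comp (comp M N) K =b comp M (comp N K)"
proof -
  have "App (ren Suc (comp M N)) (App (ren Suc K) (Var 0)) =b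
    App (ren Suc M) (App (ren Suc N) (App (ren Suc K) (Var 0)))"
    by (rule App_ren_comp)
  also have "\<dots> =b App (ren Suc M) (App (ren Suc (comp N K)) (Var 0))"
    by (intro bconv_App equivclp_refl equivclp_sym[OF App_ren_comp])
  finally show ?thesis
    using comp_bconv bconv_Abs equivclp_sym equivclp_trans by meson
qed

text \<open>Eta enters because a composition is always convertible to an abstraction, whereas
  \<open>M\<close> is arbitrary.\<close>

lemma comp_I_left: "comp comb_I M =e M"
  and comp_I_right: "comp M comb_I =e M"
proof -
  have I: "App (ren Suc comb_I) s =e s" for s
    using bconv_econv[OF App_to_tm[of Suc triv s]] by (simp add: to_tm_triv)
  have eta: "Abs (App (ren Suc M) (Var 0)) =e M" by (rule eta_econv[OF eta_wrap])
  have "Abs (App (ren Suc comb_I) (App (ren Suc M) (Var 0))) =e Abs (App (ren Suc M) (Var 0))"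
    by (intro econv_Abs I)
  then show "comp comb_I M =e M"
    using bconv_econv[OF comp_bconv] eta equivclp_trans by metis
  have "Abs (App (ren Suc M) (App (ren Suc comb_I) (Var 0))) =e Abs (App (ren Suc M) (Var 0))"
    by (intro econv_Abs econv_App equivclp_refl I)
  then show "comp M comb_I =e M"
    using bconv_econv[OF comp_bconv] eta equivclp_trans by metis
qed

section \<open>Terms convertible to a variable\<close>

text \<open>Parallel eta reduction. A beta step can copy or erase an eta redex, so single eta steps
  are not preserved; simultaneous ones are.\<close>

inductive peta :: "tm \<Rightarrow> tm \<Rightarrow> bool" where
  peta_Var: "peta (Var i) (Var i)"
| peta_App: "peta s s' \<Longrightarrow> peta t t' \<Longrightarrow> peta (App s t) (App s' t')"
| peta_Abs: "peta s s' \<Longrightarrow> peta (Abs s) (Abs s')"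
| peta_wrap: "peta s s' \<Longrightarrow> peta (Abs (App (ren Suc s) (Var 0))) s'"

lemma peta_refl: "peta t t"
  by (induction t) (auto intro: peta.intros)

lemma eta_peta: "eta s t \<Longrightarrow> peta s t"
  by (induction rule: eta.induct) (auto intro: peta.intros peta_refl)

lemma peta_ren: "peta s t \<Longrightarrow> peta (ren r s) (ren r t)"
proof (induction arbitrary: r rule: peta.induct)
  case (peta_wrap s s')
  show ?case by (simp add: ren_Suc_upr) (intro peta.intros peta_wrap.IH)
qed (auto intro: peta.intros)

lemma peta_psub: "peta s t \<Longrightarrow> (\<And>i. peta (\<sigma> i) (\<tau> i)) \<Longrightarrow> peta (psub \<sigma> s) (psub \<tau> t)"
proof (induction arbitrary: \<sigma> \<tau> rule: peta.induct)
  case (peta_Abs s s')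
  have "peta (up \<sigma> i) (up \<tau> i)" for i
    using peta_Abs.prems by (cases i) (auto intro: peta_ren peta_refl)
  then show ?case by (simp add: peta.peta_Abs peta_Abs.IH)
next
  case (peta_wrap s s')
  then show ?case by (simp add: psub_up_ren_Suc) (intro peta.intros peta_wrap.IH)
qed (auto intro: peta.intros)

lemma peta_psub_cons: "peta s s' \<Longrightarrow> peta t t' \<Longrightarrow> peta (psub (case_nat t Var) s) (psub (case_nat t' Var) s')"
  by (rule peta_psub) (auto split: nat.split intro: peta_refl)

text \<open>Renaming creates no redexes. This serves for beta steps inside the weakened body of an
  eta redex.\<close>

lemma beta_ren_inv: "beta (ren r s) u \<Longrightarrow> \<exists>v. u = ren r v \<and> beta s v"
proof (induction s arbitrary: r u)
  case (Var i)
  then show ?case by (auto elim: beta.cases)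
next
  case (App s t)
  from App.prems have "beta (App (ren r s) (ren r t)) u" by simp
  then show ?case
  proof (cases rule: beta.cases)
    case (1 s0)
    then obtain s1 where "s = Abs s1" "s0 = ren (upr r) s1" by (cases s) auto
    with 1 show ?thesis
      using beta_redex[of s1 t] by (auto simp: ren_psub_cons intro!: exI[of _ "psub (case_nat t Var) s1"])
  next
    case (2 s')
    with App.IH(1) obtain v where "s' = ren r v" "beta s v" by blast
    with 2 show ?thesis by (intro exI[of _ "App v t"]) (auto intro: beta.intros)
  next
    case (3 t')
    with App.IH(2) obtain v where "t' = ren r v" "beta t v" by blast
    with 3 show ?thesis by (intro exI[of _ "App s v"]) (auto intro: beta.intros)
  qed
next
  case (Abs s)
  from Abs.prems have "beta (Abs (ren (upr r) s)) u" by simp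
  then obtain u' where "u = Abs u'" "beta (ren (upr r) s) u'"
    by (cases rule: beta.cases) auto
  with Abs.IH obtain v where "u' = ren (upr r) v" "beta s v" by blast
  with \<open>u = Abs u'\<close> show ?case by (intro exI[of _ "Abs v"]) (auto intro: beta.intros)
qed

lemma beta_wrap_Abs: "beta (Abs (App (ren Suc (Abs s)) (Var 0))) (Abs s)"
proof -
  have "psub (case_nat (Var 0) Var) (ren (upr Suc) s) = psub Var s"
    unfolding psub_ren
    by (rule arg_cong[of _ _ "\<lambda>\<sigma>. psub \<sigma> s"]) (auto simp: fun_eq_iff upr_def split: nat.split)
  then show ?thesis
    using beta_redex[of "ren (upr Suc) s" "Var 0"] by (auto intro: beta.intros)
qed

lemma beta_wrap_redex: "beta (App (Abs (App (ren Suc s) (Var 0))) t) (App s t)"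
  using beta_redex[of "App (ren Suc s) (Var 0)" t] by simp

lemma beta_ren: "beta s t \<Longrightarrow> beta (ren r s) (ren r t)"
  by (simp add: ren_conv_psub beta_psub)

lemma betas_wrap: "beta\<^sup>*\<^sup>* s t \<Longrightarrow> beta\<^sup>*\<^sup>* (Abs (App (ren Suc s) (Var 0))) (Abs (App (ren Suc t) (Var 0)))"
  by (rule rtranclp_cong1) (auto intro: beta.intros beta_ren)

lemma peta_beta: "peta s s' \<Longrightarrow> beta s t \<Longrightarrow> \<exists>t'. peta t t' \<and> beta\<^sup>*\<^sup>* s' t'"
proof (induction arbitrary: t rule: peta.induct)
  case (peta_Var i)
  then show ?case by (auto elim: beta.cases)
next
  case (peta_App s s' u u')
  from peta_App.prems show ?case
  proof (cases rule: beta.cases)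
    case (1 s0)
    from peta_App.hyps(1) show ?thesis
    proof (cases rule: peta.cases)
      case (peta_Abs s1 s1')
      with 1 peta_App.hyps show ?thesis
        by (auto intro!: exI[of _ "psub (case_nat u' Var) s1'"] peta_psub_cons
            r_into_rtranclp[of beta, OF beta_redex])
    next
      \<comment> \<open>The beta redex is an eta redex applied to an argument: contracting it only
        removes the wrapper, so the right side does not move.\<close>
      case (peta_wrap v)
      with 1 peta_App.hyps show ?thesis
        by (auto intro!: exI[of _ "App s' u'"] peta.intros)
    qed (use 1 in auto)
  next
    case (2 s1)
    with peta_App.IH(1) obtain s1' where "peta s1 s1'" "beta\<^sup>*\<^sup>* s' s1'" by blast
    with 2 peta_App.hyps show ?thesis
      by (auto intro!: exI[of _ "App s1' u'"] peta.intros betas_App)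
  next
    case (3 u1)
    with peta_App.IH(2) obtain u1' where "peta u1 u1'" "beta\<^sup>*\<^sup>* u' u1'" by blast
    with 3 peta_App.hyps show ?thesis
      by (auto intro!: exI[of _ "App s' u1'"] peta.intros betas_App)
  qed
next
  case (peta_Abs s s')
  from peta_Abs.prems obtain s1 where "t = Abs s1" "beta s s1" by (cases rule: beta.cases) auto
  moreover from this peta_Abs.IH obtain s1' where "peta s1 s1'" "beta\<^sup>*\<^sup>* s' s1'" by blast
  ultimately show ?case by (auto intro!: exI[of _ "Abs s1'"] peta.intros betas_Abs)
next
  case (peta_wrap s s')
  from peta_wrap.prems obtain u where u: "t = Abs u" "beta (App (ren Suc s) (Var 0)) u"
    by (cases rule: beta.cases) auto
  from u(2) show ?case
  proof (cases rule: beta.cases)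
    \<comment> \<open>Here the eta redex wraps an abstraction, and the beta step restores that
      abstraction.\<close>
    case (1 s0)
    then obtain s1 where s: "s = Abs s1" "s0 = ren (upr Suc) s1" by (cases s) auto
    have "psub (case_nat (Var 0) Var) (ren (upr Suc) s1) = psub Var s1"
      unfolding psub_ren
      by (rule arg_cong[of _ _ "\<lambda>\<sigma>. psub \<sigma> s1"]) (auto simp: fun_eq_iff upr_def split: nat.split)
    with 1 s u have "t = s" by simp
    with peta_wrap.hyps show ?thesis by blast
  next
    case (2 w)
    then obtain v where v: "w = ren Suc v" "beta s v" using beta_ren_inv by blast
    with peta_wrap.IH obtain s1' where "peta v s1'" "beta\<^sup>*\<^sup>* s' s1'" by blast
    with u 2 v show ?thesis by (auto intro!: exI[of _ s1'] peta.intros)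
  next
    case (3 w)
    then show ?thesis by (auto elim: beta.cases)
  qed
qed

lemma peta_betas:
  assumes "beta\<^sup>*\<^sup>* s t" "peta s s'"
  shows "\<exists>t'. peta t t' \<and> beta\<^sup>*\<^sup>* s' t'"
  using assms
proof (induction rule: rtranclp_induct)
  case base
  then show ?case by blast
next
  case (step t u)
  then obtain t' where "peta t t'" "beta\<^sup>*\<^sup>* s' t'" by blast
  with peta_beta[OF _ step.hyps(2)] show ?case by (meson rtranclp_trans)
qed

text \<open>Every eta wrapper around an abstraction can be undone by a beta step.\<close>

lemma peta_Abs_inv: "peta s (Abs t) \<Longrightarrow> \<exists>u. beta\<^sup>*\<^sup>* s (Abs u) \<and> peta u t"
proof (induction s "Abs t" rule: peta.induct)
  case (peta_wrap s)
  then obtain u where u: "beta\<^sup>*\<^sup>* s (Abs u)" "peta u t" by blast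
  have "beta\<^sup>*\<^sup>* (Abs (App (ren Suc s) (Var 0))) (Abs u)"
    using betas_wrap[OF u(1)] beta_wrap_Abs by (rule rtranclp.rtrancl_into_rtrancl)
  with u(2) show ?case by blast
qed auto

text \<open>Eta postponement: redexes hidden behind eta wrappers are first uncovered by beta
  steps.\<close>

lemma beta_peta: "peta s t \<Longrightarrow> beta t u \<Longrightarrow> \<exists>v. beta\<^sup>*\<^sup>* s v \<and> peta v u"
proof (induction arbitrary: u rule: peta.induct)
  case (peta_Var i)
  then show ?case by (auto elim: beta.cases)
next
  case (peta_App s s' t t')
  from peta_App.prems show ?case
  proof (cases rule: beta.cases)
    case (1 s0')
    then obtain s0 where s0: "beta\<^sup>*\<^sup>* s (Abs s0)" "peta s0 s0'"
      using peta_Abs_inv peta_App.hyps(1) by blast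
    have "beta\<^sup>*\<^sup>* (App s t) (psub (case_nat t Var) s0)"
      using betas_App[OF s0(1) rtranclp.rtrancl_refl] beta_redex by (rule rtranclp.rtrancl_into_rtrancl)
    with 1 s0 peta_App.hyps(2) show ?thesis by (auto intro: peta_psub_cons)
  next
    case (2 s1)
    with peta_App.IH(1) obtain v where "beta\<^sup>*\<^sup>* s v" "peta v s1" by blast
    with 2 peta_App.hyps show ?thesis
      by (auto intro!: exI[of _ "App v t"] peta.intros betas_App)
  next
    case (3 t1)
    with peta_App.IH(2) obtain v where "beta\<^sup>*\<^sup>* t v" "peta v t1" by blast
    with 3 peta_App.hyps show ?thesis
      by (auto intro!: exI[of _ "App s v"] peta.intros betas_App)
  qed
next
  case (peta_Abs s s')
  from peta_Abs.prems obtain s1 where "u = Abs s1" "beta s' s1" by (cases rule: beta.cases) auto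
  moreover from this peta_Abs.IH obtain v where "beta\<^sup>*\<^sup>* s v" "peta v s1" by blast
  ultimately show ?case by (auto intro!: exI[of _ "Abs v"] peta.intros betas_Abs)
next
  case (peta_wrap s s')
  then obtain v where "beta\<^sup>*\<^sup>* s v" "peta v u" by blast
  then show ?case by (blast intro: betas_wrap peta.intros)
qed

lemma betas_peta:
  assumes "beta\<^sup>*\<^sup>* t u" "peta s t"
  shows "\<exists>v. beta\<^sup>*\<^sup>* s v \<and> peta v u"
  using assms
proof (induction rule: rtranclp_induct)
  case base
  then show ?case by blast
next
  case (step u w)
  then obtain v where "beta\<^sup>*\<^sup>* s v" "peta v u" by blast
  with beta_peta[OF _ step.hyps(2)] show ?case by (meson rtranclp_trans)
qed

lemma peta_absn_inv: "peta s ((Abs ^^ n) t) \<Longrightarrow> \<exists>u. s =b (Abs ^^ n) u \<and> peta u t"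
proof (induction n arbitrary: s)
  case 0
  then show ?case by (auto intro: equivclp_refl)
next
  case (Suc n)
  then obtain v where v: "beta\<^sup>*\<^sup>* s (Abs v)" "peta v ((Abs ^^ n) t)"
    using peta_Abs_inv by fastforce
  with Suc.IH obtain u where u: "v =b (Abs ^^ n) u" "peta u t" by blast
  have "s =b (Abs ^^ Suc n) u"
    using equivclp_trans[OF rtranclp_into_equivclp[OF v(1)] bconv_Abs[OF u(1)]] by simp
  with u show ?case by blast
qed

text \<open>Up to beta at most one wrapper survives at the top: a wrapper vanishes when the term
  receives an argument, and nested ones collapse.\<close>

lemma peta_apps_Var_inv:
  "peta s (apps (Var y) Ms) \<Longrightarrow> \<exists>Ns. list_all2 peta Ns Ms \<and>
    (s =b apps (Var y) Ns \<or> s =b Abs (App (ren Suc (apps (Var y) Ns)) (Var 0)))"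
proof (induction s "apps (Var y) Ms" arbitrary: Ms rule: peta.induct)
  case (peta_Var i)
  then have "y = i \<and> Ms = []"
    using apps_Var_inj[of i "[]" y Ms] by auto
  then show ?case by (intro exI[of _ "[]"]) auto
next
  case (peta_App s s' t t')
  from peta_App.hyps(5) obtain Ms0 where Ms: "Ms = Ms0 @ [t']" "s' = apps (Var y) Ms0"
    by (cases Ms rule: rev_cases) auto
  with peta_App.hyps(2) obtain Ns where Ns: "list_all2 peta Ns Ms0"
    "s =b apps (Var y) Ns \<or> s =b Abs (App (ren Suc (apps (Var y) Ns)) (Var 0))" by blast
  from Ns(2) have "App s t =b App (apps (Var y) Ns) t"
  proof
    assume "s =b Abs (App (ren Suc (apps (Var y) Ns)) (Var 0))"
    then have "App s t =b App (Abs (App (ren Suc (apps (Var y) Ns)) (Var 0))) t"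
      by (intro bconv_App) auto
    also have "\<dots> =b App (apps (Var y) Ns) t"
      using beta_wrap_redex by (rule r_into_equivclp)
    finally show ?thesis .
  qed (auto intro: bconv_App)
  then show ?case
    using Ns(1) Ms peta_App.hyps(3) by (intro exI[of _ "Ns @ [t]"]) (auto intro: list_all2_appendI)
next
  case (peta_Abs s s')
  then show ?case using apps_Var_not_Abs by metis
next
  case (peta_wrap s)
  then obtain Ns where Ns: "list_all2 peta Ns Ms"
    "s =b apps (Var y) Ns \<or> s =b Abs (App (ren Suc (apps (Var y) Ns)) (Var 0))" by blast
  from Ns(2) have "Abs (App (ren Suc s) (Var 0)) =b Abs (App (ren Suc (apps (Var y) Ns)) (Var 0))"
  proof
    let ?w = "Abs (App (ren Suc (apps (Var y) Ns)) (Var 0))"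
    assume "s =b ?w"
    then have "Abs (App (ren Suc s) (Var 0)) =b Abs (App (ren Suc ?w) (Var 0))"
      by (intro bconv_Abs bconv_App bconv_ren) auto
    also have "\<dots> =b ?w"
      using beta_wrap_Abs by (rule r_into_equivclp)
    finally show ?thesis .
  qed (intro bconv_Abs bconv_App bconv_ren equivclp_refl)
  with Ns(1) show ?case by blast
qed

lemma idm_build:
  assumes "\<And>i. i < length Ns \<Longrightarrow> \<exists>T. idm T \<and> Ns ! i =b happ T (Var (length Ns - Suc i))"
  shows "\<exists>T. idm T \<and> hnf (length Ns) (x + length Ns) Ns =b happ T (Var x)"
proof -
  obtain f where f: "idm (f i)" "Ns ! i =b happ (f i) (Var (length Ns - Suc i))"
    if "i < length Ns" for i
    using assms by metis
  define T where "T = Perm id (map f [0..<length Ns])"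
  have T: "arity T = length Ns" "perm T = id" "i < length Ns \<Longrightarrow> kid T i = f i" for i
    by (simp_all add: T_def kid_def)
  have "idm T"
    by (rule idm.intros) (simp_all add: T f)
  moreover have "hnf (length Ns) (x + length Ns) Ns =b happ T (Var x)"
    unfolding happ_Var[of T] T(1) hnf_def
    by (intro bconv_absn bconv_apps equivclp_refl) (simp add: list_all2_conv_all_nth T f)
  ultimately show ?thesis by blast
qed

text \<open>
  No confluence of beta-eta is needed: the terms beta convertible to some \<open>happ T (Var x)\<close> with
  \<open>idm T\<close> are closed under eta steps in both directions.
\<close>

lemma peta_happ_inv:
  "peta s (happ T (Var x)) \<Longrightarrow> idm T \<Longrightarrow> \<exists>U. idm U \<and> s =b happ U (Var x)"
proof (induction T arbitrary: s x rule: kid_induct)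
  case (kids T)
  define n where "n = arity T"
  define Ms where "Ms = map (\<lambda>i. happ (kid T i) (Var (n - Suc i))) [0..<n]"
  have "happ T (Var x) = (Abs ^^ n) (apps (Var (x + n)) Ms)"
    using idm_perm[OF kids.prems(2)] by (subst happ_Var) (simp add: hnf_def n_def Ms_def)
  with kids.prems(1) peta_absn_inv obtain u where u: "s =b (Abs ^^ n) u" "peta u (apps (Var (x + n)) Ms)"
    by metis
  then obtain Ns where Ns: "list_all2 peta Ns Ms"
    "u =b apps (Var (x + n)) Ns \<or> u =b Abs (App (ren Suc (apps (Var (x + n)) Ns)) (Var 0))"
    using peta_apps_Var_inv by blast
  have len: "length Ns = n"
    using Ns(1) by (simp add: list_all2_conv_all_nth Ms_def)
  have kids_Ns: "\<exists>U. idm U \<and> Ns ! i =b happ U (Var (n - Suc i))" if "i < n" for i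
  proof -
    have "peta (Ns ! i) (Ms ! i)" using Ns(1) len that by (simp add: list_all2_conv_all_nth)
    then show ?thesis
      using that kids.prems(2) by (intro kids.IH[of i]) (simp_all add: n_def Ms_def idm_kid)
  qed
  from Ns(2) show ?case
  proof
    assume "u =b apps (Var (x + n)) Ns"
    with u(1) have "s =b hnf n (x + n) Ns"
      unfolding hnf_def using bconv_absn equivclp_trans by metis
    then show ?thesis
      using idm_build[of Ns x] kids_Ns equivclp_trans unfolding len by meson
  next
    assume *: "u =b Abs (App (ren Suc (apps (Var (x + n)) Ns)) (Var 0))"
    \<comment> \<open>The wrapper acts as one more innermost binder: the old arguments are weakened,
      and the new last argument is the bound variable itself, with child
      \<open>triv\<close>.\<close>
    define Ks where "Ks = map (ren Suc) Ns @ [Var 0]"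
    have lenK: "length Ks = Suc n" by (simp add: Ks_def len)
    have "\<exists>U. idm U \<and> Ks ! i =b happ U (Var (Suc n - Suc i))" if i: "i < Suc n" for i
    proof (cases "i = n")
      case True
      then show ?thesis by (intro exI[of _ triv]) (simp add: Ks_def nth_append len)
    next
      case False
      with i have "i < n" by simp
      from kids_Ns[OF this] obtain U where U: "idm U" "Ns ! i =b happ U (Var (n - Suc i))" by blast
      have "ren Suc (Ns ! i) =b happ U (Var (Suc (n - Suc i)))"
        using bconv_ren[OF U(2), of Suc] by (simp add: ren_happ)
      with U(1) \<open>i < n\<close> show ?thesis
        by (intro exI[of _ U]) (simp add: Ks_def nth_append len Suc_diff_Suc)
    qed
    then obtain U where U: "idm U" "hnf (Suc n) (x + Suc n) Ks =b happ U (Var x)"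
      using idm_build[of Ks x] unfolding lenK by blast
    have "s =b (Abs ^^ n) (Abs (App (ren Suc (apps (Var (x + n)) Ns)) (Var 0)))"
      using u(1) bconv_absn[OF *] by (rule equivclp_trans)
    also have "\<dots> = hnf (Suc n) (x + Suc n) Ks"
      by (simp add: hnf_def Ks_def ren_apps funpow_swap1)
    also note U(2)
    finally show ?thesis using U(1) by blast
  qed
qed

section \<open>Eta contraction of expanded variables\<close>

lemma peta_apps_Var: "peta (apps (Var y) Ms) s \<Longrightarrow> \<exists>Ns. s = apps (Var y) Ns \<and> list_all2 peta Ms Ns"
proof (induction Ms arbitrary: s rule: rev_induct)
  case Nil
  then show ?case by (auto elim: peta.cases)
next
  case (snoc M Ms)
  then have "peta (App (apps (Var y) Ms) M) s" by simp
  then obtain s1 t1 where "s = App s1 t1" "peta (apps (Var y) Ms) s1" "peta M t1"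
    by (cases rule: peta.cases) auto
  moreover from this snoc.IH obtain Ns where "s1 = apps (Var y) Ns" "list_all2 peta Ms Ns" by blast
  ultimately show ?case
    by (intro exI[of _ "Ns @ [t1]"]) (simp add: list_all2_appendI)
qed

lemma ren_eq_apps_Var:
  "ren r s = apps (Var y) Ms \<Longrightarrow> \<exists>z Ns. s = apps (Var z) Ns \<and> y = r z \<and> Ms = map (ren r) Ns"
proof (induction Ms arbitrary: s rule: rev_induct)
  case Nil
  then show ?case by (cases s) (auto intro!: exI[of _ "[]"])
next
  case (snoc M Ms)
  then obtain s1 t1 where s: "s = App s1 t1" "ren r s1 = apps (Var y) Ms" "ren r t1 = M"
    by (cases s) auto
  with snoc.IH[OF s(2)] show ?case by (auto intro!: exI[of _ "_ @ [t1]"])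
qed

text \<open>Among the leading abstractions only the innermost has an application as body and can be
  contracted; this removes one binder together with the last argument.\<close>

lemma peta_hnf:
  "peta ((Abs ^^ n) (apps (Var y) Ms)) s \<Longrightarrow>
    (\<exists>Ns. s = (Abs ^^ n) (apps (Var y) Ns) \<and> list_all2 peta Ms Ns) \<or>
    (\<exists>m z Ks Ns. n = Suc m \<and> y = Suc z \<and> Ms = map (ren Suc) Ks @ [Var 0] \<and>
      s = (Abs ^^ m) (apps (Var z) Ns) \<and> list_all2 peta Ks Ns)"
proof (induction n arbitrary: s)
  case 0
  then show ?case using peta_apps_Var by simp
next
  case (Suc n)
  then have "peta (Abs ((Abs ^^ n) (apps (Var y) Ms))) s" by simp
  then show ?case
  proof (cases rule: peta.cases)
    case (peta_Abs s')
    from Suc.IH[OF peta_Abs(2)] show ?thesis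
    proof (elim disjE exE conjE)
      fix m z Ks Ns
      assume "n = Suc m" "y = Suc z" "Ms = map (ren Suc) Ks @ [Var 0]"
        "s' = (Abs ^^ m) (apps (Var z) Ns)" "list_all2 peta Ks Ns"
      with peta_Abs show ?thesis
        by (intro disjI2 exI[of _ "Suc m"] exI[of _ z] exI[of _ Ks] exI[of _ Ns]) simp
    qed (use peta_Abs in auto)
  next
    case (peta_wrap v)
    then have n: "n = 0" by (cases n) auto
    with peta_wrap(1) obtain Ms1 where "Ms = Ms1 @ [Var 0]" "ren Suc v = apps (Var y) Ms1"
      by (cases Ms rule: rev_cases) auto
    moreover from this ren_eq_apps_Var obtain z Ks where
      "v = apps (Var z) Ks" "y = Suc z" "Ms1 = map (ren Suc) Ks" by blast
    moreover from this peta_wrap(2) peta_apps_Var obtain Ns where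
      "s = apps (Var z) Ns" "list_all2 peta Ks Ns" by blast
    ultimately show ?thesis
      using n by (intro disjI2 exI[of _ 0] exI[of _ z] exI[of _ Ks] exI[of _ Ns]) simp
  qed
qed

lemma peta_happ:
  "peta (happ T (Var x)) s \<Longrightarrow> idm T \<Longrightarrow> \<exists>U. idm U \<and> s =b happ U (Var x)"
proof (induction T arbitrary: s x rule: kid_induct)
  case (kids T)
  define n where "n = arity T"
  define Ms where "Ms = map (\<lambda>i. happ (kid T i) (Var (n - Suc i))) [0..<n]"
  have "happ T (Var x) = (Abs ^^ n) (apps (Var (x + n)) Ms)"
    using idm_perm[OF kids.prems(2)] by (subst happ_Var) (simp add: hnf_def n_def Ms_def)
  with kids.prems(1) have "peta ((Abs ^^ n) (apps (Var (x + n)) Ms)) s" by simp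
  from peta_hnf[OF this] show ?case
  proof (elim disjE exE conjE)
    fix Ns assume Ns: "s = (Abs ^^ n) (apps (Var (x + n)) Ns)" "list_all2 peta Ms Ns"
    have len: "length Ns = n"
      using Ns(2) by (simp add: list_all2_conv_all_nth Ms_def)
    have "\<exists>U. idm U \<and> Ns ! i =b happ U (Var (n - Suc i))" if "i < n" for i
    proof -
      have "peta (Ms ! i) (Ns ! i)" using Ns(2) len that by (simp add: list_all2_conv_all_nth)
      then show ?thesis
        using that kids.prems(2) by (intro kids.IH[of i]) (simp_all add: n_def Ms_def idm_kid)
    qed
    then show ?thesis
      using idm_build[of Ns x] unfolding len Ns(1) hnf_def by blast
  next
    fix m z Ks Ns
    assume *: "n = Suc m" "x + n = Suc z" "Ms = map (ren Suc) Ks @ [Var 0]"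
      "s = (Abs ^^ m) (apps (Var z) Ns)" "list_all2 peta Ks Ns"
    have len: "length Ks = m" "length Ns = m"
      using arg_cong[OF *(3), of length] *(1,5) by (simp_all add: Ms_def list_all2_conv_all_nth)
    have "\<exists>U. idm U \<and> Ns ! i =b happ U (Var (m - Suc i))" if i: "i < m" for i
    proof -
      \<comment> \<open>The remaining children are weakened copies; injectivity of the renaming
        strips off the lost binder.\<close>
      have "ren Suc (Ks ! i) = ren Suc (happ (kid T i) (Var (m - Suc i)))"
        using arg_cong[OF *(3), of "\<lambda>Ms. Ms ! i"] i *(1) len
        by (simp add: Ms_def nth_append ren_happ Suc_diff_Suc del: upt_Suc)
      then have "Ks ! i = happ (kid T i) (Var (m - Suc i))"
        by (rule ren_inj[rotated]) simp
      moreover have "peta (Ks ! i) (Ns ! i)"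
        using *(5) i len by (simp add: list_all2_conv_all_nth)
      ultimately show ?thesis
        using i *(1) kids.prems(2) by (intro kids.IH[of i]) (simp_all add: n_def idm_kid)
    qed
    moreover have "z = x + m" using * by simp
    ultimately show ?thesis
      using idm_build[of Ns x] unfolding len *(4) hnf_def by blast
  qed
qed

lemma bconv_happ_Var_betas:
  assumes "s =b happ T (Var x)"
  shows "beta\<^sup>*\<^sup>* s (happ T (Var x))"
proof -
  obtain u where u: "beta\<^sup>*\<^sup>* s u" "beta\<^sup>*\<^sup>* (happ T (Var x)) u"
    using assms by (rule church_rosser)
  from u(2) have "u = happ T (Var x)"
    by (cases rule: converse_rtranclpE) (simp_all add: happ_Var_normal)
  with u(1) show ?thesis by simp
qed

text \<open>The conversion path is followed from \<open>Var x\<close>. As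
  \<open>happ T (Var x)\<close> is beta normal, conversion to it is a reduction, and such reductions
  are transported across an eta step in either direction.\<close>

lemma econv_Var:
  assumes "s =e Var x"
  shows "\<exists>T. idm T \<and> s =b happ T (Var x)"
  using assms
proof (induction rule: converse_equivclp_induct)
  case base
  show ?case by (rule exI[of _ triv]) simp
next
  case (step s t)
  then obtain T where T: "idm T" "t =b happ T (Var x)" by blast
  then have t: "beta\<^sup>*\<^sup>* t (happ T (Var x))" by (simp add: bconv_happ_Var_betas)
  from step.hyps(1) consider "beta s t \<or> beta t s" | "eta s t" | "eta t s"
    by (auto simp: beta_eta_def)
  then show ?case
  proof cases
    case 1
    then have "s =b t" by blast
    with T show ?thesis using equivclp_trans by metis
  next
    case 2
    with betas_peta[OF t eta_peta] obtain v where "beta\<^sup>*\<^sup>* s v" "peta v (happ T (Var x))" by blast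
    with peta_happ_inv[OF _ T(1)] show ?thesis
      using rtranclp_into_equivclp equivclp_trans by metis
  next
    case 3
    with peta_betas[OF t eta_peta] obtain v where "beta\<^sup>*\<^sup>* s v" "peta (happ T (Var x)) v" by blast
    with peta_happ[OF _ T(1)] show ?thesis
      using rtranclp_into_equivclp equivclp_trans by metis
  qed
qed

section \<open>Head normalisation\<close>

inductive whr :: "tm \<Rightarrow> tm \<Rightarrow> bool" where
  whr_beta: "whr (App (Abs s) t) (psub (case_nat t Var) s)"
| whr_App: "whr s s' \<Longrightarrow> whr (App s t) (App s' t)"

text \<open>Termination of head reduction, run as weak head reduction that restarts below each
  abstraction it reaches.\<close>

inductive hn :: "tm \<Rightarrow> bool" where
  hn_Var: "hn (apps (Var y) Ms)"
| hn_Abs: "hn s \<Longrightarrow> hn (Abs s)"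
| hn_whr: "whr s t \<Longrightarrow> hn t \<Longrightarrow> hn s"

text \<open>Internal parallel reduction: a parallel step that leaves the weak head redex
  alone.\<close>

inductive ipar :: "tm \<Rightarrow> tm \<Rightarrow> bool" where
  ipar_Var: "ipar (Var i) (Var i)"
| ipar_App: "ipar s s' \<Longrightarrow> par t t' \<Longrightarrow> ipar (App s t) (App s' t')"
| ipar_Abs: "par s s' \<Longrightarrow> ipar (Abs s) (Abs s')"

lemma whr_psub: "whr s t \<Longrightarrow> whr (psub \<sigma> s) (psub \<sigma> t)"
proof (induction rule: whr.induct)
  case (whr_beta s t)
  then show ?case using whr.whr_beta by (simp add: psub_psub_cons)
qed (simp add: whr_App)

lemma whrs_psub: "whr\<^sup>*\<^sup>* s t \<Longrightarrow> whr\<^sup>*\<^sup>* (psub \<sigma> s) (psub \<sigma> t)"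
  by (rule rtranclp_cong1) (rule whr_psub)

lemma whrs_App: "whr\<^sup>*\<^sup>* s t \<Longrightarrow> whr\<^sup>*\<^sup>* (App s u) (App t u)"
  by (rule rtranclp_cong1) (rule whr_App)

lemma ipar_psub:
  assumes "ipar s t" "\<And>i. par (\<sigma> i) (\<tau> i)" "\<And>i. \<exists>u. whr\<^sup>*\<^sup>* (\<sigma> i) u \<and> ipar u (\<tau> i)"
  shows "\<exists>u. whr\<^sup>*\<^sup>* (psub \<sigma> s) u \<and> ipar u (psub \<tau> t)"
  using assms(1)
proof (induction rule: ipar.induct)
  case (ipar_Var i)
  then show ?case using assms(3) by simp
next
  case (ipar_App s s' t t')
  then obtain u where "whr\<^sup>*\<^sup>* (psub \<sigma> s) u" "ipar u (psub \<tau> s')" by blast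
  then show ?case
    using par_psub[OF ipar_App.hyps(2) assms(2)]
    by (auto intro!: exI[of _ "App u (psub \<sigma> t)"] whrs_App ipar.intros)
next
  case (ipar_Abs s s')
  have "par (up \<sigma> i) (up \<tau> i)" for i
    using assms(2) by (cases i) (auto intro: par_ren par_refl)
  then have "ipar (Abs (psub (up \<sigma>) s)) (Abs (psub (up \<tau>) s'))"
    by (intro ipar.intros par_psub ipar_Abs)
  then show ?case by auto
qed

text \<open>The weak head part of a parallel step can be done first; this factorisation is the core
  of standardisation.\<close>

lemma par_whrs_ipar: "par s t \<Longrightarrow> \<exists>u. whr\<^sup>*\<^sup>* s u \<and> ipar u t"
proof (induction rule: par.induct)
  case (par_App s s' t t')
  then obtain u where "whr\<^sup>*\<^sup>* s u" "ipar u s'" by blast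
  with par_App.hyps show ?case by (auto intro!: exI[of _ "App u t"] whrs_App ipar.intros)
next
  case (par_beta s s' t t')
  then obtain u where u: "whr\<^sup>*\<^sup>* s u" "ipar u s'" by blast
  have "\<exists>v. whr\<^sup>*\<^sup>* (case_nat t Var i) v \<and> ipar v (case_nat t' Var i)" for i
    using par_beta.IH(2) by (cases i) (auto intro: ipar.intros)
  moreover have "par (case_nat t Var i) (case_nat t' Var i)" for i
    using par_beta.hyps(2) by (cases i) (auto intro: par.intros)
  ultimately obtain v where
    "whr\<^sup>*\<^sup>* (psub (case_nat t Var) u) v" "ipar v (psub (case_nat t' Var) s')"
    using ipar_psub[OF u(2)] by blast
  then show ?case
    using whr_beta[of s t] whrs_psub[OF u(1)] by (meson converse_rtranclp_into_rtranclp rtranclp_trans)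
qed (auto intro: ipar.intros)

text \<open>An internal step creates no weak head redex, so the one contracted in \<open>t\<close>
  is already present in \<open>s\<close>.\<close>

lemma ipar_whr: "whr t t' \<Longrightarrow> ipar s t \<Longrightarrow> \<exists>s'. whr s s' \<and> par s' t'"
proof (induction arbitrary: s rule: whr.induct)
  case (whr_beta a b)
  from whr_beta obtain s1 b1 where s: "s = App s1 b1" "ipar s1 (Abs a)" "par b1 b"
    by (cases rule: ipar.cases) auto
  from s(2) obtain a1 where "s1 = Abs a1" "par a1 a"
    by (cases rule: ipar.cases) auto
  with s show ?case using whr.whr_beta par_psub_cons by blast
next
  case (whr_App t t' b)
  from whr_App.prems obtain s1 b1 where s: "s = App s1 b1" "ipar s1 t" "par b1 b"
    by (cases rule: ipar.cases) auto
  with whr_App.IH obtain s' where "whr s1 s'" "par s' t'" by blast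
  with s show ?case using whr.whr_App par_App by blast
qed

lemma ipar_apps_Var: "ipar s (apps (Var y) Ms) \<Longrightarrow> \<exists>Ns. s = apps (Var y) Ns"
proof (induction Ms arbitrary: s rule: rev_induct)
  case Nil
  then have "ipar s (Var y)" by simp
  then have "s = apps (Var y) []" by (cases rule: ipar.cases) simp
  then show ?case by blast
next
  case (snoc M Ms)
  then have "ipar s (App (apps (Var y) Ms) M)" by simp
  then obtain s1 t1 where "s = App s1 t1" "ipar s1 (apps (Var y) Ms)"
    by (cases rule: ipar.cases) auto
  moreover from this snoc.IH obtain Ns where "s1 = apps (Var y) Ns" by blast
  ultimately show ?case by (intro exI[of _ "Ns @ [t1]"]) simp
qed

lemma hn_whrs: "whr\<^sup>*\<^sup>* s t \<Longrightarrow> hn t \<Longrightarrow> hn s"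
  by (induction rule: converse_rtranclp_induct) (auto intro: hn_whr)

lemma hn_par: "hn t \<Longrightarrow> par s t \<Longrightarrow> hn s"
proof (induction arbitrary: s rule: hn.induct)
  case (hn_Var y Ms)
  then obtain u where "whr\<^sup>*\<^sup>* s u" "ipar u (apps (Var y) Ms)" using par_whrs_ipar by blast
  then show ?case using ipar_apps_Var hn.hn_Var hn_whrs by blast
next
  case (hn_Abs t)
  then obtain u where u: "whr\<^sup>*\<^sup>* s u" "ipar u (Abs t)" using par_whrs_ipar by blast
  from u(2) obtain v where "u = Abs v" "par v t" by (cases rule: ipar.cases) auto
  with u(1) hn_Abs.IH show ?case using hn.hn_Abs hn_whrs by blast
next
  case (hn_whr t t')
  then obtain u where u: "whr\<^sup>*\<^sup>* s u" "ipar u t" using par_whrs_ipar by blast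
  with ipar_whr[OF hn_whr.hyps(1)] obtain u' where "whr u u'" "par u' t'" by blast
  with u(1) hn_whr.IH show ?case using hn.hn_whr hn_whrs by blast
qed

lemma hn_betas: "beta\<^sup>*\<^sup>* s t \<Longrightarrow> hn t \<Longrightarrow> hn s"
  by (induction rule: converse_rtranclp_induct) (auto intro: hn_par beta_par)

lemma hn_hnf: "hn (hnf n y Ms)"
  unfolding hnf_def by (induction n) (auto intro: hn.intros)

lemma bconv_hnf_hn:
  assumes "s =b hnf n y Ms"
  shows "hn s"
proof -
  obtain u where u: "beta\<^sup>*\<^sup>* s u" "beta\<^sup>*\<^sup>* (hnf n y Ms) u"
    using assms by (rule church_rosser)
  with betas_hnf hn_hnf hn_betas show ?thesis by blast
qed

lemma whr_bconv: "whr s t \<Longrightarrow> s =b t"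
  by (induction rule: whr.induct) (auto intro: bconv_redex bconv_App)

lemma hn_bconv_hnf: "hn s \<Longrightarrow> \<exists>n y Ms. s =b hnf n y Ms"
proof (induction rule: hn.induct)
  case (hn_Var y Ms)
  show ?case by (intro exI[of _ 0] exI[of _ y] exI[of _ Ms]) (simp add: hnf_def)
next
  case (hn_Abs s)
  then obtain n y Ms where "s =b hnf n y Ms" by blast
  then have "Abs s =b hnf (Suc n) y Ms" using bconv_Abs by (simp add: hnf_def)
  then show ?case by blast
next
  case (hn_whr s t)
  then obtain n y Ms where "t =b hnf n y Ms" by blast
  with whr_bconv[OF hn_whr.hyps(1)] have "s =b hnf n y Ms" by (rule equivclp_trans)
  then show ?case by blast
qed

lemma whr_trichotomy: "(\<exists>y Ms. s = apps (Var y) Ms) \<or> (\<exists>t. s = Abs t) \<or> (\<exists>t. whr s t)"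
proof (induction s)
  case (Var y)
  have "Var y = apps (Var y) []" by simp
  then show ?case by blast
next
  case (App s t)
  from App.IH(1) show ?case
  proof (elim disjE exE)
    fix y Ms assume "s = apps (Var y) Ms"
    then have "App s t = apps (Var y) (Ms @ [t])" by simp
    then show ?thesis by blast
  qed (auto intro: whr.intros)
qed auto

lemma Abs_no_whr: "\<not> whr (Abs s) t"
  by (auto elim: whr.cases)

lemma whr_deterministic: "whr s t \<Longrightarrow> whr s u \<Longrightarrow> t = u"
proof (induction arbitrary: u rule: whr.induct)
  case (whr_beta s t)
  then show ?case by (cases rule: whr.cases) (simp_all add: Abs_no_whr)
next
  case (whr_App s s' t)
  from whr_App.prems show ?case
  proof (cases rule: whr.cases)
    case whr_beta
    with whr_App.hyps show ?thesis by (simp add: Abs_no_whr)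
  next
    case (whr_App s1)
    with whr_App.IH show ?thesis by simp
  qed
qed

lemma apps_Var_no_whr: "\<not> whr (apps (Var y) Ms) t"
proof (induction Ms arbitrary: t rule: rev_induct)
  case Nil
  then show ?case by (auto elim: whr.cases)
next
  case (snoc M Ms)
  show ?case
  proof
    assume "whr (apps (Var y) (Ms @ [M])) t"
    then have "whr (App (apps (Var y) Ms) M) t" by simp
    then show False
      by (cases rule: whr.cases) (use snoc apps_Var_not_Abs in metis)+
  qed
qed

text \<open>Induction on the head reduction of the instance. A weak head step of \<open>s\<close> is
  also one of the instance, and by determinism the only one possible there; a term without such a
  step is neutral or an abstraction.\<close>

lemma hn_psub: "hn (psub \<sigma> s) \<Longrightarrow> hn s"
proof (induction "psub \<sigma> s" arbitrary: \<sigma> s rule: hn.induct)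
  case (hn_Var y Ms)
  consider (neutral) "\<exists>y Ms. s = apps (Var y) Ms" | (Abs) t where "s = Abs t" | (whr) t where "whr s t"
    using whr_trichotomy by blast
  then show ?case
  proof cases
    case neutral
    then show ?thesis using hn.hn_Var by blast
  next
    case Abs
    then show ?thesis using hn_Var apps_Var_not_Abs by (metis psub.simps(3))
  next
    case whr
    then show ?thesis using hn_Var apps_Var_no_whr whr_psub by metis
  qed
next
  case (hn_Abs u)
  consider (neutral) "\<exists>y Ms. s = apps (Var y) Ms" | (Abs) t where "s = Abs t" | (whr) t where "whr s t"
    using whr_trichotomy by blast
  then show ?case
  proof cases
    case neutral
    then show ?thesis using hn.hn_Var by blast
  next
    case (Abs t)
    with hn_Abs.hyps(3) have "u = psub (up \<sigma>) t" by simp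
    with hn_Abs.hyps(2) Abs show ?thesis using hn.hn_Abs by blast
  next
    case (whr t)
    then have "whr (Abs u) (psub \<sigma> t)" using hn_Abs.hyps(3) whr_psub by metis
    then show ?thesis by (simp add: Abs_no_whr)
  qed
next
  case (hn_whr u)
  consider (neutral) "\<exists>y Ms. s = apps (Var y) Ms" | (Abs) t where "s = Abs t" | (whr) t where "whr s t"
    using whr_trichotomy by blast
  then show ?case
  proof cases
    case neutral
    then show ?thesis using hn.hn_Var by blast
  next
    case (Abs t)
    then show ?thesis using hn_whr.hyps(1) by (simp add: Abs_no_whr)
  next
    case (whr t)
    then have "u = psub \<sigma> t" using hn_whr.hyps(1) whr_psub whr_deterministic by metis
    with whr hn_whr.hyps(3) show ?thesis using hn.hn_whr by blast
  qed
qed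

section \<open>Finite hereditary permutations as Boehm trees\<close>

text \<open>\<open>BT\<close> works with a chosen head normal form, whose arguments match given ones
  only up to beta; hence the intermediate list \<open>Ns\<close>.\<close>

lemma BT_hnf:
  assumes "M =b hnf n y Ms"
  shows "\<exists>Ns. list_all2 bconv Ms Ns \<and> BT M = Hnf n y (map BT Ns)"
proof -
  define h where "h = (SOME (n, y, Ms). (M, hnf n y Ms) \<in> beta_conv)"
  have "\<exists>h. case h of (n, y, Ms) \<Rightarrow> (M, hnf n y Ms) \<in> beta_conv"
    using assms by (auto simp: beta_conv_iff)
  then have "case h of (n, y, Ms) \<Rightarrow> (M, hnf n y Ms) \<in> beta_conv"
    unfolding h_def by (rule someI_ex)
  then obtain n' y' Ns where h: "h = (n', y', Ns)" "M =b hnf n' y' Ns"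
    by (auto simp: beta_conv_iff)
  have "hnf n y Ms =b hnf n' y' Ns"
    using assms h(2) equivclp_sym equivclp_trans by metis
  then have *: "n' = n" "y' = y" "list_all2 bconv Ms Ns"
    using hnf_unique by blast+
  have "some_hnf M = Some h"
    using assms unfolding some_hnf_def h_def by (auto simp: beta_conv_iff)
  then have "BT M = Hnf n y (map BT Ns)"
    by (subst BT.code) (simp add: h(1) *)
  with * show ?thesis by blast
qed

lemma BT_Hnf:
  assumes "BT M = Hnf n y Ts"
  shows "\<exists>Ms. M =b hnf n y Ms \<and> Ts = map BT Ms"
proof -
  have "\<exists>n y Ms. (M, hnf n y Ms) \<in> beta_conv"
  proof (rule ccontr)
    assume "\<nexists>n y Ms. (M, hnf n y Ms) \<in> beta_conv"
    then have "BT M = Bot" by (subst BT.code) (simp add: some_hnf_def)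
    with assms show False by simp
  qed
  then obtain n' y' Ms' where *: "M =b hnf n' y' Ms'" by (auto simp: beta_conv_iff)
  with assms obtain Ns where Ns: "list_all2 bconv Ms' Ns" "n' = n" "y' = y" "Ts = map BT Ns"
    using BT_hnf[OF *] by auto
  then have "hnf n' y' Ms' =b hnf n y Ns"
    unfolding hnf_def by (simp add: bconv_absn bconv_apps)
  with * have "M =b hnf n y Ns" by (rule equivclp_trans)
  with Ns(4) show ?thesis by blast
qed

lemma wfh_build:
  assumes "p permutes {..<n}" "\<And>i. i < n \<Longrightarrow> wfh (f i)"
  shows "\<exists>T. wfh T \<and> perm T = p \<and> arity T = n \<and> (\<forall>i<n. kid T i = f i)"
proof (intro exI conjI)
  define T where "T = Perm p (map f [0..<n])"
  show T: "perm T = p" "arity T = n" "\<forall>i<n. kid T i = f i"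
    by (simp_all add: T_def kid_def)
  show "wfh T" by (rule wfh.intros) (simp_all add: T assms)
qed

lemma nodes_Hnf: "{p. node (Hnf n y Ts) p} = insert [] (\<Union>i<length Ts. (#) i ` {p. node (Ts ! i) p})"
proof -
  have "p = [] \<or> (\<exists>i<length Ts. p \<in> (#) i ` {p. node (Ts ! i) p})" if "node (Hnf n y Ts) p" for p
    using that by (cases rule: node.cases) auto
  then show ?thesis by (auto intro: node.intros)
qed

lemma finite_tree_Hnf: "finite_tree (Hnf n y Ts) \<longleftrightarrow> (\<forall>T\<in>set Ts. finite_tree T)"
proof -
  have "finite ((#) i ` A) \<longleftrightarrow> finite A" for i :: nat and A
    by (rule finite_image_iff) simp
  then show ?thesis
    by (simp add: finite_tree_def nodes_Hnf all_set_conv_all_nth) (simp add: Ball_def)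
qed

text \<open>Boehm trees form a codatatype without structural induction; for finite trees the number
  of nodes takes its place.\<close>

lemma card_nodes_less:
  assumes "finite_tree (Hnf n y Ts)" "i < length Ts"
  shows "card {p. node (Ts ! i) p} < card {p. node (Hnf n y Ts) p}"
proof -
  have "(#) i ` {p. node (Ts ! i) p} \<subset> {p. node (Hnf n y Ts) p}"
    using assms(2) unfolding nodes_Hnf by auto
  then have "card ((#) i ` {p. node (Ts ! i) p}) < card {p. node (Hnf n y Ts) p}"
    using assms(1) by (intro psubset_card_mono) (auto simp: finite_tree_def)
  then show ?thesis by (simp add: card_image)
qed

lemma HP_var_Hnf:
  assumes "HP_var j T"
  shows "\<exists>n p Ts. T = Hnf n (j + n) Ts \<and> length Ts = n \<and> p permutes {..<n} \<and>
    (\<forall>i<n. HP_var (n - Suc (p i)) (Ts ! i))"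
  using assms by (cases rule: HP_var.cases) auto

lemma hnf_happ:
  assumes "length Ms = n" "p permutes {..<n}"
    and "\<And>i. i < n \<Longrightarrow> \<exists>T. wfh T \<and> Ms ! i =b happ T (Var (n - Suc (p i)))"
  shows "\<exists>T. wfh T \<and> (\<forall>j. hnf n (j + n) Ms =b happ T (Var j))"
proof -
  obtain f where f: "wfh (f i)" "Ms ! i =b happ (f i) (Var (n - Suc (p i)))" if "i < n" for i
    using assms(3) by metis
  obtain T where T: "wfh T" "perm T = p" "arity T = n" "\<forall>i<n. kid T i = f i"
    using wfh_build[of p n f] assms(2) f(1) by auto
  have "hnf n (j + n) Ms =b happ T (Var j)" for j
    unfolding happ_Var[of T] T(3) hnf_def using assms(1)
    by (intro bconv_absn bconv_apps equivclp_refl) (simp add: list_all2_conv_all_nth T f)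
  with T(1) show ?thesis by blast
qed

lemma HP_var_BT:
  assumes "HP_var j (BT M)" "finite_tree (BT M)"
  shows "\<exists>T. wfh T \<and> M =b happ T (Var j)"
  using assms
proof (induction "card {p. node (BT M) p}" arbitrary: M j rule: less_induct)
  case less
  obtain n p Ts where T: "BT M = Hnf n (j + n) Ts" "length Ts = n" "p permutes {..<n}"
    "\<forall>i<n. HP_var (n - Suc (p i)) (Ts ! i)"
    using HP_var_Hnf[OF less.prems(1)] by blast
  obtain Ms where Ms: "M =b hnf n (j + n) Ms" "Ts = map BT Ms"
    using BT_Hnf[OF T(1)] by blast
  have "\<exists>T. wfh T \<and> Ms ! i =b happ T (Var (n - Suc (p i)))" if "i < n" for i
  proof (rule less.hyps)
    have fin: "finite_tree (Hnf n (j + n) Ts)" using less.prems(2) T(1) by simp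
    have i: "Ts ! i = BT (Ms ! i)" "i < length Ts" using that T(2) Ms(2) by auto
    show "card {p. node (BT (Ms ! i)) p} < card {p. node (BT M) p}"
      using card_nodes_less[OF fin i(2)] i T(1) by simp
    show "HP_var (n - Suc (p i)) (BT (Ms ! i))" using T(4)[rule_format, OF that] unfolding i(1) .
    show "finite_tree (BT (Ms ! i))" using fin i unfolding finite_tree_Hnf by (metis nth_mem)
  qed
  then obtain T where "wfh T" "hnf n (j + n) Ms =b happ T (Var j)"
    using hnf_happ[of Ms n p] T(2,3) Ms(2) by auto
  with Ms(1) show ?case using equivclp_trans by metis
qed

lemma bconv_happ_BT:
  assumes "wfh T" "M =b happ T (Var j)"
  shows "HP_var j (BT M) \<and> finite_tree (BT M)"
  using assms
proof (induction T arbitrary: M j rule: kid_induct)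
  case (kids T)
  let ?f = "\<lambda>i. happ (kid T i) (Var (arity T - Suc (perm T i)))"
  from kids.prems(2) obtain Ns where Ns: "list_all2 bconv (map ?f [0..<arity T]) Ns"
    "BT M = Hnf (arity T) (j + arity T) (map BT Ns)"
    unfolding happ_Var[of T] using BT_hnf by blast
  have len: "length Ns = arity T" using Ns(1) by (simp add: list_all2_conv_all_nth)
  have *: "HP_var (arity T - Suc (perm T i)) (BT (Ns ! i)) \<and> finite_tree (BT (Ns ! i))" if "i < arity T" for i
  proof (rule kids.IH[OF that wfh_kid[OF kids.prems(1)]])
    show "Ns ! i =b ?f i"
      using list_all2_nthD[OF Ns(1), of i] that by (simp add: equivclp_sym)
  qed
  have "HP_var j (BT M)"
    unfolding Ns(2) by (rule HP_var.intros[OF _ wfh_perm[OF kids.prems(1)]]) (use * len in auto)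
  moreover have "finite_tree (BT M)"
    unfolding Ns(2) finite_tree_Hnf using * len by (auto simp: in_set_conv_nth)
  ultimately show ?case ..
qed

lemma Abs_hnf: "Abs (hnf n y Ms) = hnf (Suc n) y Ms"
  by (simp add: hnf_def)

text \<open>Ties the definition through the coinductive \<open>HP_var\<close> to the inductive
  trees. The outermost binder stands for the root variable; it is split off, and the rest is treated
  with root index 0.\<close>

lemma FHP_iff: "M \<in> FHP \<longleftrightarrow> (\<exists>T. wfh T \<and> M =b to_tm T)"
proof
  assume "M \<in> FHP"
  then obtain T where T: "HP_var 0 T" "BT M = abs_tree T" "finite_tree (BT M)"
    by (auto simp: FHP_def HP_def)
  obtain n p Ts where Ts: "T = Hnf n (0 + n) Ts" "length Ts = n" "p permutes {..<n}"
    "\<forall>i<n. HP_var (n - Suc (p i)) (Ts ! i)"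
    using HP_var_Hnf[OF T(1)] by blast
  then have BT: "BT M = Hnf (Suc n) n Ts" using T(2) by simp
  then obtain Ms where Ms: "M =b hnf (Suc n) n Ms" "Ts = map BT Ms"
    using BT_Hnf by blast
  have "\<exists>T. wfh T \<and> Ms ! i =b happ T (Var (n - Suc (p i)))" if "i < n" for i
    using that Ts Ms(2) T(3) unfolding BT finite_tree_Hnf by (intro HP_var_BT) auto
  then obtain U where U: "wfh U" "\<forall>j. hnf n (j + n) Ms =b happ U (Var j)"
    using hnf_happ[of Ms n p] Ts(2,3) Ms(2) by auto
  have "hnf n n Ms =b happ U (Var 0)" using U(2)[rule_format, of 0] by simp
  from Ms(1) bconv_Abs[OF this] have "M =b to_tm U"
    unfolding to_tm_def Abs_hnf by (auto intro: equivclp_trans)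
  with U(1) show "\<exists>T. wfh T \<and> M =b to_tm T" by blast
next
  assume "\<exists>T. wfh T \<and> M =b to_tm T"
  then obtain T where T: "wfh T" "M =b to_tm T" by blast
  let ?f = "\<lambda>i. happ (kid T i) (Var (arity T - Suc (perm T i)))"
  have "to_tm T = hnf (Suc (arity T)) (arity T) (map ?f [0..<arity T])"
    unfolding to_tm_def happ_Var[of T] Abs_hnf by simp
  then have "M =b hnf (Suc (arity T)) (arity T) (map ?f [0..<arity T])"
    using T(2) by (simp only:)
  from BT_hnf[OF this] obtain Ns where Ns: "list_all2 bconv (map ?f [0..<arity T]) Ns"
    "BT M = Hnf (Suc (arity T)) (arity T) (map BT Ns)"
    by blast
  have len: "length Ns = arity T" using Ns(1) by (simp add: list_all2_conv_all_nth)
  have *: "HP_var (arity T - Suc (perm T i)) (BT (Ns ! i)) \<and> finite_tree (BT (Ns ! i))" if "i < arity T" for i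
  proof (rule bconv_happ_BT[OF wfh_kid[OF T(1)]])
    show "Ns ! i =b ?f i"
      using list_all2_nthD[OF Ns(1), of i] that by (simp add: equivclp_sym)
  qed
  have "HP_var 0 (Hnf (arity T) (0 + arity T) (map BT Ns))"
    by (rule HP_var.intros[OF _ wfh_perm[OF T(1)]]) (use * len in auto)
  then have "BT M \<in> HP"
    unfolding HP_def Ns(2) by (auto intro!: exI[of _ "Hnf (arity T) (arity T) (map BT Ns)"])
  moreover have "finite_tree (BT M)"
    unfolding Ns(2) finite_tree_Hnf using * len by (auto simp: in_set_conv_nth)
  ultimately show "M \<in> FHP" by (simp add: FHP_def)
qed

section \<open>Mutually inverse substitutions\<close>

lemma absn_bconv_hnf_le:
  assumes "(Abs ^^ a) X =b hnf k y Ms"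
  shows "a \<le> k"
proof -
  obtain u where u: "beta\<^sup>*\<^sup>* ((Abs ^^ a) X) u" "beta\<^sup>*\<^sup>* (hnf k y Ms) u"
    using assms by (rule church_rosser)
  have "\<exists>X'. u = (Abs ^^ a) X'"
    using u(1) by (induction rule: rtranclp_induct) (auto dest: beta_absn)
  moreover obtain Ns where "u = hnf k y Ns" using betas_hnf[OF u(2)] by blast
  ultimately obtain X' where "(Abs ^^ a) X' = (Abs ^^ k) (apps (Var y) Ns)"
    by (auto simp: hnf_def)
  then show ?thesis
  proof (induction a arbitrary: k)
    case (Suc a)
    show ?case
    proof (cases k)
      case 0
      then show ?thesis using Suc.prems apps_Var_not_Abs[of y Ns] by (metis comp_apply funpow.simps(1,2) id_apply)
    next
      case (Suc k')
      then show ?thesis using Suc.IH[of k'] Suc.prems by simp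
    qed
  qed simp
qed

lemma apps_absn_bconv_Var_le:
  assumes "apps ((Abs ^^ a) X) As =b apps (Var y) Ms"
  shows "a \<le> length As"
proof (rule ccontr)
  assume "\<not> a \<le> length As"
  then obtain Y where "apps ((Abs ^^ a) X) As =b (Abs ^^ (a - length As)) Y"
    using apps_absn_partial[of As a X] by auto
  then have "(Abs ^^ (a - length As)) Y =b hnf 0 y Ms"
    using assms unfolding hnf_def by (auto intro: equivclp_trans equivclp_sym)
  with \<open>\<not> a \<le> length As\<close> absn_bconv_hnf_le show False by fastforce
qed

text \<open>An eta-expansion to \<open>k\<close> binders, seen from below them: the last
  \<open>k - a\<close> variables become additional arguments, and a head counted below
  \<open>a\<close> binders is recounted below \<open>k\<close>.\<close>

lemma apps_hnf_vars:
  assumes "s =b hnf a y Ms" "a \<le> k"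
  shows "\<exists>As. length As = length Ms + (k - a) \<and>
    apps (shift k s) (vars k) =b apps (Var (y + (k - a))) As"
proof -
  let ?r = "(upr ^^ a) (\<lambda>i. i + k)"
  define Ks where "Ks = map (psub (env (take a (vars k)))) (map (ren ?r) Ms)"
  have y: "env (take a (vars k)) (?r y) = Var (y + (k - a))"
    using assms(2) by (auto simp: env_def uprn)
  have "apps (shift k s) (vars k) =b apps (shift k (hnf a y Ms)) (vars k)"
    by (intro bconv_apps_head bconv_ren assms)
  also have "\<dots> = apps (apps ((Abs ^^ a) (apps (Var (?r y)) (map (ren ?r) Ms))) (take a (vars k))) (drop a (vars k))"
    by (simp add: hnf_def ren_absn ren_apps flip: foldl_append)
  also have "\<dots> =b apps (psub (env (take a (vars k))) (apps (Var (?r y)) (map (ren ?r) Ms))) (drop a (vars k))"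
    using assms(2) by (intro bconv_apps_head apps_absn) simp
  also have "\<dots> = apps (Var (y + (k - a))) (Ks @ drop a (vars k))"
    using y by (simp add: psub_apps Ks_def)
  finally show ?thesis
    by (intro exI[of _ "Ks @ drop a (vars k)"]) (simp add: Ks_def)
qed

lemma apps_shift_vars_psub:
  "apps (shift k (psub \<sigma> s)) (vars k) = psub ((up ^^ k) \<sigma>) (apps (shift k s) (vars k))"
proof -
  have "map (psub ((up ^^ k) \<sigma>)) (vars k) = vars k"
    by (simp add: vars_def upn)
  moreover have "psub ((up ^^ k) \<sigma>) (shift k s) = shift k (psub \<sigma> s)"
    by (simp add: psub_ren ren_psub upn)
  ultimately show ?thesis by (simp add: psub_apps)
qed

text \<open>
  \<open>inst As k\<close> replaces the \<open>length As\<close> innermost variables, which \<open>vars\<close> lists, by \<open>As\<close>, and moves the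
  remaining ones below \<open>k\<close> new ones.
\<close>

definition inst :: "tm list \<Rightarrow> nat \<Rightarrow> nat \<Rightarrow> tm" where
  "inst As k v = (if v < length As then As ! (length As - Suc v) else Var (v - length As + k))"

lemma psub_inst_apps_vars: "psub (inst As k) (apps (shift (length As) s) (vars (length As))) = apps (shift k s) As"
proof -
  have "map (psub (inst As k)) (vars (length As)) = As"
  proof (rule nth_equalityI)
    fix i assume "i < length (map (psub (inst As k)) (vars (length As)))"
    then have "i < length As" "length As - Suc i < length As" by auto
    then show "map (psub (inst As k)) (vars (length As)) ! i = As ! i"
      by (simp add: inst_def)
  qed simp
  moreover have "psub (inst As k) (shift (length As) s) = shift k s"
    unfolding psub_ren by (simp add: inst_def ren_conv_psub)
  ultimately show ?thesis by (simp add: psub_apps)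
qed

lemma apps_happ_vars:
  assumes "idm T" "arity T \<le> k"
  shows "apps (shift k (happ T (Var j))) (vars k) =b
    apps (Var (j + k)) (map (\<lambda>q. happ (kid T q) (Var (k - Suc q))) [0..<k])"
proof -
  have eq: "map (\<lambda>q. happ (kid T q) (vars k ! perm T q)) [0..<k] =
    map (\<lambda>q. happ (kid T q) (Var (k - Suc q))) [0..<k]"
    using assms(1) by (simp add: idm_perm)
  have "apps (happ T (Var (j + k))) (vars k) =b
    apps (Var (j + k)) (map (\<lambda>q. happ (kid T q) (vars k ! perm T q)) [0..<k])"
    using assms by (intro happ_apps idm_wfh) simp_all
  then show ?thesis by (simp only: eq ren_happ ren.simps)
qed

text \<open>A head bound by the leading block would survive the substitution and contradict the free
  head of \<open>happ T (Var i)\<close>. The leading abstractions of \<open>s\<close> survive in any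
  case.\<close>

lemma psub_bconv_happ_hnf:
  assumes "psub \<tau> s =b happ T (Var i)" "s =b hnf a y Ms"
  shows "a \<le> y \<and> a \<le> arity T"
proof -
  let ?Ns = "map (psub ((up ^^ a) \<tau>)) Ms"
  have "psub \<tau> (hnf a y Ms) =b happ T (Var i)"
    using assms bconv_psub by (meson equivclp_sym equivclp_trans)
  then have *: "(Abs ^^ a) (apps ((up ^^ a) \<tau> y) ?Ns) =b happ T (Var i)"
    by (simp add: hnf_def psub_absn psub_apps)
  moreover have "a \<le> y"
  proof (rule ccontr)
    assume "\<not> a \<le> y"
    with * have "hnf a y ?Ns =b happ T (Var i)"
      by (simp add: hnf_def upn)
    then have "a = arity T" "y = i + arity T"
      unfolding happ_Var[of T] using hnf_unique by blast+
    with \<open>\<not> a \<le> y\<close> show False by simp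
  qed
  ultimately show ?thesis
    unfolding happ_Var[of T] using absn_bconv_hnf_le by blast
qed

definition headvar :: "tm \<Rightarrow> nat \<Rightarrow> bool" where
  "headvar s j \<longleftrightarrow> (\<exists>a Ms. s =b hnf a (j + a) Ms)"

lemma headvar_unique: "headvar s i \<Longrightarrow> headvar s j \<Longrightarrow> i = j"
proof -
  assume "headvar s i" "headvar s j"
  then obtain a Ms b Ns where "s =b hnf a (i + a) Ms" "s =b hnf b (j + b) Ns"
    unfolding headvar_def by blast
  then have "hnf a (i + a) Ms =b hnf b (j + b) Ns"
    by (meson equivclp_sym equivclp_trans)
  from hnf_unique[OF this] show "i = j" by simp
qed

lemma headvar_Var: "headvar (Var x) x"
  unfolding headvar_def by (intro exI[of _ 0] exI[of _ "[]"]) (simp add: hnf_def)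

lemma headvar_exists:
  assumes "psub \<tau> s =e Var i"
  shows "\<exists>a j Ms. s =b hnf a (j + a) Ms"
proof -
  obtain T where T: "psub \<tau> s =b happ T (Var i)" using econv_Var[OF assms] by blast
  then have "hn (psub \<tau> s)" unfolding happ_Var[of T] by (rule bconv_hnf_hn)
  then obtain a y Ms where *: "s =b hnf a y Ms" using hn_bconv_hnf hn_psub by blast
  with psub_bconv_happ_hnf[OF T] have "a \<le> y" by blast
  with * show ?thesis by (metis le_add_diff_inverse2)
qed

text \<open>
  The arguments below matching heads form again a pair of mutually inverse substitutions, \<open>inst B p\<close>
  and \<open>inst A' K\<close>. The first composition is tracked up to beta conversion only, because the passage
  from \<open>T\<close> to its children is what makes the induction in \<open>inverse_subst\<close> terminate.
\<close>

lemma inverse_subst_step: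
  assumes inv1: "\<And>i. psub \<tau> (\<sigma> i) =e Var i" and inv2: "\<And>i. psub \<sigma> (\<tau> i) =e Var i"
    and T: "idm T" "psub \<tau> (\<sigma> i) =b happ T (Var i)" and K: "K = arity T"
  obtains j A B p A' where "headvar (\<sigma> i) j" "headvar (\<tau> j) i"
    "length A = p" "length B = K" "A' = map (psub ((up ^^ K) \<tau>)) A"
    "apps (shift K (\<sigma> i)) (vars K) =b apps (Var (j + K)) A"
    "apps (shift p (\<tau> j)) (vars p) =b apps (Var (i + p)) B"
    "\<And>q. q < K \<Longrightarrow> psub (inst A' K) (B ! q) =b happ (kid T q) (Var (K - Suc q))"
    "\<And>q. q < p \<Longrightarrow> psub (inst B p) (A' ! q) =e Var (p - Suc q)"
proof -
  obtain a j As where a: "\<sigma> i =b hnf a (j + a) As" using headvar_exists[OF inv1] by blast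
  obtain c h Bs where c: "\<tau> j =b hnf c (h + c) Bs" using headvar_exists[OF inv2] by blast
  \<comment> \<open>Expanding \<open>\<sigma> i\<close> to \<open>K\<close> binders, as many as the
    composite has, exposes its arguments \<open>A\<close>.\<close>
  have "a \<le> K" using psub_bconv_happ_hnf[OF T(2) a] K by blast
  then obtain A where A: "apps (shift K (\<sigma> i)) (vars K) =b apps (Var (j + K)) A"
    using apps_hnf_vars[OF a, of K] by auto
  define A' where "A' = map (psub ((up ^^ K) \<tau>)) A"
  define p where "p = length A"
  have len': "length A' = p" by (simp add: A'_def p_def)
  define Rs where "Rs = map (\<lambda>q. happ (kid T q) (Var (K - Suc q))) [0..<K]"
  have "apps (shift K (psub \<tau> (\<sigma> i))) (vars K) =b apps (Var (i + K)) Rs"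
    unfolding Rs_def
    by (rule equivclp_trans[OF bconv_apps_head[OF bconv_ren[OF T(2)]] apps_happ_vars[OF T(1)]]) (simp add: K)
  moreover have "apps (shift K (psub \<tau> (\<sigma> i))) (vars K) =b psub ((up ^^ K) \<tau>) (apps (Var (j + K)) A)"
    unfolding apps_shift_vars_psub by (intro bconv_psub A)
  moreover have "psub ((up ^^ K) \<tau>) (apps (Var (j + K)) A) = apps (shift K (\<tau> j)) A'"
    by (simp add: psub_apps upn A'_def)
  ultimately have E1: "apps (shift K (\<tau> j)) A' =b apps (Var (i + K)) Rs"
    by (metis equivclp_sym equivclp_trans)
  have "apps (shift K (hnf c (h + c) Bs)) A' =b apps (Var (i + K)) Rs"
    using equivclp_trans[OF bconv_apps_head[OF bconv_ren[OF equivclp_sym[OF c]]] E1] .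
  \<comment> \<open>Applied to \<open>p\<close> arguments, \<open>\<tau> j\<close> becomes neutral,
    so it cannot begin with more than \<open>p\<close> abstractions.\<close>
  then have "c \<le> p"
    unfolding hnf_def ren_absn using apps_absn_bconv_Var_le len' by blast
  then obtain B where B: "apps (shift p (\<tau> j)) (vars p) =b apps (Var (h + p)) B"
    using apps_hnf_vars[OF c, of p] by auto
  have "apps (shift K (\<tau> j)) A' =b psub (inst A' K) (apps (Var (h + p)) B)"
    using bconv_psub[OF B, of "inst A' K"] psub_inst_apps_vars[of A' K "\<tau> j"] len' by simp
  then have "apps (Var (h + K)) (map (psub (inst A' K)) B) =b apps (Var (i + K)) Rs"
    using E1 len' by (simp add: psub_apps inst_def) (meson equivclp_sym equivclp_trans)
  from apps_Var_unique[OF this] have h: "h = i" and BR: "list_all2 bconv (map (psub (inst A' K)) B) Rs"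
    by auto
  have lenB: "length B = K" using BR by (simp add: list_all2_conv_all_nth Rs_def)
  have c1: "psub (inst A' K) (B ! q) =b happ (kid T q) (Var (K - Suc q))" if "q < K" for q
    using list_all2_nthD[OF BR, of q] that lenB by (simp add: Rs_def)
  have c2: "psub (inst B p) (A' ! q) =e Var (p - Suc q)" if q: "q < p" for q
  proof -
    \<comment> \<open>The composition in the other order, evaluated at \<open>j\<close>, describes
      the arguments \<open>A\<close> after insertion of \<open>B'\<close>, the image of
      \<open>B\<close> under \<open>\<sigma>\<close>.\<close>
    obtain U where U: "idm U" "psub \<sigma> (\<tau> j) =b happ U (Var j)" using econv_Var[OF inv2] by blast
    define B' where "B' = map (psub ((up ^^ p) \<sigma>)) B"
    have lenB': "length B' = K" by (simp add: B'_def lenB)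
    have "apps (shift p (psub \<sigma> (\<tau> j))) (vars p) =b psub ((up ^^ p) \<sigma>) (apps (Var (i + p)) B)"
      unfolding apps_shift_vars_psub using B h by (intro bconv_psub) simp
    also have "\<dots> = apps (shift p (\<sigma> i)) B'"
      by (simp add: psub_apps upn B'_def)
    also have "\<dots> = psub (inst B' p) (apps (shift K (\<sigma> i)) (vars K))"
      using psub_inst_apps_vars[of B' p "\<sigma> i"] lenB' by simp
    also have "\<dots> =b psub (inst B' p) (apps (Var (j + K)) A)"
      by (intro bconv_psub A)
    also have "\<dots> = apps (Var (j + p)) (map (psub (inst B' p)) A)"
      by (simp add: psub_apps inst_def lenB')
    finally have E4: "apps (shift p (psub \<sigma> (\<tau> j))) (vars p) =b \<dots>" .
    have E5: "apps (shift p (happ U (Var j))) (vars p) =b apps (Var (j + p)) (map (psub (inst B' p)) A)"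
      using equivclp_trans[OF bconv_apps_head[OF bconv_ren[OF equivclp_sym[OF U(2)]]] E4] .
    then have "arity U \<le> length (vars p)"
      unfolding happ.simps[of U "Var j"] ren_absn by (rule apps_absn_bconv_Var_le)
    then have "arity U \<le> p" by simp
    from apps_happ_vars[OF U(1) this, of j] E5
    have "apps (Var (j + p)) (map (\<lambda>q. happ (kid U q) (Var (p - Suc q))) [0..<p]) =b
      apps (Var (j + p)) (map (psub (inst B' p)) A)"
      by (meson equivclp_sym equivclp_trans)
    from apps_Var_unique[OF this] have
      "list_all2 bconv (map (\<lambda>q. happ (kid U q) (Var (p - Suc q))) [0..<p]) (map (psub (inst B' p)) A)"
      by blast
    from list_all2_nthD[OF this, of q] have "happ (kid U q) (Var (p - Suc q)) =b psub (inst B' p) (A ! q)"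
      using q by (simp add: p_def)
    then have "psub (inst B' p) (A ! q) =e happ (kid U q) (Var (p - Suc q))"
      by (rule bconv_econv[OF equivclp_sym])
    also have "\<dots> =e Var (p - Suc q)" by (intro happ_idm_econv idm_kid U)
    finally have "psub ((up ^^ p) \<tau>) (psub (inst B' p) (A ! q)) =e psub ((up ^^ p) \<tau>) (Var (p - Suc q))"
      by (rule econv_psub)
    moreover have "psub ((up ^^ p) \<tau>) (Var (p - Suc q)) = Var (p - Suc q)"
      using q by (simp add: upn)
    \<comment> \<open>Two routes from \<open>A ! q\<close> agree: applying \<open>\<tau>\<close> and
      then inserting \<open>B\<close>, or inserting \<open>B'\<close> and then applying
      \<open>\<tau>\<close>, which cancels the \<open>\<sigma>\<close> in \<open>B'\<close>.\<close>
    moreover have "psub (inst B p) (psub ((up ^^ K) \<tau>) (A ! q)) =e psub ((up ^^ p) \<tau>) (psub (inst B' p) (A ! q))"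
      unfolding psub_psub
    proof (rule econv_psub_fun)
      fix v
      have id: "psub ((up ^^ p) \<tau>) ((up ^^ p) \<sigma> w) =e Var w" for w
      proof (cases "w < p")
        case True
        then show ?thesis by (simp add: upn)
      next
        case False
        have "psub ((up ^^ p) \<tau>) (shift p s) = shift p (psub \<tau> s)" for s
          by (simp add: psub_ren ren_psub upn)
        then show ?thesis
          using False econv_ren[OF inv1[of "w - p"], of "\<lambda>i. i + p"] by (simp add: upn)
      qed
      show "psub (inst B p) ((up ^^ K) \<tau> v) =e psub ((up ^^ p) \<tau>) (inst B' p v)"
      proof (cases "v < K")
        case True
        have "psub ((up ^^ p) \<tau>) (psub ((up ^^ p) \<sigma>) s) =e psub Var s" for s
          unfolding psub_psub by (rule econv_psub_fun) (rule id)
        then have "psub ((up ^^ p) \<tau>) (psub ((up ^^ p) \<sigma>) s) =e s" for s by simp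
        then show ?thesis
          using True by (simp add: upn inst_def lenB lenB' B'_def equivclp_sym)
      next
        case False
        then obtain w where w: "v = w + K" by (metis le_add_diff_inverse2 not_less)
        have "psub (inst B p) (shift K s) = shift p s" for s
          unfolding psub_ren by (simp add: inst_def lenB ren_conv_psub)
        then show ?thesis
          by (simp add: w upn inst_def lenB')
      qed
    qed
    ultimately show ?thesis
      using q by (simp add: A'_def p_def) (metis equivclp_trans)
  qed
  show thesis
  proof (rule that[of j A p B A'])
    show "headvar (\<sigma> i) j" using a by (auto simp: headvar_def)
    show "headvar (\<tau> j) i" using c h by (auto simp: headvar_def)
  qed (use A B h c1 c2 lenB in \<open>simp_all add: p_def A'_def\<close>)
qed

lemma hnf_happ_econv:
  assumes "length Ms = n" "inj_on h {..<n}" "\<And>q. q < n \<Longrightarrow> h q < n"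
    and "\<And>q. q < n \<Longrightarrow> \<exists>T. wfh T \<and> Ms ! q =e happ T (Var (h q))"
  shows "\<exists>T. wfh T \<and> hnf n (j + n) Ms =e happ T (Var j)"
proof -
  obtain f where f: "wfh (f q)" "Ms ! q =e happ (f q) (Var (h q))" if "q < n" for q
    using assms(4) by metis
  \<comment> \<open>The arguments name variables by de Bruijn index; reflection turns these indices
    into positions.\<close>
  define r where "r q = (if q < n then n - Suc (h q) else q)" for q
  have "inj_on r {..<n}"
  proof (rule inj_onI)
    fix q q' assume "q \<in> {..<n}" "q' \<in> {..<n}" "r q = r q'"
    moreover from this have "h q < n" "h q' < n" using assms(3) by auto
    ultimately have "h q = h q'" by (simp add: r_def)
    with \<open>q \<in> _\<close> \<open>q' \<in> _\<close> show "q = q'" using assms(2) by (meson inj_onD)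
  qed
  moreover have "r ` {..<n} \<subseteq> {..<n}" by (auto simp: r_def)
  ultimately have "r permutes {..<n}"
    by (intro bij_imp_permutes bij_betw_imageI endo_inj_surj) (auto simp: r_def)
  then obtain T where T: "wfh T" "perm T = r" "arity T = n" "\<forall>i<n. kid T i = f i"
    using wfh_build[of r n f] f(1) by auto
  have "n - Suc (r q) = h q" if "q < n" for q
    using assms(3)[OF that] that by (simp add: r_def)
  then have "hnf n (j + n) Ms =e happ T (Var j)"
    unfolding happ_Var[of T] T(3) hnf_def using assms(1)
    by (intro econv_absn econv_apps equivclp_refl) (simp add: list_all2_conv_all_nth T f)
  with T(1) show ?thesis by blast
qed

lemma inj_on_rev:
  assumes "inj g"
  shows "inj_on (\<lambda>q. g (K - Suc q)) {..<K}"
proof (rule inj_onI)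
  fix q q' assume "q \<in> {..<K}" "q' \<in> {..<K}" "g (K - Suc q) = g (K - Suc q')"
  moreover from this(3) have "K - Suc q = K - Suc q'" by (rule injD[OF assms])
  ultimately show "q = q'" by simp
qed

text \<open>\<open>n\<close> and \<open>n'\<close> bound the blocks on which the substitutions act;
  beyond them variables are only renumbered. The bounds are kept apart because at a node they become
  the numbers of binders and of arguments, whose equality is a conclusion. The bound
  \<open>m\<close> on the expansions from the first composition is the induction measure.\<close>

lemma inverse_subst:
  assumes "\<And>i. psub \<tau> (\<sigma> i) =e Var i" "\<And>i. psub \<sigma> (\<tau> i) =e Var i"
    and "\<And>i. \<sigma> (n + i) = Var (n' + i)" "\<And>i. \<tau> (n' + i) = Var (n + i)"
    and "\<And>i. i < n \<Longrightarrow> \<exists>T. idm T \<and> size T < m \<and> psub \<tau> (\<sigma> i) =b happ T (Var i)"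
  shows "n = n' \<and> (\<exists>f. f permutes {..<n} \<and>
    (\<forall>i<n. \<exists>T. wfh T \<and> \<sigma> i =e happ T (Var (f i))) \<and>
    (\<forall>i<n. \<exists>T. wfh T \<and> \<tau> (f i) =e happ T (Var i)))"
  using assms
proof (induction m arbitrary: \<sigma> \<tau> n n' rule: less_induct)
  case (less m)
  note inv = less.prems(1,2)
  \<comment> \<open>Stated for arbitrary inverse pairs, because exchanging the roles of
    \<open>\<sigma>\<close> and \<open>\<tau>\<close> gives surjectivity of
    \<open>f\<close>.\<close>
  have heads: "\<exists>j. headvar (\<sigma>' i) j \<and> headvar (\<tau>' j) i"
    if inv': "\<And>i. psub \<tau>' (\<sigma>' i) =e Var i" "\<And>i. psub \<sigma>' (\<tau>' i) =e Var i" for \<sigma>' \<tau>' i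
  proof -
    obtain T where "idm T" "psub \<tau>' (\<sigma>' i) =b happ T (Var i)" using econv_Var[OF inv'(1)] by blast
    then show ?thesis by (rule inverse_subst_step[OF inv' _ _ refl]) blast
  qed
  then obtain f where f: "headvar (\<sigma> i) (f i)" "headvar (\<tau> (f i)) i" for i
    using inv by metis
  have "inj f"
    by (rule injI) (metis f(2) headvar_unique)
  have surj: "\<exists>i. f i = j" for j
    using heads[OF inv(2,1), of j] f(1) headvar_unique by metis
  have f_tail: "f (n + i) = n' + i" for i
    using f(1)[of "n + i"] less.prems(3) headvar_Var headvar_unique by metis
  have f_less: "f i < n' \<longleftrightarrow> i < n" for i
  proof
    assume "f i < n'"
    then show "i < n" using f_tail[of "i - n"] by (cases "i < n") auto
  next
    assume "i < n"
    show "f i < n'"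
    proof (rule ccontr)
      assume "\<not> f i < n'"
      then have "f i = f (n + (f i - n'))" using f_tail[of "f i - n'"] by linarith
      then have "i = n + (f i - n')" using \<open>inj f\<close> by (simp add: inj_eq)
      with \<open>i < n\<close> show False by simp
    qed
  qed
  have im: "f ` {..<n} = {..<n'}"
  proof (intro equalityI subsetI)
    fix j assume "j \<in> {..<n'}"
    moreover obtain i where "f i = j" using surj by blast
    ultimately show "j \<in> f ` {..<n}" using f_less[of i] by auto
  qed (auto simp: f_less)
  have n': "n' = n"
    using arg_cong[OF im, of card] card_image[OF inj_on_subset[OF \<open>inj f\<close>], of "{..<n}"] by simp
  have perm: "f permutes {..<n}"
  proof (rule bij_imp_permutes)
    show "bij_betw f {..<n} {..<n}"
      using \<open>inj f\<close> im n' by (auto simp: bij_betw_def intro: inj_on_subset)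
    show "f x = x" if "x \<notin> {..<n}" for x
      using f_tail[of "x - n"] that n' by simp
  qed
  have main: "(\<exists>T. wfh T \<and> \<sigma> i =e happ T (Var (f i))) \<and> (\<exists>T. wfh T \<and> \<tau> (f i) =e happ T (Var i))"
    if i: "i < n" for i
  proof -
    obtain T where T: "idm T" "size T < m" "psub \<tau> (\<sigma> i) =b happ T (Var i)"
      using less.prems(5)[OF i] by blast
    define K where "K = arity T"
    obtain j A B p A' where j: "headvar (\<sigma> i) j" and
      AB: "length A = p" "length B = K" "A' = map (psub ((up ^^ K) \<tau>)) A" and
      \<sigma>: "apps (shift K (\<sigma> i)) (vars K) =b apps (Var (j + K)) A" and
      \<tau>: "apps (shift p (\<tau> j)) (vars p) =b apps (Var (i + p)) B" and
      c1: "\<And>q. q < K \<Longrightarrow> psub (inst A' K) (B ! q) =b happ (kid T q) (Var (K - Suc q))" and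
      c2: "\<And>q. q < p \<Longrightarrow> psub (inst B p) (A' ! q) =e Var (p - Suc q)"
      by (rule inverse_subst_step[OF inv T(1,3) K_def]) blast
    have jf: "j = f i" using j f(1) headvar_unique by blast
    have lenA': "length A' = p" using AB by simp
    have c1': "psub (inst A' K) (inst B p v) =b happ (kid T (K - Suc v)) (Var v)" if "v < K" for v
      using c1[of "K - Suc v"] that AB(2) by (simp add: inst_def)
    \<comment> \<open>The new pair is \<open>inst B p\<close> and \<open>inst A' K\<close>, with
      blocks of \<open>K\<close> and \<open>p\<close> variables. The children of \<open>T\<close>
      are smaller than \<open>T\<close>, so \<open>size T\<close> is the new bound.\<close>
    have "K = p \<and> (\<exists>g. g permutes {..<K} \<and>
      (\<forall>i<K. \<exists>T. wfh T \<and> inst B p i =e happ T (Var (g i))) \<and>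
      (\<forall>i<K. \<exists>T. wfh T \<and> inst A' K (g i) =e happ T (Var i)))"
    proof (rule less.IH[OF T(2)])
      show "psub (inst A' K) (inst B p v) =e Var v" for v
      proof (cases "v < K")
        case True
        have "psub (inst A' K) (inst B p v) =e happ (kid T (K - Suc v)) (Var v)"
          using True by (intro bconv_econv c1')
        also have "\<dots> =e Var v" by (intro happ_idm_econv idm_kid T)
        finally show ?thesis .
      next
        case False
        then obtain w where "v = w + K" by (metis le_add_diff_inverse2 not_less)
        then show ?thesis by (simp add: inst_def AB(2) lenA')
      qed
      show "psub (inst B p) (inst A' K v) =e Var v" for v
      proof (cases "v < p")
        case True
        then show ?thesis using c2[of "p - Suc v"] by (simp add: inst_def lenA')
      next
        case False
        then obtain w where "v = w + p" by (metis le_add_diff_inverse2 not_less)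
        then show ?thesis by (simp add: inst_def AB(2) lenA')
      qed
      show "\<exists>U. idm U \<and> size U < size T \<and> psub (inst A' K) (inst B p v) =b happ U (Var v)" if "v < K" for v
        using c1'[OF that] T(1) that
        by (intro exI[of _ "kid T (K - Suc v)"]) (simp add: idm_kid size_kid K_def)
    qed (simp_all add: inst_def AB(2) lenA')
    then obtain g where Kp: "p = K" and g: "g permutes {..<K}"
      "\<And>i. i < K \<Longrightarrow> \<exists>T. wfh T \<and> inst B p i =e happ T (Var (g i))"
      "\<And>i. i < K \<Longrightarrow> \<exists>T. wfh T \<and> inst A' K (g i) =e happ T (Var i)"
      by blast
    have ext: "s =e hnf K (x + K) Ms" if "apps (shift K s) (vars K) =b apps (Var (x + K)) Ms" for s x Ms
    proof -
      have "(Abs ^^ K) (apps (shift K s) (vars K)) =e hnf K (x + K) Ms"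
        unfolding hnf_def by (intro econv_absn bconv_econv that)
      then show ?thesis using eta_absn[of K s] by (meson equivclp_sym equivclp_trans)
    qed
    have "\<exists>T. wfh T \<and> hnf K (f i + K) A =e happ T (Var (f i))"
    proof (rule hnf_happ_econv)
      \<comment> \<open>The hypothesis finds the expansion of variable \<open>i\<close> at index
        \<open>g i\<close> of \<open>inst A' K\<close>, so the variables below the arguments are
        given by the inverse of \<open>g\<close>.\<close>
      define h where "h = inv_into UNIV g"
      have h: "h permutes {..<K}" "g (h v) = v" for v
        unfolding h_def using g(1) by (auto simp: permutes_inv permutes_inverses)
      show "inj_on (\<lambda>q. h (K - Suc q)) {..<K}"
        by (rule inj_on_rev[OF permutes_inj[OF h(1)]])
      show less: "h (K - Suc q) < K" if "q < K" for q
        using permutes_in_image[OF h(1), of "K - Suc q"] that by simp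
      show "\<exists>T. wfh T \<and> A ! q =e happ T (Var (h (K - Suc q)))" if q: "q < K" for q
      proof -
        obtain Y where Y: "wfh Y" "inst A' K (g (h (K - Suc q))) =e happ Y (Var (h (K - Suc q)))"
          using g(3)[OF less[OF q]] by blast
        have "psub ((up ^^ K) \<tau>) (A ! q) =e happ Y (Var (h (K - Suc q)))"
          using Y(2) q AB by (simp add: h(2) inst_def Kp)
        \<comment> \<open>The hypothesis speaks about \<open>A'\<close>, the image of
          \<open>A\<close> under \<open>\<tau>\<close>. Applying \<open>\<sigma>\<close> recovers
          \<open>A\<close>, and the right side stays because its variable is bound by the
          block.\<close>
        then have "psub ((up ^^ K) \<sigma>) (psub ((up ^^ K) \<tau>) (A ! q)) =e
          psub ((up ^^ K) \<sigma>) (happ Y (Var (h (K - Suc q))))"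
          by (rule econv_psub)
        moreover have "psub ((up ^^ K) \<sigma>) (happ Y (Var (h (K - Suc q)))) = happ Y (Var (h (K - Suc q)))"
          using less[OF q] by (simp add: psub_happ upn)
        moreover have "psub ((up ^^ K) \<sigma>) (psub ((up ^^ K) \<tau>) (A ! q)) =e psub Var (A ! q)"
          unfolding psub_psub
        proof (rule econv_psub_fun)
          fix w
          have "psub ((up ^^ K) \<sigma>) (shift K s) = shift K (psub \<sigma> s)" for s
            by (simp add: psub_ren ren_psub upn)
          then show "psub ((up ^^ K) \<sigma>) ((up ^^ K) \<tau> w) =e Var w"
            using econv_ren[OF inv(2)[of "w - K"], of "\<lambda>i. i + K"] by (cases "w < K") (simp_all add: upn)
        qed
        ultimately have "A ! q =e happ Y (Var (h (K - Suc q)))"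
          by simp (meson equivclp_sym equivclp_trans)
        with Y(1) show ?thesis by blast
      qed
    qed (simp add: AB Kp)
    moreover have "\<exists>T. wfh T \<and> hnf K (i + K) B =e happ T (Var i)"
    proof (rule hnf_happ_econv)
      show "inj_on (\<lambda>q. g (K - Suc q)) {..<K}"
        by (rule inj_on_rev[OF permutes_inj[OF g(1)]])
      show "g (K - Suc q) < K" if "q < K" for q
        using permutes_in_image[OF g(1), of "K - Suc q"] that by simp
      show "\<exists>T. wfh T \<and> B ! q =e happ T (Var (g (K - Suc q)))" if "q < K" for q
        using g(2)[of "K - Suc q"] that AB(2) by (simp add: inst_def)
    qed (simp add: AB)
    ultimately show ?thesis
      using ext \<sigma> \<tau> unfolding Kp jf by (meson equivclp_trans)
  qed
  show ?case using n' perm main by blast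
qed

lemma inverse_to_tm:
  assumes "comp M N =e comb_I" "comp N M =e comb_I"
  shows "\<exists>T. wfh T \<and> M =e to_tm T"
proof -
  \<comment> \<open>Turns a term into a substitution for one variable, so that composing terms
    becomes composing substitutions; \<open>ren Suc\<close> keeps the free variables of
    \<open>M\<close> apart from that variable.\<close>
  define S where "S M = case_nat (App (ren Suc M) (Var 0)) (\<lambda>i. Var (Suc i))" for M
  have psub: "psub (S N) (S M 0) = App (ren Suc M) (App (ren Suc N) (Var 0))" for M N
  proof -
    have "psub (S N) (ren Suc M) = ren Suc M"
      unfolding psub_ren by (simp add: S_def ren_conv_psub)
    then show ?thesis by (simp add: S_def)
  qed
  have inv: "psub (S N) (S M i) =e Var i" if "comp M N =e comb_I" for M N i
  proof (cases i)
    case 0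
    have "App (ren Suc M) (App (ren Suc N) (Var 0)) =e App (ren Suc (comp M N)) (Var 0)"
      by (intro bconv_econv equivclp_sym[OF App_ren_comp])
    also have "\<dots> =e App (ren Suc comb_I) (Var 0)"
      by (intro econv_App econv_ren that equivclp_refl)
    also have "\<dots> =e Var 0"
      using bconv_econv[OF App_to_tm[of Suc triv "Var 0"]] by (simp add: to_tm_triv)
    finally show ?thesis using 0 psub by simp
  qed (simp add: S_def)
  obtain T where T: "idm T" "psub (S N) (S M 0) =b happ T (Var 0)"
    using econv_Var[OF inv[OF assms(1)]] by blast
  have "(1::nat) = 1 \<and> (\<exists>f. f permutes {..<1} \<and>
    (\<forall>i<1. \<exists>T. wfh T \<and> S M i =e happ T (Var (f i))) \<and>
    (\<forall>i<1. \<exists>T. wfh T \<and> S N (f i) =e happ T (Var i)))"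
    by (rule inverse_subst[of _ _ _ _ "Suc (size T)"])
      (use inv assms T in \<open>auto simp: S_def\<close>)
  then obtain f T where "f permutes {..<1::nat}" "wfh T" "S M 0 =e happ T (Var (f 0))" by auto
  moreover have "f 0 = 0"
    using permutes_in_image[OF \<open>f permutes _\<close>, of 0] by simp
  ultimately have "wfh T" "Abs (S M 0) =e to_tm T"
    by (simp_all add: to_tm_def econv_Abs)
  moreover have "Abs (S M 0) =e M"
    unfolding S_def using eta_econv[OF eta_wrap] by simp
  ultimately show ?thesis by (meson equivclp_sym equivclp_trans)
qed

section \<open>Inverse monoids with a greatest element above each element\<close>

context inverse_monoid
begin

definition idem :: "'a \<Rightarrow> bool" where
  "idem e \<longleftrightarrow> e \<in> carrier G \<and> e \<otimes> e = e"

lemma star_mult_star: "u \<in> carrier G \<Longrightarrow> star u \<otimes> u \<otimes> star u = star u"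
  using mult_star_mult[of "star u"] by (simp add: star_closed star_star)

lemma idem_mult_star: "u \<in> carrier G \<Longrightarrow> idem (u \<otimes> star u)"
  unfolding idem_def by (metis m_assoc m_closed mult_star_mult star_closed)

text \<open>The product of \<open>e\<close>, \<open>star e\<close>, \<open>star e\<close>,
  \<open>e\<close> evaluates to \<open>e\<close>; by \<open>idem_commute\<close> it equals the
  product of \<open>star e\<close>, \<open>e\<close>, \<open>e\<close>, \<open>star e\<close>, which
  is \<open>star e\<close>.\<close>

lemma idem_star:
  assumes "idem e"
  shows "star e = e"
proof -
  have e: "e \<in> carrier G" "star e \<in> carrier G" "e \<otimes> e = e"
    using assms by (auto simp: idem_def star_closed)
  have s: "star e \<otimes> star e = star e" using e star_mult[of e e] by simp
  have "(e \<otimes> star e) \<otimes> (star e \<otimes> e) = (star e \<otimes> e) \<otimes> (e \<otimes> star e)"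
    using idem_commute[of e "star e"] e by (simp add: star_star)
  moreover have "(e \<otimes> star e) \<otimes> (star e \<otimes> e) = e \<otimes> (star e \<otimes> star e) \<otimes> e"
    using e(1,2) by (simp add: m_assoc)
  moreover have "(star e \<otimes> e) \<otimes> (e \<otimes> star e) = star e \<otimes> (e \<otimes> e) \<otimes> star e"
    using e(1,2) by (simp add: m_assoc)
  ultimately show ?thesis
    using e s by (simp add: mult_star_mult star_mult_star)
qed

lemma idem_mult_star_self: "idem e \<Longrightarrow> e \<otimes> star e = e"
  using idem_star[of e] by (simp add: idem_def)

lemma idem_comm: "idem e \<Longrightarrow> idem f \<Longrightarrow> e \<otimes> f = f \<otimes> e"
  using idem_commute[of e f] idem_mult_star_self[of e] idem_mult_star_self[of f]
  by (simp add: idem_def)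

text \<open>The order becomes multiplication by an idempotent; since idempotents commute, the second
  \<open>e\<close>, contributed by \<open>star u\<close>, is absorbed by the first.\<close>

lemma nat_le_iff:
  assumes "u \<in> carrier G" "v \<in> carrier G"
  shows "nat_le G star u v \<longleftrightarrow> (\<exists>e. idem e \<and> u = e \<otimes> v)"
proof
  assume "nat_le G star u v"
  then show "\<exists>e. idem e \<and> u = e \<otimes> v"
    using idem_mult_star[OF assms(1)] unfolding nat_le_def by metis
next
  assume "\<exists>e. idem e \<and> u = e \<otimes> v"
  then obtain e where e: "idem e" "u = e \<otimes> v" by blast
  then have c: "e \<in> carrier G" "e \<otimes> e = e" "star v \<in> carrier G"
    using assms by (auto simp: idem_def star_closed)
  have "u \<otimes> star u \<otimes> v = e \<otimes> ((v \<otimes> star v) \<otimes> e) \<otimes> v"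
    using e assms c by (simp add: star_mult idem_star m_assoc)
  also have "\<dots> = e \<otimes> (e \<otimes> (v \<otimes> star v)) \<otimes> v"
    using idem_comm[OF idem_mult_star e(1)] assms by simp
  also have "\<dots> = (e \<otimes> e) \<otimes> (v \<otimes> star v \<otimes> v)"
    using assms c(1,3) by (simp add: m_assoc)
  also have "\<dots> = u" using e c assms by (simp add: mult_star_mult)
  finally show "nat_le G star u v" by (simp add: nat_le_def)
qed

lemma nat_le_antisym:
  assumes "u \<in> carrier G" "v \<in> carrier G" "nat_le G star u v" "nat_le G star v u"
  shows "u = v"
proof -
  obtain e f where ef: "idem e" "u = e \<otimes> v" "idem f" "v = f \<otimes> u"
    using assms nat_le_iff by metis
  then have c: "e \<in> carrier G" "f \<in> carrier G" "e \<otimes> e = e" by (auto simp: idem_def)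
  have "u = e \<otimes> (f \<otimes> (e \<otimes> v))" using ef by metis
  also have "\<dots> = (e \<otimes> f) \<otimes> (e \<otimes> v)" using c assms by (simp add: m_assoc)
  also have "\<dots> = f \<otimes> ((e \<otimes> e) \<otimes> v)"
    unfolding idem_comm[OF ef(1,3)] using c(1,2) assms by (simp add: m_assoc)
  also have "\<dots> = v" using ef c by metis
  finally show ?thesis .
qed

end

text \<open>Transport of a group along a bijection; the quotient and the maximal elements are both
  obtained this way from one group.\<close>

lemma group_image:
  assumes "group H" "inj_on k (carrier H)" "k ` carrier H = carrier K" "k \<one>\<^bsub>H\<^esub> = \<one>\<^bsub>K\<^esub>"
    and "\<And>x y. x \<in> carrier H \<Longrightarrow> y \<in> carrier H \<Longrightarrow> k (x \<otimes>\<^bsub>H\<^esub> y) = k x \<otimes>\<^bsub>K\<^esub> k y"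
  shows "group K" "H \<cong> K"
proof -
  interpret H: group H by fact
  have iso: "k \<in> iso H K"
    using assms by (auto simp: iso_def hom_def bij_betw_def)
  then show HK: "H \<cong> K" by (rule is_isoI)
  have "monoid K"
  proof (rule monoidI; (unfold assms(3)[symmetric])?)
    show "x \<otimes>\<^bsub>K\<^esub> y \<in> k ` carrier H" if "x \<in> k ` carrier H" "y \<in> k ` carrier H" for x y
      using that by (auto simp flip: assms(5))
    show "\<one>\<^bsub>K\<^esub> \<in> k ` carrier H"
      unfolding assms(4)[symmetric] by simp
    show "x \<otimes>\<^bsub>K\<^esub> y \<otimes>\<^bsub>K\<^esub> z = x \<otimes>\<^bsub>K\<^esub> (y \<otimes>\<^bsub>K\<^esub> z)"
      if "x \<in> k ` carrier H" "y \<in> k ` carrier H" "z \<in> k ` carrier H" for x y z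
      using that by (auto simp: H.m_assoc simp flip: assms(5))
    show "\<one>\<^bsub>K\<^esub> \<otimes>\<^bsub>K\<^esub> x = x" "x \<otimes>\<^bsub>K\<^esub> \<one>\<^bsub>K\<^esub> = x" if "x \<in> k ` carrier H" for x
      unfolding assms(4)[symmetric] using that by (auto simp flip: assms(5))
  qed
  then show "group K" by (rule H.iso_imp_group[OF HK])
qed

text \<open>The kernel condition makes \<open>sigma\<close> the kernel relation of \<open>q\<close>,
  so its classes are the fibres of \<open>q\<close>. The conditions on \<open>norm\<close> say that
  it yields the greatest element above each element, hence one maximal element per fibre.\<close>

lemma (in inverse_monoid) group_quotients:
  assumes H: "group H" and q: "q \<in> hom G H" and surj: "q ` carrier G = carrier H"
    and ker: "\<And>x. x \<in> carrier G \<Longrightarrow> q x = \<one>\<^bsub>H\<^esub> \<Longrightarrow> idem x"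
    and norm: "\<And>x. x \<in> carrier G \<Longrightarrow> norm x \<in> carrier G"
      "\<And>x. x \<in> carrier G \<Longrightarrow> \<exists>e. idem e \<and> x = e \<otimes> norm x"
      "\<And>e x. idem e \<Longrightarrow> x \<in> carrier G \<Longrightarrow> norm (e \<otimes> x) = norm x"
  shows "\<forall>s\<in>carrier G. \<exists>!m. maximal_in G star (up_set G star s) m"
    and "group (quotient_struct G (sigma G star))" and "group (max_struct G star)"
    and "H \<cong> quotient_struct G (sigma G star)"
    and "quotient_struct G (sigma G star) \<cong> max_struct G star"
proof -
  interpret H: group H by fact
  have q_closed [simp]: "q x \<in> carrier H" if "x \<in> carrier G" for x
    using q that by (rule hom_in_carrier)
  have q_mult [simp]: "q (x \<otimes> y) = q x \<otimes>\<^bsub>H\<^esub> q y" if "x \<in> carrier G" "y \<in> carrier G" for x y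
    using q that by (rule hom_mult)
  have q_idem: "q e = \<one>\<^bsub>H\<^esub>" if "idem e" for e
  proof -
    have e: "e \<in> carrier G" "e \<otimes> e = e" using that by (auto simp: idem_def)
    have "q e \<otimes>\<^bsub>H\<^esub> q e = q e" using q_mult[OF e(1) e(1)] e(2) by simp
    then show ?thesis using e(1) by (simp add: H.l_cancel_one)
  qed
  have q_one: "q \<one> = \<one>\<^bsub>H\<^esub>" by (rule q_idem) (simp add: idem_def)
  have le_q: "q x = q y" if "nat_le G star x y" "x \<in> carrier G" "y \<in> carrier G" for x y
    using that nat_le_iff q_idem by (auto simp: idem_def)
  have le_norm: "nat_le G star x (norm x)" if "x \<in> carrier G" for x
    using that norm(1,2) nat_le_iff by blast
  have norm_le: "norm x = norm y" if "nat_le G star x y" "x \<in> carrier G" "y \<in> carrier G" for x y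
    using that nat_le_iff norm(3) by metis
  have norm_norm: "norm (norm x) = norm x" if "x \<in> carrier G" for x
    using norm_le[OF le_norm] norm(1) that by metis
  have q_norm: "q (norm x) = q x" if "x \<in> carrier G" for x
    using le_q[OF le_norm] norm(1) that by metis
  have max_up: "maximal_in G star (up_set G star s) m \<longleftrightarrow> m = norm s" if s: "s \<in> carrier G" for s m
  proof
    assume m: "maximal_in G star (up_set G star s) m"
    then have "m \<in> carrier G" "nat_le G star s m" by (auto simp: maximal_in_def up_set_def)
    then have eq: "norm m = norm s" using norm_le s by metis
    then have "norm m \<in> up_set G star s" using le_norm norm(1) s by (simp add: up_set_def)
    then show "m = norm s"
      using m eq le_norm[OF \<open>m \<in> carrier G\<close>] unfolding maximal_in_def by metis
  next
    assume m: "m = norm s"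
    show "maximal_in G star (up_set G star s) m"
      unfolding maximal_in_def
    proof (intro conjI ballI impI)
      show "m \<in> up_set G star s" using m le_norm norm(1) s by (simp add: up_set_def)
      fix v assume "v \<in> up_set G star s" "nat_le G star m v"
      then have v: "v \<in> carrier G" "nat_le G star s v" "nat_le G star m v" by (auto simp: up_set_def)
      then have "norm v = m" using norm_le s m by metis
      then have "nat_le G star v m" using le_norm v by metis
      then show "v = m" using nat_le_antisym v m norm(1) s by metis
    qed
  qed
  then show "\<forall>s\<in>carrier G. \<exists>!m. maximal_in G star (up_set G star s) m" by auto
  have max_above: "max_above G star s = norm s" if "s \<in> carrier G" for s
    using max_up[OF that] by (simp add: max_above_def)
  have max_carrier: "maximal_in G star (carrier G) m \<longleftrightarrow> m \<in> carrier G \<and> norm m = m" for m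
  proof
    assume "maximal_in G star (carrier G) m"
    then show "m \<in> carrier G \<and> norm m = m"
      using le_norm norm(1) unfolding maximal_in_def by metis
  next
    assume m: "m \<in> carrier G \<and> norm m = m"
    show "maximal_in G star (carrier G) m"
      unfolding maximal_in_def
    proof (intro conjI ballI impI)
      fix v assume v: "v \<in> carrier G" "nat_le G star m v"
      then have "norm v = m" using norm_le m by metis
      then have "nat_le G star v m" using le_norm v by metis
      then show "v = m" using nat_le_antisym v m by metis
    qed (use m in blast)
  qed

  have sigma: "sigma G star = {(t, u). t \<in> carrier G \<and> u \<in> carrier G \<and> q t = q u}"
  proof (intro equalityI subsetI; clarify)
    fix t u assume "(t, u) \<in> sigma G star"
    then show "t \<in> carrier G \<and> u \<in> carrier G \<and> q t = q u"
      unfolding sigma_def using le_q by auto metis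
  next
    fix t u assume tu: "t \<in> carrier G" "u \<in> carrier G" "q t = q u"
    note c = tu(1,2) star_closed[OF tu(1)]
    \<comment> \<open>\<open>e\<close> lies in the kernel of \<open>q\<close>, hence is idempotent,
      and \<open>t \<otimes> e\<close> is a common lower bound: it is
      \<open>t \<otimes> star t\<close> times \<open>u\<close>, and also a conjugate of
      \<open>e\<close> times \<open>t\<close>.\<close>
    define e where "e = star t \<otimes> u"
    have "q t \<otimes>\<^bsub>H\<^esub> q (star t) \<otimes>\<^bsub>H\<^esub> q t = q t"
      using mult_star_mult[OF tu(1)] c by (metis m_closed q_mult)
    then have "q t \<otimes>\<^bsub>H\<^esub> (q (star t) \<otimes>\<^bsub>H\<^esub> q t) = q t"
      using c by (simp add: H.m_assoc)
    then have "q e = \<one>\<^bsub>H\<^esub>"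
      using c tu(3) by (simp add: e_def H.r_cancel_one)
    then have e: "idem e" using ker c by (simp add: e_def)
    have e': "e \<in> carrier G" "e \<otimes> e = e" using e by (auto simp: idem_def)
    have f: "idem (star t \<otimes> t)" using idem_mult_star[OF c(3)] c by (simp add: star_star)
    have w1: "t \<otimes> e = (t \<otimes> star t) \<otimes> u" using c by (simp add: e_def m_assoc)
    have "t \<otimes> e = t \<otimes> star t \<otimes> t \<otimes> e" using c by (simp add: mult_star_mult)
    also have "\<dots> = t \<otimes> ((star t \<otimes> t) \<otimes> e)" using c e' by (simp add: m_assoc)
    also have "\<dots> = (t \<otimes> e \<otimes> star t) \<otimes> t"
      unfolding idem_comm[OF f e] using c e' by (simp add: m_assoc)
    finally have w2: "t \<otimes> e = (t \<otimes> e \<otimes> star t) \<otimes> t" .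
    have "(t \<otimes> e \<otimes> star t) \<otimes> (t \<otimes> e \<otimes> star t) = t \<otimes> (e \<otimes> ((star t \<otimes> t) \<otimes> e)) \<otimes> star t"
      using c e' by (simp add: m_assoc)
    also have "\<dots> = t \<otimes> ((e \<otimes> e) \<otimes> (star t \<otimes> t)) \<otimes> star t"
      unfolding idem_comm[OF f e] using c e'(1) by (simp add: m_assoc)
    also have "\<dots> = t \<otimes> e \<otimes> (star t \<otimes> t \<otimes> star t)"
      unfolding e'(2) using c e'(1) by (simp add: m_assoc)
    finally have "idem (t \<otimes> e \<otimes> star t)"
      using c e' by (simp add: idem_def star_mult_star)
    then have "nat_le G star (t \<otimes> e) t"
      using w2 c e' nat_le_iff by (metis m_closed)
    moreover have "nat_le G star (t \<otimes> e) u"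
      using w1 c e' nat_le_iff idem_mult_star[OF c(1)] by (metis m_closed)
    ultimately show "(t, u) \<in> sigma G star"
      using tu e' by (auto simp: sigma_def)
  qed

  let ?S = "quotient_struct G (sigma G star)"
  define k where "k z = {x \<in> carrier G. q x = z}" for z
  have cls: "sigma G star `` {x} = k (q x)" if "x \<in> carrier G" for x
    using that by (auto simp: sigma k_def)
  have kS: "k ` carrier H = carrier ?S"
    unfolding surj[symmetric] by (auto simp: quotient_struct_def quotient_def cls image_iff)
  have inj: "inj_on k (carrier H)"
    unfolding surj[symmetric] by (auto simp: inj_on_def k_def)
  have k_mult: "k (x \<otimes>\<^bsub>H\<^esub> y) = k x \<otimes>\<^bsub>?S\<^esub> k y" if "x \<in> carrier H" "y \<in> carrier H" for x y
  proof -
    have "sigma G star `` {a \<otimes> b} = k (x \<otimes>\<^bsub>H\<^esub> y)" if "a \<in> k x" "b \<in> k y" for a b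
      using that by (subst cls) (auto simp: k_def)
    moreover have "k x \<noteq> {}" "k y \<noteq> {}" using that unfolding surj[symmetric] by (auto simp: k_def)
    ultimately show ?thesis by (auto simp: quotient_struct_def)
  qed
  have k_one: "k \<one>\<^bsub>H\<^esub> = \<one>\<^bsub>?S\<^esub>"
    by (simp add: quotient_struct_def cls q_one)
  show gS: "group ?S" and HS: "H \<cong> ?S"
    using group_image[OF H inj kS k_one k_mult] by auto

  let ?M = "max_struct G star"
  \<comment> \<open>A preimage is chosen arbitrarily; two preimages are related by
    \<open>sigma\<close>, and \<open>norm\<close> agrees on them.\<close>
  define l where "l z = norm (inv_into (carrier G) q z)" for z
  have l: "l (q x) = norm x" if x: "x \<in> carrier G" for x
  proof -
    define y where "y = inv_into (carrier G) q (q x)"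
    have "y \<in> carrier G" "q y = q x"
      using x by (auto simp: y_def inv_into_into f_inv_into_f)
    then have "(y, x) \<in> sigma G star" using x sigma by blast
    then obtain w where "w \<in> carrier G" "nat_le G star w y" "nat_le G star w x"
      by (auto simp: sigma_def)
    then have "norm y = norm x" using norm_le \<open>y \<in> _\<close> x by metis
    then show ?thesis by (simp add: l_def y_def)
  qed
  have inj: "inj_on l (carrier H)"
    unfolding surj[symmetric] inj_on_def by (metis (no_types, lifting) imageE l q_norm)
  have lM: "l ` carrier H = carrier ?M"
    unfolding surj[symmetric] by (force simp: max_struct_def max_carrier l norm(1) norm_norm image_iff)
  have l_mult: "l (x \<otimes>\<^bsub>H\<^esub> y) = l x \<otimes>\<^bsub>?M\<^esub> l y" if xy: "x \<in> carrier H" "y \<in> carrier H" for x y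
  proof -
    obtain a b where ab: "x = q a" "y = q b" "a \<in> carrier G" "b \<in> carrier G"
      using xy surj by blast
    have "l x \<otimes>\<^bsub>?M\<^esub> l y = norm (norm a \<otimes> norm b)"
      using ab norm(1) by (simp add: max_struct_def l max_above)
    also have "\<dots> = l (q (norm a \<otimes> norm b))" using l[of "norm a \<otimes> norm b"] norm(1) ab by (simp del: q_mult)
    also have "\<dots> = l (x \<otimes>\<^bsub>H\<^esub> y)" using ab norm(1) q_norm by simp
    finally show ?thesis ..
  qed
  have l_one: "l \<one>\<^bsub>H\<^esub> = \<one>\<^bsub>?M\<^esub>"
  proof -
    \<comment> \<open>Multiplying \<open>\<one> = e \<otimes> norm \<one>\<close> by
      \<open>e\<close> gives \<open>e = \<one>\<close>, so the unit is its own greatest upper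
      element.\<close>
    obtain e where e: "idem e" "\<one> = e \<otimes> norm \<one>" using norm(2)[OF one_closed] by blast
    then have "e \<in> carrier G" "e \<otimes> e = e" by (auto simp: idem_def)
    have "e = e \<otimes> (e \<otimes> norm \<one>)" using e(2) \<open>e \<in> _\<close> by simp
    also have "\<dots> = (e \<otimes> e) \<otimes> norm \<one>"
      using \<open>e \<in> _\<close> norm(1) by (simp only: m_assoc one_closed)
    also have "\<dots> = \<one>" using \<open>e \<otimes> e = e\<close> e(2) by simp
    finally have "norm \<one> = \<one>" using e(2) norm(1) by simp
    then show ?thesis using l[OF one_closed] q_one by (simp add: max_struct_def)
  qed
  show "group ?M"
    using group_image[OF H inj lM l_one l_mult] by auto
  have "H \<cong> ?M"
    using group_image[OF H inj lM l_one l_mult] by auto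
  then show "?S \<cong> ?M"
    using H.iso_sym[OF HS] group.iso_sym iso_trans by metis
qed

section \<open>Composition of classes of terms\<close>

lemma equiv_beta_conv: "equiv UNIV beta_conv"
  and equiv_beta_eta_conv: "equiv UNIV beta_eta_conv"
  by (auto intro!: equivI refl_onI symI transI simp: beta_conv_iff beta_eta_conv_iff
      intro: equivclp_sym equivclp_trans)

text \<open>The union over all representatives collapses, since a congruence gives the same class
  for each choice.\<close>

lemma terms_mod_mult:
  assumes "equiv UNIV r"
    and "\<And>M M' N N'. (M, M') \<in> r \<Longrightarrow> (N, N') \<in> r \<Longrightarrow> (comp M N, comp M' N') \<in> r"
  shows "r `` {M} \<otimes>\<^bsub>terms_mod A r\<^esub> r `` {N} = r `` {comp M N}"
proof -
  have "r `` {comp M' N'} = r `` {comp M N}" if "(M, M') \<in> r" "(N, N') \<in> r" for M' N'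
    using equiv_class_eq[OF assms(1) assms(2)[OF that]] by simp
  then have "(\<Union>x\<in>r `` {M}. \<Union>y\<in>r `` {N}. r `` {comp x y}) = (\<Union>x\<in>r `` {M}. \<Union>y\<in>r `` {N}. r `` {comp M N})"
    by (intro SUP_cong refl) simp
  moreover have "r `` {M} \<noteq> {}" "r `` {N} \<noteq> {}"
    using equiv_class_self[OF assms(1)] by blast+
  ultimately show ?thesis
    by (simp add: terms_mod_def quotient_struct_def)
qed

lemma terms_mod_carrier: "carrier (terms_mod A r) = (\<lambda>M. r `` {M}) ` A"
  by (auto simp: terms_mod_def quotient_struct_def quotient_def)

lemma terms_mod_one: "\<one>\<^bsub>terms_mod A r\<^esub> = r `` {comb_I}"
  by (simp add: terms_mod_def quotient_struct_def)

section \<open>Classes of the terms of permutation trees\<close>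

definition bcls :: "tm \<Rightarrow> tm set" where "bcls M = beta_conv `` {M}"
definition ecls :: "tm \<Rightarrow> tm set" where "ecls M = beta_eta_conv `` {M}"

lemma bcls_eq_iff: "bcls M = bcls N \<longleftrightarrow> M =b N"
  unfolding bcls_def using eq_equiv_class_iff[OF equiv_beta_conv, of M N] by (simp add: beta_conv_iff)

lemma ecls_eq_iff: "ecls M = ecls N \<longleftrightarrow> M =e N"
  unfolding ecls_def using eq_equiv_class_iff[OF equiv_beta_eta_conv, of M N] by (simp add: beta_eta_conv_iff)

lemma bcls_mult: "bcls M \<otimes>\<^bsub>terms_mod A beta_conv\<^esub> bcls N = bcls (comp M N)"
  unfolding bcls_def by (rule terms_mod_mult[OF equiv_beta_conv]) (simp add: beta_conv_iff comp_cong_bconv)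

lemma ecls_mult: "ecls M \<otimes>\<^bsub>terms_mod A beta_eta_conv\<^esub> ecls N = ecls (comp M N)"
  unfolding ecls_def by (rule terms_mod_mult[OF equiv_beta_eta_conv]) (simp add: beta_eta_conv_iff comp_cong_econv)

text \<open>Taking the image under \<open>beta_eta_conv\<close> merges beta classes; it is the
  projection used as homomorphism onto the group.\<close>

lemma beta_eta_bcls: "beta_eta_conv `` bcls M = ecls M"
proof -
  have "M =e K" if "M =b N" "N =e K" for N K
    using bconv_econv[OF that(1)] that(2) by (rule equivclp_trans)
  then show ?thesis
    by (auto simp: bcls_def ecls_def beta_conv_iff beta_eta_conv_iff)
qed

abbreviation btm :: "hperm \<Rightarrow> tm set" where "btm T \<equiv> bcls (to_tm T)"
abbreviation etm :: "hperm \<Rightarrow> tm set" where "etm T \<equiv> ecls (to_tm T)"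

lemma to_tm_FHP: "wfh T \<Longrightarrow> to_tm T \<in> FHP"
  unfolding FHP_iff by (blast intro: equivclp_refl)

lemma carrier_FHP_beta: "carrier FHP_beta = btm ` {T. wfh T}"
proof -
  have "bcls ` FHP = btm ` {T. wfh T}"
    using to_tm_FHP by (auto simp: FHP_iff image_iff bcls_eq_iff)
  then show ?thesis by (simp add: terms_mod_carrier bcls_def)
qed

lemma carrier_FHP_beta_eta: "carrier FHP_beta_eta = etm ` {T. wfh T}"
proof -
  have "ecls ` FHP = etm ` {T. wfh T}"
  proof (intro equalityI image_subsetI)
    fix M assume "M \<in> FHP"
    then obtain T where "wfh T" "M =b to_tm T" by (auto simp: FHP_iff)
    then have "ecls M = etm T" "wfh T" by (simp_all add: ecls_eq_iff bconv_econv)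
    then show "ecls M \<in> etm ` {T. wfh T}" by blast
  qed (use to_tm_FHP in blast)
  then show ?thesis by (simp add: terms_mod_carrier ecls_def)
qed

lemma btm_mult: "wfh T \<Longrightarrow> wfh U \<Longrightarrow> btm T \<otimes>\<^bsub>FHP_beta\<^esub> btm U = btm (hmult T U)"
  by (simp add: bcls_mult bcls_eq_iff comp_to_tm)

lemma etm_mult: "wfh T \<Longrightarrow> wfh U \<Longrightarrow> etm T \<otimes>\<^bsub>FHP_beta_eta\<^esub> etm U = etm (hmult T U)"
  by (simp add: ecls_mult ecls_eq_iff bconv_econv comp_to_tm)

lemma btm_one: "\<one>\<^bsub>FHP_beta\<^esub> = btm triv"
  by (simp add: terms_mod_one to_tm_triv bcls_def)

lemma happ_to_tm: "happ T s =b App (ren r (to_tm T)) s"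
  using App_to_tm equivclp_sym by metis

lemma btm_inject:
  assumes "wfh T" "wfh U" "btm T = btm U"
  shows "T = U"
proof -
  have "App (ren Suc (to_tm T)) (Var 0) =b App (ren Suc (to_tm U)) (Var 0)"
    using assms(3) by (intro bconv_App bconv_ren) (simp_all add: bcls_eq_iff)
  then have "happ T (Var 0) =b happ U (Var 0)"
    using happ_to_tm App_to_tm equivclp_trans by meson
  with assms(1,2) show ?thesis using happ_Var_inject by blast
qed

lemma to_tm_idm: "idm T \<Longrightarrow> to_tm T =e comb_I"
  unfolding to_tm_def comb_I_def by (intro econv_Abs happ_idm_econv)

text \<open>Applied to a fresh variable, \<open>to_tm T\<close> is convertible to that variable and
  hence beta convertible to some expansion of it; injectivity of \<open>happ\<close> identifies the
  tree.\<close>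

lemma to_tm_econv_I:
  assumes "wfh T" "to_tm T =e comb_I"
  shows "idm T"
proof -
  have "happ T (Var 0) =e App (ren Suc (to_tm T)) (Var 0)"
    by (rule bconv_econv[OF happ_to_tm])
  also have "\<dots> =e App (ren Suc (to_tm triv)) (Var 0)"
    unfolding to_tm_triv by (intro econv_App econv_ren assms(2) equivclp_refl)
  also have "\<dots> =e Var 0"
    using bconv_econv[OF App_to_tm[of Suc triv "Var 0"]] by simp
  finally obtain U where "idm U" "happ T (Var 0) =b happ U (Var 0)"
    using econv_Var by blast
  with assms(1) show ?thesis using happ_Var_inject idm_wfh by blast
qed

lemma monoid_FHP_beta: "monoid FHP_beta"
  by (rule monoidI)
    (auto simp: carrier_FHP_beta btm_mult btm_one wfh_hmult hmult_assoc hmult_triv_left hmult_triv_right)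

definition bstar :: "tm set \<Rightarrow> tm set" where
  "bstar X = btm (hstar (inv_into {T. wfh T} btm X))"

lemma inv_btm: "wfh T \<Longrightarrow> inv_into {T. wfh T} btm (btm T) = T"
  by (rule inv_into_f_f) (auto intro: inj_onI btm_inject)

lemma inverse_monoid_FHP_beta: "inverse_monoid FHP_beta bstar"
proof -
  interpret monoid FHP_beta by (rule monoid_FHP_beta)
  show ?thesis
  proof unfold_locales
    fix X Y assume "X \<in> carrier FHP_beta"
    then obtain T where T: "X = btm T" "wfh T" by (auto simp: carrier_FHP_beta)
    note simps = T btm_mult bstar_def inv_btm wfh_hstar wfh_hmult hstar_hstar hstar_hmult hmult_hstar_hmult
    show "bstar X \<in> carrier FHP_beta" by (simp add: simps carrier_FHP_beta)
    show "bstar (bstar X) = X" by (simp add: simps)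
    show "X \<otimes>\<^bsub>FHP_beta\<^esub> bstar X \<otimes>\<^bsub>FHP_beta\<^esub> X = X" by (simp add: simps)
    assume "Y \<in> carrier FHP_beta"
    then obtain U where U: "Y = btm U" "wfh U" by (auto simp: carrier_FHP_beta)
    show "bstar (X \<otimes>\<^bsub>FHP_beta\<^esub> Y) = bstar Y \<otimes>\<^bsub>FHP_beta\<^esub> bstar X"
      by (simp add: simps U)
    show "X \<otimes>\<^bsub>FHP_beta\<^esub> bstar X \<otimes>\<^bsub>FHP_beta\<^esub> (Y \<otimes>\<^bsub>FHP_beta\<^esub> bstar Y) =
      Y \<otimes>\<^bsub>FHP_beta\<^esub> bstar Y \<otimes>\<^bsub>FHP_beta\<^esub> (X \<otimes>\<^bsub>FHP_beta\<^esub> bstar X)"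
      using idm_commute[OF idm_hmult_hstar(1)[OF T(2)] idm_hmult_hstar(1)[OF U(2)]]
      by (simp add: simps U)
  qed
qed

section \<open>Invertible elements modulo beta-eta\<close>

lemma carrier_terms_beta_eta: "carrier (terms_mod UNIV beta_eta_conv) = range ecls"
  and one_terms_beta_eta: "\<one>\<^bsub>terms_mod UNIV beta_eta_conv\<^esub> = ecls comb_I"
  by (simp_all add: terms_mod_carrier terms_mod_one ecls_def)

lemma monoid_terms_beta_eta: "monoid (terms_mod UNIV beta_eta_conv)"
proof (rule monoidI)
  let ?E = "terms_mod UNIV beta_eta_conv"
  note simps = carrier_terms_beta_eta one_terms_beta_eta ecls_mult
  show "x \<otimes>\<^bsub>?E\<^esub> y \<in> carrier ?E" if "x \<in> carrier ?E" "y \<in> carrier ?E" for x y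
    using that by (auto simp: simps)
  show "\<one>\<^bsub>?E\<^esub> \<in> carrier ?E" by (simp add: simps)
  show "x \<otimes>\<^bsub>?E\<^esub> y \<otimes>\<^bsub>?E\<^esub> z = x \<otimes>\<^bsub>?E\<^esub> (y \<otimes>\<^bsub>?E\<^esub> z)"
    if xyz: "x \<in> carrier ?E" "y \<in> carrier ?E" "z \<in> carrier ?E" for x y z
  proof -
    obtain M N K where "x = ecls M" "y = ecls N" "z = ecls K"
      using xyz by (auto simp: simps)
    then show ?thesis by (simp add: simps ecls_eq_iff bconv_econv comp_assoc)
  qed
  show "\<one>\<^bsub>?E\<^esub> \<otimes>\<^bsub>?E\<^esub> x = x" "x \<otimes>\<^bsub>?E\<^esub> \<one>\<^bsub>?E\<^esub> = x" if x: "x \<in> carrier ?E" for x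
  proof -
    obtain M where "x = ecls M" using x by (auto simp: simps)
    then show "\<one>\<^bsub>?E\<^esub> \<otimes>\<^bsub>?E\<^esub> x = x" "x \<otimes>\<^bsub>?E\<^esub> \<one>\<^bsub>?E\<^esub> = x"
      by (simp_all add: simps ecls_eq_iff comp_I_left comp_I_right)
  qed
qed

lemma Units_beta_eta: "Units (terms_mod UNIV beta_eta_conv) = carrier FHP_beta_eta"
proof (intro equalityI subsetI)
  let ?E = "terms_mod UNIV beta_eta_conv"
  note c = carrier_terms_beta_eta and o = one_terms_beta_eta
  fix x
  show "x \<in> carrier FHP_beta_eta" if "x \<in> Units ?E"
  proof -
    from that obtain M N where MN: "x = ecls M"
      "ecls N \<otimes>\<^bsub>?E\<^esub> ecls M = \<one>\<^bsub>?E\<^esub>" "ecls M \<otimes>\<^bsub>?E\<^esub> ecls N = \<one>\<^bsub>?E\<^esub>"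
      unfolding Units_def c by blast
    then have "comp N M =e comb_I" "comp M N =e comb_I"
      by (simp_all add: o ecls_mult ecls_eq_iff)
    then obtain T where "wfh T" "M =e to_tm T" using inverse_to_tm by blast
    then have "x = etm T" "wfh T" using MN(1) by (simp_all add: ecls_eq_iff)
    then show ?thesis unfolding carrier_FHP_beta_eta by blast
  qed
  show "x \<in> Units ?E" if "x \<in> carrier FHP_beta_eta"
  proof -
    from that obtain T where T: "x = etm T" "wfh T" by (auto simp: carrier_FHP_beta_eta)
    have "comp (to_tm T) (to_tm (hstar T)) =e comb_I" "comp (to_tm (hstar T)) (to_tm T) =e comb_I"
      using T(2) by (auto intro!: equivclp_trans[OF bconv_econv[OF comp_to_tm]] to_tm_idm
          simp: wfh_hstar idm_hmult_hstar)
    then have "etm T \<otimes>\<^bsub>?E\<^esub> etm (hstar T) = \<one>\<^bsub>?E\<^esub>" "etm (hstar T) \<otimes>\<^bsub>?E\<^esub> etm T = \<one>\<^bsub>?E\<^esub>"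
      by (simp_all add: ecls_mult o ecls_eq_iff)
    then show ?thesis using T(1) by (auto simp: Units_def c)
  qed
qed

text \<open>Reduces the group axioms to the fact that the units of a monoid form a group.\<close>

lemma FHP_beta_eta_units: "FHP_beta_eta = units_of (terms_mod UNIV beta_eta_conv)"
  unfolding units_of_def Units_beta_eta by (simp add: terms_mod_def quotient_struct_def)

theorem theorem4p11:
  "(\<exists>star. inverse_monoid FHP_beta star) \<and>
   group FHP_beta_eta \<and>
   carrier FHP_beta_eta = Units (terms_mod UNIV beta_eta_conv) \<and>
   (\<forall>star. inverse_monoid FHP_beta star \<longrightarrow>
      (\<forall>s\<in>carrier FHP_beta. \<exists>!m. maximal_in FHP_beta star (up_set FHP_beta star s) m) \<and>
      group (quotient_struct FHP_beta (sigma FHP_beta star)) \<and>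
      group (max_struct FHP_beta star) \<and>
      FHP_beta_eta \<cong> quotient_struct FHP_beta (sigma FHP_beta star) \<and>
      quotient_struct FHP_beta (sigma FHP_beta star) \<cong> max_struct FHP_beta star)"
proof (intro conjI allI impI)
  show "\<exists>star. inverse_monoid FHP_beta star"
    using inverse_monoid_FHP_beta by blast
  show group: "group FHP_beta_eta"
    unfolding FHP_beta_eta_units using monoid_terms_beta_eta by (rule monoid.units_group)
  show "carrier FHP_beta_eta = Units (terms_mod UNIV beta_eta_conv)"
    by (rule Units_beta_eta[symmetric])
  fix star assume "inverse_monoid FHP_beta star"
  then interpret inverse_monoid FHP_beta star .
  define norm where "norm X = btm (etan (inv_into {T. wfh T} btm X))" for X
  have norm: "norm (btm T) = btm (etan T)" if "wfh T" for T
    using that by (simp add: norm_def inv_btm)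
  \<comment> \<open>Idempotents are described by the product alone, so their identification with
    \<open>idm\<close> is valid for every star.\<close>
  have idem: "idem (btm T) \<longleftrightarrow> idm T" if "wfh T" for T
  proof -
    have "idem (btm T) \<longleftrightarrow> btm (hmult T T) = btm T"
      using that unfolding idem_def btm_mult[OF that that] by (simp add: carrier_FHP_beta)
    also have "\<dots> \<longleftrightarrow> hmult T T = T"
      using btm_inject[OF wfh_hmult[OF that that] that] by auto
    also have "\<dots> \<longleftrightarrow> idm T"
      using idem_idm[OF that] idm_idem by blast
    finally show ?thesis .
  qed
  have q_hom: "(``) beta_eta_conv \<in> hom FHP_beta FHP_beta_eta"
    by (auto simp: hom_def carrier_FHP_beta carrier_FHP_beta_eta beta_eta_bcls btm_mult etm_mult wfh_hmult)
  have q_surj: "(``) beta_eta_conv ` carrier FHP_beta = carrier FHP_beta_eta"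
    by (simp add: carrier_FHP_beta carrier_FHP_beta_eta image_image beta_eta_bcls)
  have q_ker: "idem X" if X: "X \<in> carrier FHP_beta" "beta_eta_conv `` X = \<one>\<^bsub>FHP_beta_eta\<^esub>" for X
  proof -
    obtain T where T: "X = btm T" "wfh T" using X(1) unfolding carrier_FHP_beta by blast
    then have "etm T = ecls comb_I"
      using X(2) by (simp add: beta_eta_bcls terms_mod_one ecls_def)
    with T show ?thesis by (simp add: ecls_eq_iff idem to_tm_econv_I)
  qed
  have norm_closed: "norm X \<in> carrier FHP_beta" if "X \<in> carrier FHP_beta" for X
    using that by (auto simp: carrier_FHP_beta norm etan_props)
  have norm_above: "\<exists>E. idem E \<and> X = E \<otimes>\<^bsub>FHP_beta\<^esub> norm X" if X: "X \<in> carrier FHP_beta" for X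
  proof -
    obtain T where T: "X = btm T" "wfh T" using X unfolding carrier_FHP_beta by blast
    then have "idem (btm (hmult T (hstar T)))" "X = btm (hmult T (hstar T)) \<otimes>\<^bsub>FHP_beta\<^esub> norm X"
      by (simp_all add: idem wfh_hmult wfh_hstar idm_hmult_hstar norm btm_mult etan_props hmult_hstar_etan)
    then show ?thesis by blast
  qed
  have norm_idem: "norm (E \<otimes>\<^bsub>FHP_beta\<^esub> X) = norm X" if EX: "idem E" "X \<in> carrier FHP_beta" for E X
  proof -
    obtain T U where TU: "E = btm T" "wfh T" "X = btm U" "wfh U"
      using EX by (auto simp: carrier_FHP_beta idem_def)
    with EX(1) show ?thesis by (simp add: idem btm_mult norm wfh_hmult etan_idm_hmult)
  qed
  note groups = group_quotients[OF group q_hom q_surj q_ker norm_closed norm_above norm_idem]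
  show "\<forall>s\<in>carrier FHP_beta. \<exists>!m. maximal_in FHP_beta star (up_set FHP_beta star s) m"
    by (rule groups(1))
  show "group (quotient_struct FHP_beta (sigma FHP_beta star))" by (rule groups(2))
  show "group (max_struct FHP_beta star)" by (rule groups(3))
  show "FHP_beta_eta \<cong> quotient_struct FHP_beta (sigma FHP_beta star)" by (rule groups(4))
  show "quotient_struct FHP_beta (sigma FHP_beta star) \<cong> max_struct FHP_beta star" by (rule groups(5))
qed

end
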